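(* Fix one of the three graphical flows (MCF) with $n\ge 1$, (SD) with $n\ge 1$, or (WF) with $n=2$, written as $\partial_t u+Au=N[u]$ on $\mathbb{R}^n\times(0,\infty)$, with $\alpha=2$ for (MCF) and $\alpha=4$ for (SD), (WF). There exists $\varepsilon>0$ such that the following holds. Let $v_0:\mathbb{R}^n\to\mathbb{R}$ be self-similar, i.e. $v_0(x)=\lambda^{-1}v_0(\lambda x)$ for all $\lambda>0$, $x\in\mathbb{R}^n$ (equivalently $v_0(x)=|x|\psi(x/|x|)$ for some $\psi:\mathbb{S}^{n-1}\to\mathbb{R}$), and let $p:\mathbb{R}^n\to\mathbb{R}$ satisfy $\|p\|_{L^\infty(\mathbb{R}^n)}<\infty$, with $\|\nabla v_0\|_{L^\infty(\mathbb{R}^n)}<\varepsilon$ and $\|\nabla p\|_{L^\infty(\mathbb{R}^n)}<\varepsilon$. Let $u$ be the global mild solution with initial data $u_0=v_0+p$, let $v$ be the global mild solution with initial data $v_0$, and let $\Psi(x):=v(x,1)$ be the self-similar profile, so that $v(x,t)=t^{1/\alpha}\Psi(xt^{-1/\alpha})$. Then for every compact set $K\subset\mathbb{R}^n$ and every integer $k\ge 1$, $$\lim_{t\to\infty}\left\|t^{-\frac1\alpha}u(t^{\frac1\alpha}x,t)-\Psi(x)\right\|_{C^k(K)}=0,$$ where the $C^k(K)$ norm is taken in the variable $x$.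
   Context: Flows. For $u=u(x,t)$ on $\mathbb{R}^n\times(0,\infty)$ let $w=\sqrt{1+|\nabla u|^2}$ and $\mathcal H=\mathrm{div}(\nabla u/w)$. (MCF) graphical mean curvature flow: $\partial_t u=w\,\mathrm{div}(\nabla u/w)$. Here $A=-\Delta$, $N[u]=-w^{-2}\sum_{i,j}\nabla_iu\nabla_ju\nabla_{ij}u$. (SD) graphical surface diffusion: $\partial_t u=-\mathrm{div}\left[w\left(I-\frac{\nabla u\otimes\nabla u}{w^2}\right)\nabla\mathcal H\right]$. (WF) graphical Willmore flow: $\partial_t u=-w\,\mathrm{div}\left[\frac1w\left(\left(I-\frac{\nabla u\otimes\nabla u}{w^2}\right)\nabla(w\mathcal H)-\frac12\mathcal H^2\nabla u\right)\right]$. For (SD) and (WF), $A=\Delta^2$ and the equation is rewritten (Koch–Lamm) as $\partial_tu+\Delta^2u=N[u]:=f_0[u]+\nabla_if_1^i[u]+\nabla_{ij}f_2^{ij}[u]$ (summation convention; $f_0=0$ for SD), where each component of $f_0,f_1,f_2$ is a fixed constant-coefficient linear combination of terms of the respective forms $\nabla^2u\star\nabla^2u\star\nabla^2u\star w^{-2k}P_{2k-2}(\nabla u)$ $(1\le k\le4)$; $\nabla^2u\star\nabla^2u\star w^{-2k}P_{2k-1}(\nabla u)$ $(1\le k\le 4)$; $\nabla^2u\star w^{-2k}P_{2k}(\nabla u)$ $(1\le k\le2)$. Here $\star$ denotes a product of components and $P_j(\nabla u)$ a product of $j$ first partial derivatives of $u$. Mild solution. $u$ is a (global) mild solution with initial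 data $u_0$ if $u(x,t)=e^{-tA}u_0(x)+\int_0^te^{-(t-s)A}N[u](x,s)\,ds$ for all $(x,t)\in\mathbb{R}^n\times(0,\infty)$, where $e^{-tA}$ is convolution with the heat kernel ($A=-\Delta$) or the biharmonic heat kernel ($A=\Delta^2$), and for $A=\Delta^2$ the derivatives in front of $f_1,f_2$ are moved onto the kernel by integration by parts. Function space. With $0<T\le\infty$, for (MCF): $\|f\|_{X_T}=\sup_{0<t<T}\|\nabla f(\cdot,t)\|_{L^\infty}+\sup_{x\in\mathbb{R}^n}\sup_{0<R^2<T}R^{\frac2{n+4}}\|\nabla^2f\|_{L^{n+4}(B_R(x)\times(R^2/2,R^2))}$; for (SD), (WF): $\|f\|_{X_T}=\sup_{0<t<T}\|\nabla f(\cdot,t)\|_{L^\infty}+\sup_{x\in\mathbb{R}^n}\sup_{0<R^4<T}R^{\frac2{n+6}}\|\nabla^2f\|_{L^{n+6}(B_R(x)\times(R^4/2,R^4))}$. Known well-posedness (Koch–Lamm), used to specify the solutions: there are $\varepsilon_0,C>0$ such that for every $u_0$ with $\|\nabla u_0\|_{L^\infty}<\varepsilon_0$ there is a solution $u$ with $u(\cdot,0)=u_0$ and $\|u\|_{X_\infty}\le C\|\nabla u_0\|_{L^\infty}$, unique in $\{\|u\|_{X_\infty}\le C\varepsilon_0\}$; moreover it is analytic for $t>0$ and there are $c,R>0$ with $\sup_{x}\sup_{t>0}|(t^{1/\alpha}\nabla)^\gamma(t\partial_t)^k\nabla u(x,t)|\le c\|\nabla u_0\|_{L^\infty}R^{|\gamma|+k}(|\gamma|+k)!$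 for all $k\in\mathbb{N}_0$, $\gamma\in\mathbb{N}_0^n$. "The global mild solution" always means this solution. By scale invariance and uniqueness, the solution $v$ with self-similar data $v_0$ satisfies $v(x,t)=\lambda^{-1}v(\lambda x,\lambda^\alpha t)$ for all $\lambda>0$. *)

theory Defs
  imports "HOL-Probability.Essential_Supremum" "HOL-Analysis.Analysis"
begin

section \<open>Partial derivatives on Euclidean space\<close>

definition partial :: "'n::finite \<Rightarrow> (real^'n \<Rightarrow> real) \<Rightarrow> real^'n \<Rightarrow> real" where
  "partial i f x = deriv (\<lambda>h. f (x + h *\<^sub>R axis i 1)) 0"

text \<open>Iterated partial derivatives are indexed by lists of directions. For functions of class
  \<open>C\<^sup>k\<close> these are exactly the derivatives indexed by multi-indices, and the length of the list is
  the order of the multi-index.\<close>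

definition partials :: "'n::finite list \<Rightarrow> (real^'n \<Rightarrow> real) \<Rightarrow> real^'n \<Rightarrow> real" where
  "partials is f = foldr partial is f"

definition C_class :: "nat \<Rightarrow> (real^'n::finite \<Rightarrow> real) \<Rightarrow> bool" where
  "C_class k f \<longleftrightarrow>
     (\<forall>is. length is < k \<longrightarrow>
        (\<forall>i x. (\<lambda>h. partials is f (x + h *\<^sub>R axis i 1)) differentiable at (0::real))) \<and>
     (\<forall>is. length is \<le> k \<longrightarrow> continuous_on UNIV (partials is f))"

text \<open>The norm of \<open>C\<^sup>k(K)\<close>, for functions defined on all of \<open>\<real>\<^sup>n\<close>; it is infinite for functions
  that are not of class \<open>C\<^sup>k\<close>.\<close>

definition Ck_norm :: "nat \<Rightarrow> (real^'n::finite) set \<Rightarrow> (real^'n \<Rightarrow> real) \<Rightarrow> ennreal" where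
  "Ck_norm k K f =
     (if C_class k f
      then (SUP is\<in>{is. length is \<le> k}. SUP x\<in>K. ennreal \<bar>partials is f x\<bar>)
      else \<infinity>)"

definition grad :: "(real^'n::finite \<Rightarrow> real) \<Rightarrow> real^'n \<Rightarrow> real^'n" where
  "grad f x = (\<chi> i. partial i f x)"

definition hess :: "(real^'n::finite \<Rightarrow> real) \<Rightarrow> real^'n \<Rightarrow> real^'n^'n" where
  "hess f x = (\<chi> i j. partial i (partial j f) x)"

definition dvg :: "(real^'n::finite \<Rightarrow> real^'n) \<Rightarrow> real^'n \<Rightarrow> real" where
  "dvg V x = (\<Sum>i\<in>UNIV. partial i (\<lambda>y. V y $ i) x)"

definition laplacian :: "(real^'n::finite \<Rightarrow> real) \<Rightarrow> real^'n \<Rightarrow> real" where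
  "laplacian f = dvg (grad f)"

section \<open>Lebesgue norms and weak gradients\<close>

definition Linf_norm :: "('a::euclidean_space \<Rightarrow> 'b::real_normed_vector) \<Rightarrow> ennreal" where
  "Linf_norm f = esssup lebesgue (\<lambda>x. ennreal (norm (f x)))"

definition Lp_norm ::
  "real \<Rightarrow> 'a::euclidean_space set \<Rightarrow> ('a \<Rightarrow> 'b::real_normed_vector) \<Rightarrow> ennreal" where
  "Lp_norm p S f =
     (let I = (\<integral>\<^sup>+z\<in>S. ennreal (norm (f z) powr p) \<partial>lebesgue)
      in if I = \<infinity> then \<infinity> else ennreal (enn2real I powr (1 / p)))"

definition test_function :: "(real^'n::finite \<Rightarrow> real) \<Rightarrow> bool" where
  "test_function \<phi> \<longleftrightarrow> (\<forall>k. C_class k \<phi>) \<and> compact (closure {x. \<phi> x \<noteq> 0})"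

definition weak_gradient :: "(real^'n::finite \<Rightarrow> real) \<Rightarrow> (real^'n \<Rightarrow> real^'n) \<Rightarrow> bool" where
  "weak_gradient f g \<longleftrightarrow>
     (\<forall>K. compact K \<longrightarrow> f absolutely_integrable_on K \<and> g absolutely_integrable_on K) \<and>
     (\<forall>\<phi> i. test_function \<phi> \<longrightarrow>
        (LINT x|lebesgue. f x * partial i \<phi> x) = - (LINT x|lebesgue. (g x $ i) * \<phi> x))"

text \<open>The norm of the gradient of initial data in \<open>L\<^sup>\<infinity>\<close>. The initial data are in general not
  differentiable everywhere (self-similar data have a corner at the origin), so the gradient is the
  weak one, which is unique up to null sets; the value is infinite if there is no weak gradient.\<close>

definition grad_norm :: "(real^'n::finite \<Rightarrow> real) \<Rightarrow> ennreal" where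
  "grad_norm f = Inf {Linf_norm g |g. weak_gradient f g}"

section \<open>The flows\<close>

datatype flow = MCF | SD | WF

text \<open>The exponent \<open>\<alpha>\<close>, which is also the order of the operator \<open>A\<close>.\<close>

fun flow_order :: "flow \<Rightarrow> nat" where
  "flow_order MCF = 2"
| "flow_order SD = 4"
| "flow_order WF = 4"

fun lin_op :: "flow \<Rightarrow> (real^'n::finite \<Rightarrow> real) \<Rightarrow> real^'n \<Rightarrow> real" where
  "lin_op MCF u x = - laplacian u x"
| "lin_op SD u x = laplacian (laplacian u) x"
| "lin_op WF u x = laplacian (laplacian u) x"

definition area :: "real^'n::finite \<Rightarrow> real" where
  "area q = sqrt (1 + (norm q)\<^sup>2)"

definition mean_curv :: "(real^'n::finite \<Rightarrow> real) \<Rightarrow> real^'n \<Rightarrow> real" where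
  "mean_curv u = dvg (\<lambda>y. grad u y /\<^sub>R area (grad u y))"

text \<open>The matrix \<open>I - (q \<otimes> q) / w\<^sup>2\<close> applied to a vector.\<close>

definition tproj :: "real^'n::finite \<Rightarrow> real^'n \<Rightarrow> real^'n" where
  "tproj q \<xi> = \<xi> - ((q \<bullet> \<xi>) / (area q)\<^sup>2) *\<^sub>R q"

fun flow_rhs :: "flow \<Rightarrow> (real^'n::finite \<Rightarrow> real) \<Rightarrow> real^'n \<Rightarrow> real" where
  "flow_rhs MCF u x = area (grad u x) * dvg (\<lambda>y. grad u y /\<^sub>R area (grad u y)) x"
| "flow_rhs SD u x =
     - dvg (\<lambda>y. area (grad u y) *\<^sub>R tproj (grad u y) (grad (mean_curv u) y)) x"
| "flow_rhs WF u x =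
     - area (grad u x) *
         dvg (\<lambda>y. (1 / area (grad u y)) *\<^sub>R
                (tproj (grad u y) (grad (\<lambda>z. area (grad u z) * mean_curv u z) y)
                 - ((1/2) * (mean_curv u y)\<^sup>2) *\<^sub>R grad u y)) x"

section \<open>The nonlinearity\<close>

text \<open>A function of the first derivatives \<open>q\<close> and the second derivatives \<open>H\<close>.\<close>

type_synonym 'n jetfun = "real^'n \<Rightarrow> real^'n^'n \<Rightarrow> real"

text \<open>Products of \<open>m\<close> second derivatives, \<open>w\<^sup>-\<^sup>2\<^sup>k\<close>, and \<open>d k\<close> first derivatives, for \<open>1 \<le> k \<le> M\<close>.\<close>

definition jet_terms :: "nat \<Rightarrow> nat \<Rightarrow> (nat \<Rightarrow> nat) \<Rightarrow> ('n::finite) jetfun set" where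
  "jet_terms m M d =
     {(\<lambda>q H. (\<Prod>(a, b)\<leftarrow>ps. H $ a $ b) * (\<Prod>a\<leftarrow>as. q $ a) / area q ^ (2 * k)) |ps as k.
        1 \<le> k \<and> k \<le> M \<and> length ps = m \<and> length as = d k}"

definition lin_combs :: "('n::finite) jetfun set \<Rightarrow> 'n jetfun set" where
  "lin_combs S =
     {(\<lambda>q H. \<Sum>l<N. c l * T l q H) |(N::nat) (c::nat \<Rightarrow> real) T. \<forall>l<N. T l \<in> S}"

text \<open>The coefficients of \<open>N[u] = f\<^sub>0[u] + \<nabla>\<^sub>i f\<^sub>1\<^sup>i[u] + \<nabla>\<^sub>i\<^sub>j f\<^sub>2\<^sup>i\<^sup>j[u]\<close>. For mean curvature flow \<open>N[u]\<close>
  contains no derivatives of second-order terms, and it is represented by \<open>f\<^sub>0\<close> alone.\<close>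

type_synonym 'n coeffs =
  "'n jetfun \<times> ('n \<Rightarrow> 'n jetfun) \<times> ('n \<Rightarrow> 'n \<Rightarrow> 'n jetfun)"

fun admissible_form :: "flow \<Rightarrow> ('n::finite) coeffs \<Rightarrow> bool" where
  "admissible_form MCF (f0, f1, f2) \<longleftrightarrow>
     f0 = (\<lambda>q H. - (\<Sum>i\<in>UNIV. \<Sum>j\<in>UNIV. q $ i * q $ j * H $ i $ j) / (area q)\<^sup>2) \<and>
     f1 = (\<lambda>i q H. 0) \<and> f2 = (\<lambda>i j q H. 0)"
| "admissible_form SD (f0, f1, f2) \<longleftrightarrow>
     f0 = (\<lambda>q H. 0) \<and>
     (\<forall>i. f1 i \<in> lin_combs (jet_terms 2 4 (\<lambda>k. 2 * k - 1))) \<and>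
     (\<forall>i j. f2 i j \<in> lin_combs (jet_terms 1 2 (\<lambda>k. 2 * k)))"
| "admissible_form WF (f0, f1, f2) \<longleftrightarrow>
     f0 \<in> lin_combs (jet_terms 3 4 (\<lambda>k. 2 * k - 2)) \<and>
     (\<forall>i. f1 i \<in> lin_combs (jet_terms 2 4 (\<lambda>k. 2 * k - 1))) \<and>
     (\<forall>i j. f2 i j \<in> lin_combs (jet_terms 1 2 (\<lambda>k. 2 * k)))"

fun nonlin :: "('n::finite) coeffs \<Rightarrow> (real^'n \<Rightarrow> real) \<Rightarrow> real^'n \<Rightarrow> real" where
  "nonlin (f0, f1, f2) u x =
     f0 (grad u x) (hess u x)
     + (\<Sum>i\<in>UNIV. partial i (\<lambda>y. f1 i (grad u y) (hess u y)) x)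
     + (\<Sum>i\<in>UNIV. \<Sum>j\<in>UNIV. partial i (partial j (\<lambda>y. f2 i j (grad u y) (hess u y))) x)"

text \<open>The coefficients rewrite the flow as \<open>\<partial>\<^sub>t u + A u = N[u]\<close>.\<close>

definition rewrites_flow :: "flow \<Rightarrow> ('n::finite) coeffs \<Rightarrow> bool" where
  "rewrites_flow F f \<longleftrightarrow>
     admissible_form F f \<and>
     (\<forall>u x. C_class (flow_order F) u \<longrightarrow> flow_rhs F u x = - lin_op F u x + nonlin f u x)"

section \<open>Kernels and mild solutions\<close>

text \<open>The biharmonic heat kernel is the inverse Fourier transform of \<open>exp (- t |\<xi>|\<^sup>4)\<close>; the imaginary
  part of the Fourier integral vanishes by symmetry.\<close>

fun kernel :: "flow \<Rightarrow> real \<Rightarrow> real^'n::finite \<Rightarrow> real" where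
  "kernel MCF t x = (4 * pi * t) powr (- real CARD('n) / 2) * exp (- (norm x)\<^sup>2 / (4 * t))"
| "kernel SD t x =
     (1 / (2 * pi) ^ CARD('n)) * (LINT \<xi>|lborel. cos (x \<bullet> \<xi>) * exp (- t * norm \<xi> ^ 4))"
| "kernel WF t x =
     (1 / (2 * pi) ^ CARD('n)) * (LINT \<xi>|lborel. cos (x \<bullet> \<xi>) * exp (- t * norm \<xi> ^ 4))"

text \<open>The integrand, in \<open>y\<close>, of \<open>e\<^sup>-\<^sup>(\<^sup>t\<^sup>-\<^sup>s\<^sup>)\<^sup>A N[u](x,s)\<close>, with the derivatives in front of \<open>f\<^sub>1\<close> and
  \<open>f\<^sub>2\<close> moved onto the kernel. The partial derivatives act on the kernel as a function of \<open>x - y\<close>,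
  hence no sign appears.\<close>

fun duhamel_integrand ::
  "flow \<Rightarrow> ('n::finite) coeffs \<Rightarrow> (real^'n \<Rightarrow> real \<Rightarrow> real) \<Rightarrow> real^'n \<Rightarrow> real \<Rightarrow> real^'n \<Rightarrow> real \<Rightarrow> real"
where
  "duhamel_integrand F (f0, f1, f2) u x t y s =
     (let q = grad (\<lambda>z. u z s) y; H = hess (\<lambda>z. u z s) y in
        kernel F (t - s) (x - y) * f0 q H
        + (\<Sum>i\<in>UNIV. partial i (kernel F (t - s)) (x - y) * f1 i q H)
        + (\<Sum>i\<in>UNIV. \<Sum>j\<in>UNIV. partial i (partial j (kernel F (t - s))) (x - y) * f2 i j q H))"

text \<open>Spacetime functions are curried, and their values at negative times are irrelevant. The
  integrability conditions say that the integrals defining the mild solution converge absolutely.\<close>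

definition mild_solution ::
  "flow \<Rightarrow> ('n::finite) coeffs \<Rightarrow> (real^'n \<Rightarrow> real) \<Rightarrow> (real^'n \<Rightarrow> real \<Rightarrow> real) \<Rightarrow> bool" where
  "mild_solution F f u0 u \<longleftrightarrow>
     (\<forall>x. u x 0 = u0 x) \<and>
     (\<forall>t>0. C_class 2 (\<lambda>x. u x t)) \<and>
     (\<forall>x. \<forall>t>0.
        integrable lebesgue (\<lambda>y. kernel F t (x - y) * u0 y) \<and>
        set_integrable lborel (UNIV \<times> {0<..<t}) (\<lambda>(y, s). duhamel_integrand F f u x t y s) \<and>
        u x t = (LINT y|lebesgue. kernel F t (x - y) * u0 y)
                + (LINT s:{0<..<t}|lborel. (LINT y|lborel. duhamel_integrand F f u x t y s)))"

text \<open>The norm of \<open>X\<^sub>\<infinity>\<close>; the integrability exponent is \<open>n + 4\<close> for mean curvature flow and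
  \<open>n + 6\<close> for the other two flows, that is, \<open>n + 2 + \<alpha>\<close>.\<close>

definition X_norm :: "flow \<Rightarrow> (real^'n::finite \<Rightarrow> real \<Rightarrow> real) \<Rightarrow> ennreal" where
  "X_norm F u =
     (let \<alpha> = flow_order F; p = real (CARD('n) + 2 + \<alpha>) in
        (SUP t\<in>{0<..}. Linf_norm (grad (\<lambda>x. u x t)))
        + (SUP x. SUP R\<in>{0<..}. ennreal (R powr (2 / p)) *
             Lp_norm p (ball x R \<times> {R ^ \<alpha> / 2<..<R ^ \<alpha>}) (\<lambda>(y, s). hess (\<lambda>z. u z s) y)))"

text \<open>The space \<open>X\<^sub>\<infinity>\<close> contains only functions whose Hessian is measurable in spacetime.\<close>

definition X_ball :: "flow \<Rightarrow> ennreal \<Rightarrow> (real^'n::finite \<Rightarrow> real \<Rightarrow> real) set" where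
  "X_ball F r =
     {u. set_borel_measurable lebesgue (UNIV \<times> {0<..}) (\<lambda>(y, s). hess (\<lambda>z. u z s) y) \<and>
         X_norm F u \<le> r}"

section \<open>Well-posedness\<close>

definition real_analytic_on :: "('a::euclidean_space \<Rightarrow> real) \<Rightarrow> 'a set \<Rightarrow> bool" where
  "real_analytic_on f S \<longleftrightarrow>
     (\<forall>x\<in>S. \<exists>r>0. \<exists>a :: ('a \<Rightarrow> nat) \<Rightarrow> real. \<forall>y\<in>ball x r.
        ((\<lambda>\<gamma>. a \<gamma> * (\<Prod>b\<in>Basis. ((y - x) \<bullet> b) ^ \<gamma> b)) has_sum f y) (Basis \<rightarrow>\<^sub>E UNIV))"

definition tdt :: "('a \<Rightarrow> real \<Rightarrow> real) \<Rightarrow> 'a \<Rightarrow> real \<Rightarrow> real" where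
  "tdt g x t = t * deriv (g x) t"

text \<open>The vector \<open>(t\<^sup>1\<^sup>/\<^sup>\<alpha> \<nabla>)\<^sup>\<gamma> (t \<partial>\<^sub>t)\<^sup>k \<nabla>u(x,t)\<close>.\<close>

definition scaled_deriv ::
  "flow \<Rightarrow> 'n::finite list \<Rightarrow> nat \<Rightarrow> (real^'n \<Rightarrow> real \<Rightarrow> real) \<Rightarrow> real^'n \<Rightarrow> real \<Rightarrow> real^'n" where
  "scaled_deriv F \<gamma> k u x t =
     (\<chi> i. t powr (real (length \<gamma>) / real (flow_order F)) *
           partials \<gamma> (\<lambda>y. (tdt ^^ k) (\<lambda>z s. partial i (\<lambda>z. u z s) z) y t) x)"

definition derivative_bounds ::
  "flow \<Rightarrow> (real^'n::finite \<Rightarrow> real) \<Rightarrow> (real^'n \<Rightarrow> real \<Rightarrow> real) \<Rightarrow> bool" where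
  "derivative_bounds F u0 u \<longleftrightarrow>
     (\<exists>c>0. \<exists>R>0. \<forall>\<gamma> k x. \<forall>t>0.
        ennreal (norm (scaled_deriv F \<gamma> k u x t))
        \<le> ennreal (c * R ^ (length \<gamma> + k) * fact (length \<gamma> + k)) * grad_norm u0)"

text \<open>The solution with initial data \<open>u\<^sub>0\<close> which the well-posedness theorem below provides and
  singles out; \<open>C\<close> is the constant of that theorem.\<close>

definition global_mild_solution ::
  "flow \<Rightarrow> ('n::finite) coeffs \<Rightarrow> real \<Rightarrow> (real^'n \<Rightarrow> real) \<Rightarrow> (real^'n \<Rightarrow> real \<Rightarrow> real) \<Rightarrow> bool"
where
  "global_mild_solution F f C u0 u \<longleftrightarrow>
     mild_solution F f u0 u \<and> u \<in> X_ball F (ennreal C * grad_norm u0)"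

text \<open>The well-posedness theorem of Koch and Lamm, with constants \<open>\<epsilon>\<^sub>0\<close> and \<open>C\<close>.\<close>

definition koch_lamm :: "flow \<Rightarrow> ('n::finite) coeffs \<Rightarrow> real \<Rightarrow> real \<Rightarrow> bool" where
  "koch_lamm F f \<epsilon>\<^sub>0 C \<longleftrightarrow>
     \<epsilon>\<^sub>0 > 0 \<and> C > 0 \<and>
     (\<forall>u0. grad_norm u0 < ennreal \<epsilon>\<^sub>0 \<longrightarrow>
        (\<exists>u. global_mild_solution F f C u0 u \<and>
             (\<forall>u'. mild_solution F f u0 u' \<and> u' \<in> X_ball F (ennreal (C * \<epsilon>\<^sub>0)) \<longrightarrow>
                   (\<forall>x. \<forall>t\<ge>0. u' x t = u x t)) \<and>
             real_analytic_on (\<lambda>(x, t). u x t) (UNIV \<times> {0<..}) \<and>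
             derivative_bounds F u0 u))"

end

theory Submission
  imports Defs "HOL-Complex_Analysis.Great_Picard" "HOL-Probability.Sinc_Integral"
begin

text \<open>
  Put \<open>u\<^sub>l(x, t) = l\<^sup>-\<^sup>1 u(l x, l\<^sup>\<alpha> t)\<close>. With \<open>l = t\<^sup>1\<^sup>/\<^sup>\<alpha>\<close>, the claim is that \<open>u\<^sub>l(\<cdot>, 1)\<close> tends to \<open>v(\<cdot>, 1)\<close> as
  \<open>l\<close> grows. The flows are invariant under this dilation, so \<open>u\<^sub>l\<close> is the solution whose data are
  \<open>v0 + l\<^sup>-\<^sup>1 p(l x)\<close>: the self-similar part is unchanged, and the perturbation disappears uniformly. The
  theorem is thus continuous dependence of the solution on its data, obtained from compactness and
  uniqueness.

  For compactness, the derivative bounds of the well-posedness theorem are scale invariant, hence they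
  hold for all \<open>u\<^sub>l\<close> with the same constants (\<open>slice_bounds_dilate\<close>, \<open>time_bound_dilate\<close>). Along a subsequence
  the gradients converge at all positive times (\<open>gradient_convergent_subsequence\<close>), and then so do all
  spatial derivatives, because bounds on second derivatives turn pointwise convergence of functions
  into pointwise convergence of first derivatives (\<open>partials_of_pointwise_limit\<close>).

  Dominated convergence passes to the limit in the integral equation
  (\<open>limit_is_mild_solution\<close>). A term with \<open>j\<close> derivatives on the kernel is of degree
  \<open>d = \<alpha> - 1 - j\<close> in the second derivatives, so after integration in space it is bounded by a multiple
  of \<open>(t - s)\<^sup>-\<^sup>j\<^sup>/\<^sup>\<alpha> s\<^sup>-\<^sup>d\<^sup>/\<^sup>\<alpha>\<close>, which is integrable in time (\<open>duhamel_integrand_majorised\<close>). The limit has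
  data \<open>v0\<close>, and it stays in the ball of the solution space because the norm is scale invariant and
  lower semicontinuous (\<open>X_norm_limit_le\<close>). By the uniqueness part of the well-posedness theorem it is
  \<open>v\<close> (\<open>dilated_solutions_subconverge\<close>). As this holds for some subsequence of every sequence, the full
  family converges; the uniform bounds make the convergence uniform on compact sets
  (\<open>Ck_norm_tendsto_0\<close>).

  Two ingredients are of independent interest. The biharmonic kernel and its derivatives decay like
  an integrable product weight, by integration by parts in the Fourier integral
  (\<open>cos_transform_decay\<close>). A function given locally by convergent multi-index power series has partial
  derivatives of the same kind (\<open>real_analytic_on_directional_derivative\<close>); this is what makes the
  derivatives in the bounds exist.
\<close>


section \<open>Iterated partial derivatives\<close>

abbreviation has_partial :: "'n::finite \<Rightarrow> (real^'n \<Rightarrow> real) \<Rightarrow> real \<Rightarrow> real^'n \<Rightarrow> bool" where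
  "has_partial i f D x \<equiv> ((\<lambda>h. f (x + h *\<^sub>R axis i 1)) has_real_derivative D) (at 0)"

abbreviation partially_differentiable :: "'n::finite \<Rightarrow> (real^'n \<Rightarrow> real) \<Rightarrow> real^'n \<Rightarrow> bool" where
  "partially_differentiable i f x \<equiv> (\<lambda>h. f (x + h *\<^sub>R axis i 1)) differentiable at (0::real)"

text \<open>Smoothness in the sense of \<^const>\<open>C_class\<close> of every order, except that continuity is not asked
  for: it follows from bounds on the next derivatives, and those are at hand for all solutions.\<close>

definition axis_smooth :: "(real^'n::finite \<Rightarrow> real) \<Rightarrow> bool" where
  "axis_smooth f \<longleftrightarrow>
     (\<forall>is i x. partially_differentiable i (partials is f) x)"

lemma real_differentiableI: "(f has_real_derivative D) (at x) \<Longrightarrow> f differentiable at x"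
  unfolding real_differentiable_def by blast

lemma partials_Nil [simp]: "partials [] f = f"
  by (simp add: partials_def)

lemma partials_Cons [simp]: "partials (i # is) f = partial i (partials is f)"
  by (simp add: partials_def)

lemma partials_append: "partials (is @ js) f = partials is (partials js f)"
  by (simp add: partials_def)

lemma partial_eqI:
  assumes "has_partial i f D x"
  shows "partial i f x = D"
  using assms unfolding partial_def by (rule DERIV_imp_deriv)

lemma has_partial_partial:
  assumes "partially_differentiable i f x"
  shows "has_partial i f (partial i f x) x"
  using assms unfolding partial_def
  by (metis DERIV_deriv_iff_real_differentiable)

lemma has_partial_shift:
  assumes "\<And>x. partially_differentiable i f x"
  shows "((\<lambda>h. f (x + h *\<^sub>R axis i 1)) has_real_derivative partial i f (x + s *\<^sub>R axis i 1)) (at s)"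
proof -
  have "((\<lambda>h. f ((x + s *\<^sub>R axis i 1) + h *\<^sub>R axis i 1)) has_real_derivative partial i f (x + s *\<^sub>R axis i 1)) (at 0)"
    by (rule has_partial_partial[OF assms])
  then have "((\<lambda>h. f (x + (h + s) *\<^sub>R axis i 1)) has_real_derivative partial i f (x + s *\<^sub>R axis i 1)) (at 0)"
    by (simp add: algebra_simps)
  then show ?thesis
    using DERIV_shift[of "\<lambda>h. f (x + h *\<^sub>R axis i 1)" "partial i f (x + s *\<^sub>R axis i 1)" 0 s] by simp
qed

lemma axis_smoothD:
  "axis_smooth f \<Longrightarrow> partially_differentiable i (partials is f) x"
  by (simp add: axis_smooth_def)

lemma axis_smooth_partials: "axis_smooth f \<Longrightarrow> axis_smooth (partials js f)"
  unfolding axis_smooth_def partials_append[symmetric] by blast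

lemma has_partial_partials:
  "axis_smooth f \<Longrightarrow>
    has_partial i (partials is f) (partials (i # is) f x) x"
  using has_partial_partial[OF axis_smoothD] by simp

lemma partials_dilation_step:
  assumes "partially_differentiable i (partials is f) (c *\<^sub>R x)"
  shows "has_partial i (\<lambda>x. a * c ^ length is * partials is f (c *\<^sub>R x))
    (a * c ^ length (i # is) * partials (i # is) f (c *\<^sub>R x)) x"
proof -
  have "((\<lambda>h. partials is f (c *\<^sub>R x + (c * h) *\<^sub>R axis i 1))
      has_real_derivative partials (i # is) f (c *\<^sub>R x) * c) (at 0)"
    using DERIV_chain2[of "\<lambda>h. partials is f (c *\<^sub>R x + h *\<^sub>R axis i 1)" _ "\<lambda>h. c * h" 0 c UNIV]
      has_partial_partial[OF assms]
    by (auto intro!: derivative_eq_intros)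
  from DERIV_cmult[OF this, of "a * c ^ length is"] show ?thesis
    by (simp add: algebra_simps)
qed

lemma partials_dilation:
  assumes "axis_smooth f"
  shows "partials is (\<lambda>x. a * f (c *\<^sub>R x)) = (\<lambda>x. a * c ^ length is * partials is f (c *\<^sub>R x))"
proof (induction "is")
  case (Cons i "is")
  have "partial i (\<lambda>x. a * c ^ length is * partials is f (c *\<^sub>R x)) x
      = a * c ^ length (i # is) * partials (i # is) f (c *\<^sub>R x)" for x
    by (intro partial_eqI partials_dilation_step axis_smoothD assms)
  then show ?case by (simp add: Cons.IH fun_eq_iff)
qed simp

lemma axis_smooth_dilation:
  assumes "axis_smooth f"
  shows "axis_smooth (\<lambda>x. a * f (c *\<^sub>R x))"
  unfolding axis_smooth_def partials_dilation[OF assms]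
  by (intro allI real_differentiableI[OF partials_dilation_step] axis_smoothD[OF assms])

lemma partials_diff:
  assumes "axis_smooth f" "axis_smooth g"
  shows "partials is (\<lambda>x. f x - g x) = (\<lambda>x. partials is f x - partials is g x)"
proof (induction "is")
  case (Cons i "is")
  have "partial i (\<lambda>x. partials is f x - partials is g x) x = partials (i # is) f x - partials (i # is) g x" for x
    by (intro partial_eqI DERIV_diff has_partial_partials assms)
  then show ?case by (simp add: Cons.IH fun_eq_iff)
qed simp

lemma axis_smooth_diff:
  assumes "axis_smooth f" "axis_smooth g"
  shows "axis_smooth (\<lambda>x. f x - g x)"
  unfolding axis_smooth_def partials_diff[OF assms]
  using DERIV_diff[OF has_partial_partials[OF assms(1)] has_partial_partials[OF assms(2)]]
  by (blast intro: real_differentiableI)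

text \<open>Move from one point to the other one coordinate at a time and use the mean value theorem on each
  segment; no total derivative is involved.\<close>

lemma bounded_partials_imp_lipschitz:
  fixes f :: "real^'n::finite \<Rightarrow> real"
  assumes diff: "\<And>i x. partially_differentiable i f x"
    and bd: "\<And>i x. \<bar>partial i f x\<bar> \<le> B"
  shows "\<bar>f x - f y\<bar> \<le> B * real CARD('n) * norm (x - y)"
proof -
  have B0: "B \<ge> 0" using bd[of undefined 0] by (meson abs_ge_zero order_trans)
  have seg: "\<bar>f (x + s *\<^sub>R axis i 1) - f x\<bar> \<le> B * \<bar>s\<bar>" for x s i
  proof -
    have "norm (f (x + s *\<^sub>R axis i 1) - f (x + 0 *\<^sub>R axis i 1)) \<le> B * norm (s - 0)"
    proof (rule field_differentiable_bound[of UNIV])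
      show "((\<lambda>h. f (x + h *\<^sub>R axis i 1)) has_field_derivative partial i f (x + h *\<^sub>R axis i 1)) (at h within UNIV)" for h
        using has_partial_shift[OF diff] by simp
    qed (use bd in simp_all)
    then show ?thesis by simp
  qed
  have "\<bar>f (x + (\<Sum>i\<in>A. (y $ i - x $ i) *\<^sub>R axis i 1)) - f x\<bar> \<le> B * (\<Sum>i\<in>A. \<bar>y $ i - x $ i\<bar>)" if "finite A" for A
    using that
  proof (induction A rule: finite_induct)
    case (insert j A)
    let ?z = "x + (\<Sum>i\<in>A. (y $ i - x $ i) *\<^sub>R axis i 1)"
    have "x + (\<Sum>i\<in>insert j A. (y $ i - x $ i) *\<^sub>R axis i 1) = ?z + (y $ j - x $ j) *\<^sub>R axis j 1"
      using insert.hyps by simp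
    moreover have "(\<Sum>i\<in>insert j A. \<bar>y $ i - x $ i\<bar>) = \<bar>y $ j - x $ j\<bar> + (\<Sum>i\<in>A. \<bar>y $ i - x $ i\<bar>)"
      using insert.hyps by simp
    ultimately show ?case
      using insert.IH seg[of ?z "y $ j - x $ j" j] by (simp only: distrib_left)
  qed simp
  from this[of UNIV]
  have "\<bar>f (x + (\<Sum>i\<in>UNIV. (y $ i - x $ i) *\<^sub>R axis i 1)) - f x\<bar> \<le> B * (\<Sum>i\<in>UNIV. \<bar>y $ i - x $ i\<bar>)" by simp
  moreover have "x + (\<Sum>i\<in>UNIV. (y $ i - x $ i) *\<^sub>R axis i 1) = y"
    by (simp add: vec_eq_iff axis_def if_distrib cong: if_cong)
  moreover have "(\<Sum>i\<in>UNIV. \<bar>y $ i - x $ i\<bar>) \<le> real CARD('n) * norm (x - y)"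
  proof -
    have "(\<Sum>i\<in>UNIV. \<bar>y $ i - x $ i\<bar>) \<le> (\<Sum>i\<in>(UNIV::'n set). norm (x - y))"
      using component_le_norm_cart[of "x - y"] by (intro sum_mono) (simp add: abs_minus_commute)
    then show ?thesis by simp
  qed
  ultimately show ?thesis
    using mult_left_mono[OF _ B0] by (smt (verit, ccfv_SIG) mult.assoc)
qed

lemma bounded_partials_imp_continuous:
  fixes f :: "real^'n::finite \<Rightarrow> real"
  assumes "\<And>i x. partially_differentiable i f x"
    and "\<And>i x. \<bar>partial i f x\<bar> \<le> B"
  shows "continuous_on UNIV f"
proof -
  have B0: "B \<ge> 0" using assms(2)[of undefined 0] by (meson abs_ge_zero order_trans)
  have "(B * real CARD('n))-lipschitz_on UNIV f"
    using bounded_partials_imp_lipschitz[of f B] assms B0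
    by (intro lipschitz_onI) (auto simp: dist_real_def dist_norm)
  then show ?thesis by (rule lipschitz_on_continuous_on)
qed

text \<open>A bound on second derivatives makes the difference quotients of the members of a sequence
  uniformly close to their derivatives, so pointwise convergence alone yields convergence of the
  derivatives.\<close>

lemma derivative_of_pointwise_limit:
  fixes f :: "nat \<Rightarrow> real \<Rightarrow> real"
  assumes f': "\<And>n s. (f n has_real_derivative f' n s) (at s)"
    and f'': "\<And>n s. (f' n has_real_derivative f'' n s) (at s)"
    and bd: "\<And>n s. \<bar>f'' n s\<bar> \<le> B"
    and lim: "\<And>s. (\<lambda>n. f n s) \<longlonglongrightarrow> g s"
  shows "\<exists>L. (\<lambda>n. f' n 0) \<longlonglongrightarrow> L \<and> (g has_real_derivative L) (at 0)"
proof -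
  have B0: "B \<ge> 0" using bd[of 0 0] by linarith
  have lip: "\<bar>f' n s - f' n 0\<bar> \<le> B * \<bar>s\<bar>" for n s
    using field_differentiable_bound[of UNIV "f' n" "f'' n" B s 0] f'' bd by simp
  have quot: "\<bar>(f n h - f n 0) / h - f' n 0\<bar> \<le> B * \<bar>h\<bar>" if h: "h \<noteq> 0" for n h
  proof -
    have "norm (f n h - f n 0 - f' n 0 * (h - 0)) \<le> (B * \<bar>h\<bar>) * norm (h - 0)"
    proof -
      have "norm ((f n h - f' n 0 * h) - (f n 0 - f' n 0 * 0)) \<le> (B * \<bar>h\<bar>) * norm (h - 0)"
      proof (rule field_differentiable_bound[of "cball 0 \<bar>h\<bar>"])
        show "((\<lambda>s. f n s - f' n 0 * s) has_field_derivative f' n s - f' n 0) (at s within cball 0 \<bar>h\<bar>)" for s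
          by (intro DERIV_subset[OF DERIV_diff[OF f' DERIV_cmult_Id]]) auto
        show "norm (f' n s - f' n 0) \<le> B * \<bar>h\<bar>" if "s \<in> cball 0 \<bar>h\<bar>" for s
          using lip[of n s] that mult_left_mono[OF _ B0, of "\<bar>s\<bar>" "\<bar>h\<bar>"] by (simp add: dist_real_def)
      qed auto
      then show ?thesis by simp
    qed
    then have "\<bar>f n h - f n 0 - f' n 0 * h\<bar> / \<bar>h\<bar> \<le> B * \<bar>h\<bar>"
      using h by (simp add: pos_divide_le_eq)
    moreover have "(f n h - f n 0) / h - f' n 0 = (f n h - f n 0 - f' n 0 * h) / h"
      using h by (simp add: field_simps)
    ultimately show ?thesis by (simp add: abs_divide)
  qed
  have limq: "(\<lambda>n. (f n h - f n 0) / h) \<longlonglongrightarrow> (g h - g 0) / h" for h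
    by (cases "h = 0") (auto intro!: tendsto_intros lim)
  have "Cauchy (\<lambda>n. f' n 0)"
  proof (rule metric_CauchyI)
    fix e :: real assume e: "e > 0"
    \<comment> \<open>with this step the quotients are within \<open>e/4\<close> of the derivatives, for all members at once\<close>
    define h where "h = e / (4 * (B + 1))"
    have h: "h > 0" "B * \<bar>h\<bar> < e / 4 + 0"
      using e B0 by (auto simp: h_def field_simps)
    have "Cauchy (\<lambda>n. (f n h - f n 0) / h)"
      using limq by (rule LIMSEQ_imp_Cauchy)
    then obtain M where M: "\<And>m n. m \<ge> M \<Longrightarrow> n \<ge> M \<Longrightarrow>
        dist ((f m h - f m 0) / h) ((f n h - f n 0) / h) < e / 2"
      using metric_CauchyD[of _ "e / 2"] e by (meson half_gt_zero)
    show "\<exists>M. \<forall>m\<ge>M. \<forall>n\<ge>M. dist (f' m 0) (f' n 0) < e"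
    proof (intro exI allI impI)
      fix m n assume mn: "m \<ge> M" "n \<ge> M"
      show "dist (f' m 0) (f' n 0) < e"
        using M[OF mn] quot[of h m] quot[of h n] h unfolding dist_real_def by linarith
    qed
  qed
  then obtain L where L: "(\<lambda>n. f' n 0) \<longlonglongrightarrow> L"
    using Cauchy_convergent convergent_def by blast
  have gq: "\<bar>(g h - g 0) / h - L\<bar> \<le> B * \<bar>h\<bar>" if "h \<noteq> 0" for h
    by (rule LIMSEQ_le_const2[where X = "\<lambda>n. \<bar>(f n h - f n 0) / h - f' n 0\<bar>"])
       (use quot[OF that] in \<open>auto intro!: tendsto_intros limq L\<close>)
  have "((\<lambda>h. (g h - g 0) / h - L) \<longlongrightarrow> 0) (at 0)"
  proof (rule Lim_null_comparison)
    show "eventually (\<lambda>h. norm ((g h - g 0) / h - L) \<le> B * \<bar>h\<bar>) (at 0)"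
      using gq by (auto simp: eventually_at intro!: exI[of _ 1])
    show "((\<lambda>h. B * \<bar>h\<bar>) \<longlongrightarrow> 0) (at 0)"
      by (auto intro!: tendsto_eq_intros)
  qed
  then have "((\<lambda>h. (g h - g 0) / h) \<longlongrightarrow> L) (at 0)"
    using LIM_zero_iff by blast
  then have "(g has_real_derivative L) (at 0)"
    by (simp add: has_field_derivative_iff)
  then show ?thesis using L by blast
qed

text \<open>Induction on the order: the derivatives of order \<open>m + 1\<close> converge because those of order \<open>m\<close> do
  and those of order \<open>m + 2\<close> are bounded. Bounds are asked of
  derivatives only, because solutions grow linearly in space.\<close>

lemma partials_of_pointwise_limit:
  fixes f :: "nat \<Rightarrow> real^'n::finite \<Rightarrow> real"
  assumes smooth: "\<And>n. axis_smooth (f n)"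
    and bd: "\<And>is. is \<noteq> [] \<Longrightarrow> \<exists>B. \<forall>n x. \<bar>partials is (f n) x\<bar> \<le> B"
    and lim: "\<And>x. (\<lambda>n. f n x) \<longlonglongrightarrow> g x"
  shows "axis_smooth g" and "(\<lambda>n. partials is (f n) x) \<longlonglongrightarrow> partials is g x"
proof -
  have step: "(\<lambda>n. partials (i # is) (f n) x) \<longlonglongrightarrow> partials (i # is) g x \<and>
      partially_differentiable i (partials is g) x"
    if l: "\<And>x. (\<lambda>n. partials is (f n) x) \<longlonglongrightarrow> partials is g x" for "is" i x
  proof -
    obtain B where B: "\<And>n x. \<bar>partials (i # i # is) (f n) x\<bar> \<le> B"
      using bd[of "i # i # is"] by blast
    have "\<exists>L. (\<lambda>n. partials (i # is) (f n) (x + 0 *\<^sub>R axis i 1)) \<longlonglongrightarrow> L \<and>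
        has_partial i (partials is g) L x"
    proof (rule derivative_of_pointwise_limit[where f = "\<lambda>n h. partials is (f n) (x + h *\<^sub>R axis i 1)"
          and f' = "\<lambda>n h. partials (i # is) (f n) (x + h *\<^sub>R axis i 1)"
          and f'' = "\<lambda>n h. partials (i # i # is) (f n) (x + h *\<^sub>R axis i 1)" and B = B])
      show "((\<lambda>h. partials is (f n) (x + h *\<^sub>R axis i 1)) has_real_derivative
         partials (i # is) (f n) (x + s *\<^sub>R axis i 1)) (at s)" for n s
        using has_partial_shift[OF axis_smoothD[OF smooth[of n], of "is"]] by simp
      show "((\<lambda>h. partials (i # is) (f n) (x + h *\<^sub>R axis i 1)) has_real_derivative
         partials (i # i # is) (f n) (x + s *\<^sub>R axis i 1)) (at s)" for n s
        using has_partial_shift[OF axis_smoothD[OF smooth[of n], of "i # is"]] by simp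
    qed (use B l in auto)
    then obtain L where L: "(\<lambda>n. partials (i # is) (f n) x) \<longlonglongrightarrow> L"
        "has_partial i (partials is g) L x" by auto
    have "partials (i # is) g x = L" using L(2) by (simp add: partial_eqI)
    then show ?thesis using L by (auto intro: real_differentiableI)
  qed
  have conv: "(\<lambda>n. partials is (f n) x) \<longlonglongrightarrow> partials is g x" for "is" x
  proof (induction "is" arbitrary: x)
    case Nil then show ?case using lim by simp
  next
    case (Cons i "is") then show ?case using step by blast
  qed
  then show "(\<lambda>n. partials is (f n) x) \<longlonglongrightarrow> partials is g x" .
  show "axis_smooth g" unfolding axis_smooth_def using step[OF conv] by blast
qed


section \<open>Real analytic functions\<close>

lemma summable_on_abs_real:
  fixes f :: "'a \<Rightarrow> real"
  shows "f summable_on A \<Longrightarrow> (\<lambda>x. \<bar>f x\<bar>) summable_on A"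
  using summable_on_iff_abs_summable_on_real[of f A] by simp

lemma summable_on_if_abs_real:
  fixes f :: "'a \<Rightarrow> real"
  shows "(\<lambda>x. \<bar>f x\<bar>) summable_on A \<Longrightarrow> f summable_on A"
  using summable_on_iff_abs_summable_on_real[of f A] by simp

text \<open>The loss of two factors \<open>m\<close> in differentiating a power series twice is absorbed by a larger radius.\<close>

lemma square_times_power_le:
  fixes K s :: real
  assumes "0 < K" "K < s"
  shows "\<exists>C. \<forall>m::nat. (real m)\<^sup>2 * K ^ m \<le> C * s ^ m"
proof -
  \<comment> \<open>then \<open>m\<^sup>2 (K/s)\<^sup>m\<close> is the square of the bounded sequence \<open>m r\<^sup>m\<close>\<close>
  define r where "r = sqrt (K / s)"
  have r: "0 < r" "r < 1" "r\<^sup>2 = K / s" using assms by (auto simp: r_def)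
  have "(\<lambda>n. real n * r ^ n) \<longlonglongrightarrow> 0"
    using r by (intro powser_times_n_limit_0) auto
  then have "Bseq (\<lambda>n. real n * r ^ n)" by (rule convergent_imp_Bseq[OF convergentI]) 
  then obtain C where C: "C > 0" "\<And>n. norm (real n * r ^ n) \<le> C" unfolding Bseq_def by blast
  have "(real m)\<^sup>2 * K ^ m \<le> C\<^sup>2 * s ^ m" for m
  proof -
    have "(real m * r ^ m)\<^sup>2 \<le> C\<^sup>2"
      using C(2)[of m] r by (intro power_mono) auto
    moreover have "(real m * r ^ m)\<^sup>2 * s ^ m = (real m)\<^sup>2 * (r\<^sup>2 * s) ^ m"
      by (simp add: power_mult_distrib power_mult[symmetric] mult.commute)
    moreover have "r\<^sup>2 * s = K" using r assms by simp
    ultimately show ?thesis using mult_right_mono[of _ "C\<^sup>2" "s ^ m"] assms by fastforce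
  qed
  then show ?thesis by blast
qed

text \<open>Termwise differentiation, by the usual comparison of difference quotients with a power
  series at a slightly larger radius; the index set is arbitrary, so that multi-indices need not
  be grouped by the exponent of the variable of differentiation.\<close>

lemma has_sum_power_has_derivative:
  fixes c :: "'a \<Rightarrow> real" and m :: "'a \<Rightarrow> nat"
  assumes F: "\<And>h. \<bar>h\<bar> < d \<Longrightarrow> ((\<lambda>\<gamma>. c \<gamma> * (\<tau> + h) ^ m \<gamma>) has_sum F h) A"
    and d: "d > 0" and s: "\<bar>\<tau>\<bar> < s"
    and summ: "(\<lambda>\<gamma>. c \<gamma> * s ^ m \<gamma>) summable_on A"
  shows "\<exists>D. (F has_real_derivative D) (at 0) \<and>
             ((\<lambda>\<gamma>. c \<gamma> * real (m \<gamma>) * \<tau> ^ (m \<gamma> - 1)) has_sum D) A"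
proof -
  \<comment> \<open>between \<open>\<bar>\<tau>\<bar>\<close> and \<open>s\<close>: room for the increment \<open>h\<close> on one side, for the polynomial factors on the other\<close>
  define K where "K = (\<bar>\<tau>\<bar> + s) / 2"
  have K: "0 < K" "\<bar>\<tau>\<bar> < K" "K < s" using s by (auto simp: K_def)
  obtain C where C: "\<And>m::nat. (real m)\<^sup>2 * K ^ m \<le> C * s ^ m"
    using square_times_power_le[OF K(1,3)] by blast
  have s0: "s > 0" using s by linarith
  have abss: "(\<lambda>\<gamma>. \<bar>c \<gamma>\<bar> * s ^ m \<gamma>) summable_on A"
    using summable_on_abs_real[OF summ] s0 by (simp add: abs_mult)
  define S where "S = infsum (\<lambda>\<gamma>. \<bar>c \<gamma>\<bar> * s ^ m \<gamma>) A"
  have S: "((\<lambda>\<gamma>. \<bar>c \<gamma>\<bar> * s ^ m \<gamma>) has_sum S) A"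
    unfolding S_def using abss by (rule has_sum_infsum)
  have "0 \<le> C * s ^ 1" using C[of 1] K by (intro order_trans[OF _ C]) auto
  then have C0: "C \<ge> 0" using s0 by (simp add: zero_le_mult_iff)
  have C1: "real k * K ^ (k - 1) \<le> C / K * s ^ k" for k
  proof (cases k)
    case (Suc j)
    have "real k * K ^ (k - 1) * K = real k * K ^ k" using Suc by simp
    also have "\<dots> \<le> (real k)\<^sup>2 * K ^ k"
      using Suc K by (intro mult_right_mono) (auto simp: power2_eq_square)
    also have "\<dots> \<le> C * s ^ k" by (rule C)
    finally show ?thesis using K by (simp add: field_simps)
  qed (use C0 K in simp)
  have C2: "real k * real (k - Suc 0) * K ^ (k - 2) \<le> C / K\<^sup>2 * s ^ k" for k
  proof (cases "k \<ge> 2")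
    case True
    then have "K ^ (k - 2) * K\<^sup>2 = K ^ k" by (metis le_add_diff_inverse2 power_add)
    then have "real k * real (k - Suc 0) * K ^ (k - 2) * K\<^sup>2 = real k * real (k - Suc 0) * K ^ k"
      by simp
    also have "\<dots> \<le> (real k)\<^sup>2 * K ^ k"
      using K by (intro mult_right_mono) (auto simp: power2_eq_square intro!: mult_left_mono)
    also have "\<dots> \<le> C * s ^ k" by (rule C)
    finally show ?thesis using K by (simp add: field_simps)
  next
    case False
    then have "k = 0 \<or> k = 1" by auto
    then show ?thesis using C0 K s0 by auto
  qed
  have "(\<lambda>\<gamma>. norm (c \<gamma> * real (m \<gamma>) * \<tau> ^ (m \<gamma> - 1))) summable_on A"
  proof (rule Infinite_Sum.abs_summable_on_comparison_test)
    have "(\<lambda>\<gamma>. C / K * (\<bar>c \<gamma>\<bar> * s ^ m \<gamma>)) summable_on A"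
      using abss by (rule summable_on_cmult_right)
    from summable_on_abs_real[OF this]
    show "(\<lambda>\<gamma>. norm (C / K * (\<bar>c \<gamma>\<bar> * s ^ m \<gamma>))) summable_on A"
      by simp
    fix \<gamma>
    have "real (m \<gamma>) * \<bar>\<tau>\<bar> ^ (m \<gamma> - 1) \<le> real (m \<gamma>) * K ^ (m \<gamma> - 1)"
      using K by (intro mult_left_mono power_mono) auto
    also have "\<dots> \<le> C / K * s ^ m \<gamma>" by (rule C1)
    finally have "\<bar>c \<gamma>\<bar> * (real (m \<gamma>) * \<bar>\<tau>\<bar> ^ (m \<gamma> - 1)) \<le> \<bar>c \<gamma>\<bar> * (C / K * s ^ m \<gamma>)"
      by (intro mult_left_mono) auto
    then show "norm (c \<gamma> * real (m \<gamma>) * \<tau> ^ (m \<gamma> - 1)) \<le> norm (C / K * (\<bar>c \<gamma>\<bar> * s ^ m \<gamma>))"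
      using C0 K s0 by (simp add: abs_mult power_abs algebra_simps)
  qed
  then obtain D where D: "((\<lambda>\<gamma>. c \<gamma> * real (m \<gamma>) * \<tau> ^ (m \<gamma> - 1)) has_sum D) A"
    using Infinite_Sum.abs_summable_summable summable_on_def by blast
  define e where "e = min d (K - \<bar>\<tau>\<bar>)"
  have e: "e > 0" "e \<le> d" "e \<le> K - \<bar>\<tau>\<bar>" using d K by (auto simp: e_def)
  have quot: "\<bar>(F h - F 0) / h - D\<bar> \<le> C / K\<^sup>2 * S * \<bar>h\<bar>" if h: "h \<noteq> 0" "\<bar>h\<bar> < e" for h
  proof -
    have "((\<lambda>\<gamma>. (c \<gamma> * (\<tau> + h) ^ m \<gamma> + - (c \<gamma> * (\<tau> + 0) ^ m \<gamma>)) * (1 / h)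
        + - (c \<gamma> * real (m \<gamma>) * \<tau> ^ (m \<gamma> - 1))) has_sum ((F h + - F 0) * (1 / h) + - D)) A"
      using h e d by (intro has_sum_add has_sum_cmult_left F D has_sum_uminusI) auto
    then have 1: "((\<lambda>\<gamma>. c \<gamma> * (((\<tau> + h) ^ m \<gamma> - \<tau> ^ m \<gamma>) / h - real (m \<gamma>) * \<tau> ^ (m \<gamma> - 1)))
        has_sum ((F h - F 0) / h - D)) A"
      by (simp add: algebra_simps diff_divide_distrib)
    have 2: "((\<lambda>\<gamma>. (C / K\<^sup>2 * \<bar>h\<bar>) * (\<bar>c \<gamma>\<bar> * s ^ m \<gamma>)) has_sum ((C / K\<^sup>2 * \<bar>h\<bar>) * S)) A"
      by (intro has_sum_cmult_right S)
    have "norm ((F h - F 0) / h - D) \<le> (C / K\<^sup>2 * \<bar>h\<bar>) * S"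
    proof (rule norm_infsum_le[OF 1 2])
      fix \<gamma>
      have "norm (((\<tau> + h) ^ m \<gamma> - \<tau> ^ m \<gamma>) / h - of_nat (m \<gamma>) * \<tau> ^ (m \<gamma> - Suc 0))
          \<le> real (m \<gamma>) * real (m \<gamma> - Suc 0) * K ^ (m \<gamma> - 2) * norm h"
        using h e K by (intro lemma_termdiff3) auto
      also have "\<dots> \<le> C / K\<^sup>2 * s ^ m \<gamma> * norm h"
        by (intro mult_right_mono C2) auto
      finally have "\<bar>c \<gamma>\<bar> * norm (((\<tau> + h) ^ m \<gamma> - \<tau> ^ m \<gamma>) / h - of_nat (m \<gamma>) * \<tau> ^ (m \<gamma> - Suc 0))
          \<le> \<bar>c \<gamma>\<bar> * (C / K\<^sup>2 * s ^ m \<gamma> * norm h)" by (intro mult_left_mono) auto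
      then show "norm (c \<gamma> * (((\<tau> + h) ^ m \<gamma> - \<tau> ^ m \<gamma>) / h - real (m \<gamma>) * \<tau> ^ (m \<gamma> - 1)))
          \<le> C / K\<^sup>2 * \<bar>h\<bar> * (\<bar>c \<gamma>\<bar> * s ^ m \<gamma>)"
        by (simp only: real_norm_def abs_mult One_nat_def mult_ac)
    qed
    then show ?thesis by (simp only: real_norm_def mult_ac)
  qed
  have "((\<lambda>h. (F h - F 0) / h - D) \<longlongrightarrow> 0) (at 0)"
  proof (rule Lim_null_comparison)
    show "eventually (\<lambda>h. norm ((F h - F 0) / h - D) \<le> C / K\<^sup>2 * S * \<bar>h\<bar>) (at 0)"
      using quot e by (auto simp: eventually_at intro!: exI[of _ e])
    show "((\<lambda>h. C / K\<^sup>2 * S * \<bar>h\<bar>) \<longlongrightarrow> 0) (at 0)"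
      using K by (auto intro!: tendsto_eq_intros)
  qed
  then have "((\<lambda>h. (F h - F 0) / h) \<longlongrightarrow> D) (at 0)"
    using LIM_zero_iff by blast
  then have "(F has_real_derivative D) (at 0)"
    by (simp add: has_field_derivative_iff)
  then show ?thesis using D by blast
qed

text \<open>On a ball where the power series of \<open>f\<close> converges, freezing all coordinates but the one along \<open>b\<close>
  leaves a power series in one variable over the same set of multi-indices. Its termwise derivative
  is, after lowering the exponent of \<open>b\<close> by one, again a power series on the whole ball.\<close>

lemma real_analytic_on_directional_derivative:
  fixes f :: "'a::euclidean_space \<Rightarrow> real"
  assumes an: "real_analytic_on f S" and b: "b \<in> Basis"
  shows "\<And>x. x \<in> S \<Longrightarrow> (\<lambda>h. f (x + h *\<^sub>R b)) differentiable at (0::real)"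
    and "real_analytic_on (\<lambda>x. deriv (\<lambda>h. f (x + h *\<^sub>R b)) 0) S"
proof -
  have main: "\<exists>a' :: ('a \<Rightarrow> nat) \<Rightarrow> real. \<forall>y\<in>ball x r. \<exists>D.
        ((\<lambda>h. f (y + h *\<^sub>R b)) has_real_derivative D) (at 0) \<and>
        ((\<lambda>\<gamma>. a' \<gamma> * (\<Prod>b\<in>Basis. ((y - x) \<bullet> b) ^ \<gamma> b)) has_sum D) (Basis \<rightarrow>\<^sub>E UNIV)"
    if a: "\<forall>y\<in>ball x r. ((\<lambda>\<gamma>. a \<gamma> * (\<Prod>b\<in>Basis. ((y - x) \<bullet> b) ^ \<gamma> b)) has_sum f y) (Basis \<rightarrow>\<^sub>E UNIV)"
    for x r and a :: "('a \<Rightarrow> nat) \<Rightarrow> real"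
  proof -
    \<comment> \<open>the coefficients of the derivative, with the index shifted back by \<open>\<gamma>(b := \<gamma> b - 1)\<close>\<close>
    define a' where "a' \<gamma> = a (\<gamma>(b := Suc (\<gamma> b))) * real (Suc (\<gamma> b))" for \<gamma> :: "'a \<Rightarrow> nat"
    have "\<exists>D. ((\<lambda>h. f (y + h *\<^sub>R b)) has_real_derivative D) (at 0) \<and>
        ((\<lambda>\<gamma>. a' \<gamma> * (\<Prod>b\<in>Basis. ((y - x) \<bullet> b) ^ \<gamma> b)) has_sum D) (Basis \<rightarrow>\<^sub>E UNIV)"
      if y: "y \<in> ball x r" for y
    proof -
      define \<tau> where "\<tau> = (y - x) \<bullet> b"
      define P where "P \<gamma> = (\<Prod>b'\<in>Basis - {b}. ((y - x) \<bullet> b') ^ \<gamma> b')" for \<gamma> :: "'a \<Rightarrow> nat"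
      have split: "(\<Prod>b'\<in>Basis. ((y + h *\<^sub>R b - x) \<bullet> b') ^ \<gamma> b') = (\<tau> + h) ^ \<gamma> b * P \<gamma>" for h \<gamma>
      proof -
        have "(\<Prod>b'\<in>Basis. ((y + h *\<^sub>R b - x) \<bullet> b') ^ \<gamma> b')
            = ((y + h *\<^sub>R b - x) \<bullet> b) ^ \<gamma> b * (\<Prod>b'\<in>Basis - {b}. ((y + h *\<^sub>R b - x) \<bullet> b') ^ \<gamma> b')"
          using b by (intro prod.remove) auto
        also have "(\<Prod>b'\<in>Basis - {b}. ((y + h *\<^sub>R b - x) \<bullet> b') ^ \<gamma> b') = P \<gamma>"
          unfolding P_def using b
          by (intro prod.cong refl) (auto simp: inner_diff_left inner_add_left inner_Basis)
        also have "(y + h *\<^sub>R b - x) \<bullet> b = \<tau> + h"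
          using b by (simp add: \<tau>_def inner_diff_left inner_add_left)
        finally show ?thesis .
      qed
      define d where "d = r - dist x y"
      have d: "d > 0" using y by (simp add: d_def)
      have inb: "y + h *\<^sub>R b \<in> ball x r" if "\<bar>h\<bar> < d" for h
      proof -
        have "dist x (y + h *\<^sub>R b) \<le> dist x y + dist y (y + h *\<^sub>R b)" by (rule dist_triangle)
        also have "dist y (y + h *\<^sub>R b) = \<bar>h\<bar>" using b by (simp add: dist_norm)
        finally show ?thesis using that by (simp add: d_def)
      qed
      have F: "((\<lambda>\<gamma>. a \<gamma> * P \<gamma> * (\<tau> + h) ^ \<gamma> b) has_sum f (y + h *\<^sub>R b)) (Basis \<rightarrow>\<^sub>E UNIV)"
        if "\<bar>h\<bar> < d" for h
        using a[rule_format, OF inb[OF that]] by (simp add: split mult_ac)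
      \<comment> \<open>moving away from the centre along \<open>b\<close> gives absolute convergence at a larger radius\<close>
      define \<sigma> :: real where "\<sigma> = (if \<tau> \<ge> 0 then 1 else -1)"
      have sg: "\<bar>\<tau> + \<sigma> * (d / 2)\<bar> = \<bar>\<tau>\<bar> + d / 2" "\<bar>\<sigma> * (d / 2)\<bar> < d"
        using d by (auto simp: \<sigma>_def)
      have "(\<lambda>\<gamma>. a \<gamma> * P \<gamma> * (\<tau> + \<sigma> * (d / 2)) ^ \<gamma> b) summable_on (Basis \<rightarrow>\<^sub>E UNIV)"
        using F[OF sg(2)] summable_on_def by blast
      from summable_on_abs_real[OF this]
      have "(\<lambda>\<gamma>. \<bar>a \<gamma> * P \<gamma> * (\<bar>\<tau>\<bar> + d / 2) ^ \<gamma> b\<bar>) summable_on (Basis \<rightarrow>\<^sub>E UNIV)"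
        using d unfolding abs_mult power_abs sg(1) by simp
      then have "(\<lambda>\<gamma>. a \<gamma> * P \<gamma> * (\<bar>\<tau>\<bar> + d / 2) ^ \<gamma> b) summable_on (Basis \<rightarrow>\<^sub>E UNIV)"
        by (rule summable_on_if_abs_real)
      then obtain D where D: "((\<lambda>h. f (y + h *\<^sub>R b)) has_real_derivative D) (at 0)"
          "((\<lambda>\<gamma>. a \<gamma> * P \<gamma> * real (\<gamma> b) * \<tau> ^ (\<gamma> b - 1)) has_sum D) (Basis \<rightarrow>\<^sub>E UNIV)"
        using has_sum_power_has_derivative[where d = d and c = "\<lambda>\<gamma>. a \<gamma> * P \<gamma>" and \<tau> = \<tau> and m = "\<lambda>\<gamma>. \<gamma> b"
            and F = "\<lambda>h. f (y + h *\<^sub>R b)" and A = "Basis \<rightarrow>\<^sub>E UNIV" and s = "\<bar>\<tau>\<bar> + d / 2"] F d by auto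
      \<comment> \<open>the terms with \<open>\<gamma> b = 0\<close> vanish, so that the exponent of \<open>b\<close> can be lowered\<close>
      have "((\<lambda>\<gamma>. a \<gamma> * P \<gamma> * real (\<gamma> b) * \<tau> ^ (\<gamma> b - 1)) has_sum D) {\<gamma> \<in> Basis \<rightarrow>\<^sub>E UNIV. \<gamma> b > 0}"
        by (rule has_sum_cong_neutral[THEN iffD1, OF _ _ _ D(2)]) auto
      also have "?this \<longleftrightarrow> ((\<lambda>\<gamma>. a' \<gamma> * (\<Prod>b\<in>Basis. ((y - x) \<bullet> b) ^ \<gamma> b)) has_sum D) (Basis \<rightarrow>\<^sub>E UNIV)"
      proof (rule has_sum_reindex_bij_witness[where i = "\<lambda>\<gamma>. \<gamma>(b := Suc (\<gamma> b))" and j = "\<lambda>\<gamma>. \<gamma>(b := \<gamma> b - 1)"])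
        fix \<gamma> assume \<gamma>: "\<gamma> \<in> {\<gamma> \<in> Basis \<rightarrow>\<^sub>E (UNIV :: nat set). \<gamma> b > 0}"
        have "P (\<gamma>(b := \<gamma> b - 1)) = P \<gamma>" unfolding P_def by (intro prod.cong) auto
        then show "a' (\<gamma>(b := \<gamma> b - 1)) * (\<Prod>ba\<in>Basis. ((y - x) \<bullet> ba) ^ (\<gamma>(b := \<gamma> b - 1)) ba)
            = a \<gamma> * P \<gamma> * real (\<gamma> b) * \<tau> ^ (\<gamma> b - 1)"
          using \<gamma> split[of 0 "\<gamma>(b := \<gamma> b - 1)"] by (simp add: a'_def)
      next
        fix \<gamma> :: "'a \<Rightarrow> nat" assume \<gamma>: "\<gamma> \<in> Basis \<rightarrow>\<^sub>E UNIV"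
        show "\<gamma>(b := Suc (\<gamma> b)) \<in> {\<gamma> \<in> Basis \<rightarrow>\<^sub>E UNIV. \<gamma> b > 0}"
          using b PiE_arb[OF \<gamma>] by (intro CollectI conjI PiE_I) auto
      next
        fix \<gamma> :: "'a \<Rightarrow> nat" assume \<gamma>: "\<gamma> \<in> {\<gamma> \<in> Basis \<rightarrow>\<^sub>E UNIV. \<gamma> b > 0}"
        then have "\<gamma> x = undefined" if "x \<notin> Basis" for x using PiE_arb that by blast
        then show "\<gamma>(b := \<gamma> b - 1) \<in> Basis \<rightarrow>\<^sub>E UNIV"
          using b by (intro PiE_I) auto
      qed auto
      finally show ?thesis using D(1) by blast
    qed
    then show ?thesis by blast
  qed
  show "(\<lambda>h. f (x + h *\<^sub>R b)) differentiable at (0::real)" if x: "x \<in> S" for x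
  proof -
    obtain r a where r: "r > 0" and a: "\<forall>y\<in>ball x r. ((\<lambda>\<gamma>. a \<gamma> * (\<Prod>b\<in>Basis. ((y - x) \<bullet> b) ^ \<gamma> b)) has_sum f y) (Basis \<rightarrow>\<^sub>E UNIV)"
      using an x unfolding real_analytic_on_def by meson
    from main[OF a] obtain D where "((\<lambda>h. f (x + h *\<^sub>R b)) has_real_derivative D) (at 0)"
      using r by fastforce
    then show ?thesis by (rule real_differentiableI)
  qed
  show "real_analytic_on (\<lambda>x. deriv (\<lambda>h. f (x + h *\<^sub>R b)) 0) S"
    unfolding real_analytic_on_def
  proof
    fix x assume x: "x \<in> S"
    obtain r a where r: "r > 0" and a: "\<forall>y\<in>ball x r. ((\<lambda>\<gamma>. a \<gamma> * (\<Prod>b\<in>Basis. ((y - x) \<bullet> b) ^ \<gamma> b)) has_sum f y) (Basis \<rightarrow>\<^sub>E UNIV)"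
      using an x unfolding real_analytic_on_def by meson
    show "\<exists>r>0. \<exists>a. \<forall>y\<in>ball x r. ((\<lambda>\<gamma>. a \<gamma> * (\<Prod>b\<in>Basis. ((y - x) \<bullet> b) ^ \<gamma> b))
        has_sum deriv (\<lambda>h. f (y + h *\<^sub>R b)) 0) (Basis \<rightarrow>\<^sub>E UNIV)"
    proof -
      from main[OF a] obtain a' where a': "\<forall>y\<in>ball x r. \<exists>D. ((\<lambda>h. f (y + h *\<^sub>R b)) has_real_derivative D) (at 0) \<and>
          ((\<lambda>\<gamma>. a' \<gamma> * (\<Prod>b\<in>Basis. ((y - x) \<bullet> b) ^ \<gamma> b)) has_sum D) (Basis \<rightarrow>\<^sub>E UNIV)" ..
      have "((\<lambda>\<gamma>. a' \<gamma> * (\<Prod>b\<in>Basis. ((y - x) \<bullet> b) ^ \<gamma> b))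
        has_sum deriv (\<lambda>h. f (y + h *\<^sub>R b)) 0) (Basis \<rightarrow>\<^sub>E UNIV)" if y: "y \<in> ball x r" for y
      proof -
        from a' y obtain D where "((\<lambda>h. f (y + h *\<^sub>R b)) has_real_derivative D) (at 0)"
            "((\<lambda>\<gamma>. a' \<gamma> * (\<Prod>b\<in>Basis. ((y - x) \<bullet> b) ^ \<gamma> b)) has_sum D) (Basis \<rightarrow>\<^sub>E UNIV)"
          by blast
        then show ?thesis by (simp only: DERIV_imp_deriv)
      qed
      then show ?thesis using r by blast
    qed
  qed
qed

lemma real_analytic_on_partials:
  fixes u :: "real^'n::finite \<Rightarrow> real \<Rightarrow> real"
  assumes "real_analytic_on (\<lambda>(x, t). u x t) (UNIV \<times> {0<..})"
  shows "real_analytic_on (\<lambda>(x, t). partials is (\<lambda>z. u z t) x) (UNIV \<times> {0<..})"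
proof (induction "is")
  case Nil then show ?case using assms by simp
next
  case (Cons i "is")
  have "(axis i 1, 0) \<in> (Basis :: ((real^'n) \<times> real) set)"
    by (auto simp: Basis_prod_def Basis_vec_def)
  from real_analytic_on_directional_derivative(2)[OF Cons.IH this]
  show ?case by (simp add: partial_def case_prod_unfold)
qed

lemma axis_smooth_slice:
  fixes u :: "real^'n::finite \<Rightarrow> real \<Rightarrow> real"
  assumes "real_analytic_on (\<lambda>(x, t). u x t) (UNIV \<times> {0<..})" "t > 0"
  shows "axis_smooth (\<lambda>x. u x t)"
  unfolding axis_smooth_def
proof (intro allI)
  fix "is" i x
  have "(axis i 1, 0) \<in> (Basis :: ((real^'n) \<times> real) set)"
    by (auto simp: Basis_prod_def Basis_vec_def)
  from real_analytic_on_directional_derivative(1)[OF real_analytic_on_partials[OF assms(1)] this, of "(x, t)" "is"] assms(2)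
  show "partially_differentiable i (partials is (\<lambda>x. u x t)) x" by simp
qed

lemma partials_differentiable_time:
  fixes u :: "real^'n::finite \<Rightarrow> real \<Rightarrow> real"
  assumes "real_analytic_on (\<lambda>(x, t). u x t) (UNIV \<times> {0<..})" "t > 0"
  shows "(\<lambda>s. partials is (\<lambda>z. u z s) x) differentiable at t"
proof -
  have "(0, 1) \<in> (Basis :: ((real^'n) \<times> real) set)"
    by (simp add: Basis_prod_def)
  from real_analytic_on_directional_derivative(1)[OF real_analytic_on_partials[OF assms(1)] this, of "(x, t)" "is"] assms(2)
  have "(\<lambda>h. partials is (\<lambda>z. u z (t + h)) x) differentiable at 0" by simp
  then obtain D where "((\<lambda>h. partials is (\<lambda>z. u z (t + h)) x) has_real_derivative D) (at 0)"
    by (metis DERIV_deriv_iff_real_differentiable)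
  then have "((\<lambda>h. partials is (\<lambda>z. u z (h + t)) x) has_real_derivative D) (at 0)"
    by (simp add: add.commute)
  then have "((\<lambda>s. partials is (\<lambda>z. u z s) x) has_real_derivative D) (at t)"
    using DERIV_shift[of "\<lambda>s. partials is (\<lambda>z. u z s) x" D 0 t] by simp
  then show ?thesis by (rule real_differentiableI)
qed


section \<open>Self-similarity and decay of the kernels\<close>

text \<open>Differentiation under the integral sign. It is used both for the derivatives of the kernel, where
  the parameter is a point, and for integration by parts, where it is a translation.\<close>

lemma has_derivative_lborel_integral:
  fixes F F' :: "real \<Rightarrow> 'a::euclidean_space \<Rightarrow> real"
  assumes F': "\<And>h y. \<bar>h\<bar> < 1 \<Longrightarrow> ((\<lambda>h. F h y) has_real_derivative F' h y) (at h)"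
    and bd: "\<And>h y. \<bar>h\<bar> < 1 \<Longrightarrow> \<bar>F' h y\<bar> \<le> w y"
    and w: "integrable lborel w"
    and F: "\<And>h. integrable lborel (F h)"
  shows "((\<lambda>h. LINT y|lborel. F h y) has_real_derivative (LINT y|lborel. F' 0 y)) (at 0)"
proof -
  have quot: "\<bar>(F h y - F 0 y) / h\<bar> \<le> w y" if h: "h \<noteq> 0" "\<bar>h\<bar> < 1" for h y
  proof -
    have "norm (F h y - F 0 y) \<le> w y * norm (h - 0)"
      by (rule field_differentiable_bound[of "ball 0 1" "\<lambda>h. F h y" "\<lambda>h. F' h y"])
         (use h F' bd in \<open>auto simp: dist_real_def intro: DERIV_subset\<close>)
    then show ?thesis using h by (simp add: abs_divide divide_le_eq)
  qed
  have qlim: "((\<lambda>h. (F h y - F 0 y) / h) \<longlongrightarrow> F' 0 y) (at 0)" for y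
    using F'[of 0 y] by (simp add: has_field_derivative_iff)
  have "((\<lambda>h. LINT y|lborel. (F h y - F 0 y) / h) \<longlongrightarrow> (LINT y|lborel. F' 0 y)) (at 0)"
    unfolding tendsto_at_iff_sequentially comp_def
  proof (intro allI impI)
    fix X :: "nat \<Rightarrow> real" assume X: "\<forall>i. X i \<in> UNIV - {0}" "X \<longlonglongrightarrow> 0"
    then have "eventually (\<lambda>n. \<bar>X n\<bar> < 1) sequentially"
      using order_tendstoD(2)[OF tendsto_rabs[OF X(2)], of 1] by simp
    then obtain N where N: "\<And>n. n \<ge> N \<Longrightarrow> \<bar>X n\<bar> < 1" by (auto simp: eventually_sequentially)
    have lim: "(\<lambda>n. (F (X (n + N)) y - F 0 y) / X (n + N)) \<longlonglongrightarrow> F' 0 y" for y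
      using qlim[of y] X LIMSEQ_ignore_initial_segment
      unfolding tendsto_at_iff_sequentially comp_def by blast
    have m: "(\<lambda>y. (F (X (n + N)) y - F 0 y) / X (n + N)) \<in> borel_measurable lborel" for n
      using F by (intro borel_measurable_divide borel_measurable_diff) auto
    have "(\<lambda>n. LINT y|lborel. (F (X (n + N)) y - F 0 y) / X (n + N)) \<longlonglongrightarrow> (LINT y|lborel. F' 0 y)"
    proof (rule integral_dominated_convergence[where w = w])
      show "(\<lambda>y. F' 0 y) \<in> borel_measurable lborel"
        by (rule borel_measurable_LIMSEQ_metric[OF m lim])
      show "AE y in lborel. norm ((F (X (n + N)) y - F 0 y) / X (n + N)) \<le> w y" for n
        using quot X N[of "n + N"] by (intro AE_I2) auto
    qed (use m w lim in auto)
    then show "(\<lambda>n. LINT y|lborel. (F (X n) y - F 0 y) / X n) \<longlonglongrightarrow> (LINT y|lborel. F' 0 y)"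
      by (rule LIMSEQ_offset)
  qed
  moreover have eq: "(LINT y|lborel. (F h y - F 0 y) / h) = ((LINT y|lborel. F h y) - (LINT y|lborel. F 0 y)) / h" for h
    using F by (simp add: Bochner_Integration.integral_diff)
  ultimately show ?thesis by (simp only: has_field_derivative_iff eq diff_zero)
qed

lemma integral_lborel_translate:
  fixes f :: "'a::euclidean_space \<Rightarrow> real"
  assumes [measurable]: "f \<in> borel_measurable borel"
  shows "(LINT x|lborel. f (x + a)) = (LINT x|lborel. f x)"
proof -
  have "(LINT x|lborel. f x) = (LINT x|distr lborel borel ((+) a). f x)"
    by (simp add: lborel_distr_plus)
  also have "\<dots> = (LINT x|lborel. f (a + x))"
    by (subst integral_distr) auto
  finally show ?thesis by (simp add: add.commute)
qed

text \<open>All substitutions below are linear. This common form covers Borel and completed Lebesgue measure.\<close>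

lemma change_of_variables_constant_jacobian:
  fixes T :: "'a \<Rightarrow> 'a" and J :: real
  assumes M: "M = density (distr M N T) (\<lambda>_. ennreal J)"
    and T: "T \<in> M \<rightarrow>\<^sub>M N" and N: "sets N = sets M" and J: "J > 0"
  shows "\<And>H. H \<in> borel_measurable M \<Longrightarrow> (\<integral>\<^sup>+z. H z \<partial>M) = ennreal J * (\<integral>\<^sup>+z. H (T z) \<partial>M)"
    and "\<And>H :: 'a \<Rightarrow> real. integrable M H \<Longrightarrow> integrable M (\<lambda>z. H (T z))"
    and "\<And>H :: 'a \<Rightarrow> real. H \<in> borel_measurable M \<Longrightarrow> (LINT z|M. H z) = J * (LINT z|M. H (T z))"
proof -
  have m: "H \<in> borel_measurable N \<longleftrightarrow> H \<in> borel_measurable M" for H :: "'a \<Rightarrow> 'b::topological_space"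
    by (simp add: measurable_cong_sets[OF N refl])
  show "(\<integral>\<^sup>+z. H z \<partial>M) = ennreal J * (\<integral>\<^sup>+z. H (T z) \<partial>M)" if H: "H \<in> borel_measurable M" for H
  proof -
    have HN: "H \<in> borel_measurable N" using H by (simp add: m)
    have "(\<integral>\<^sup>+z. H z \<partial>M) = (\<integral>\<^sup>+z. H z \<partial>density (distr M N T) (\<lambda>_. ennreal J))"
      by (rule arg_cong[OF M])
    also have "\<dots> = (\<integral>\<^sup>+z. ennreal J * H (T z) \<partial>M)"
      using T HN by (simp add: nn_integral_density nn_integral_distr)
    also have "\<dots> = ennreal J * (\<integral>\<^sup>+z. H (T z) \<partial>M)"
      using measurable_compose[OF T HN] by (rule nn_integral_cmult)
    finally show ?thesis .
  qed
  show "integrable M (\<lambda>z. H (T z))" if H: "integrable M H" for H :: "'a \<Rightarrow> real"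
  proof -
    have HN: "H \<in> borel_measurable N" using H by (simp add: m)
    have "integrable (density (distr M N T) (\<lambda>_. ennreal J)) H"
      using H by (rule subst[OF M])
    then have "integrable (distr M N T) (\<lambda>z. J *\<^sub>R H z)"
      using J HN by (subst (asm) integrable_density) auto
    then have "integrable M (\<lambda>z. J *\<^sub>R H (T z))"
      using T HN by (subst (asm) integrable_distr_eq) auto
    then show ?thesis using J by simp
  qed
  show "(LINT z|M. H z) = J * (LINT z|M. H (T z))" if H: "H \<in> borel_measurable M" for H :: "'a \<Rightarrow> real"
  proof -
    have HN: "H \<in> borel_measurable N" using H by (simp add: m)
    have "(LINT z|M. H z) = (LINT z|density (distr M N T) (\<lambda>_. ennreal J). H z)"
      by (rule arg_cong[OF M])
    also have "\<dots> = (LINT z|distr M N T. J *\<^sub>R H z)"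
      using J HN by (subst integral_density) auto
    also have "\<dots> = (LINT z|M. J *\<^sub>R H (T z))"
      using T HN by (subst integral_distr) auto
    finally show ?thesis by simp
  qed
qed

lemma integral_lborel_dilate:
  fixes f :: "'a::euclidean_space \<Rightarrow> real"
  assumes f: "f \<in> borel_measurable borel" and c: "c > 0"
  shows "(LINT x|lborel. f x) = c ^ DIM('a) * (LINT x|lborel. f (c *\<^sub>R x))"
proof (rule change_of_variables_constant_jacobian(3))
  show "(lborel :: 'a measure) = density (distr lborel borel ((*\<^sub>R) c)) (\<lambda>_. ennreal (c ^ DIM('a)))"
    using lborel_affine[of c "0::'a"] c by simp
qed (use f c in auto)

lemma norm_le_shift_axis:
  fixes \<xi> :: "real^'n::finite"
  assumes "\<bar>h\<bar> \<le> 1"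
  shows "1 + norm \<xi> \<le> 2 * (1 + norm (\<xi> + h *\<^sub>R axis i 1))"
proof -
  have "norm \<xi> \<le> norm (\<xi> + h *\<^sub>R axis i 1) + norm (h *\<^sub>R axis i (1::real) :: real^'n)"
    by (metis add_diff_cancel norm_triangle_ineq4)
  then have "norm \<xi> \<le> norm (\<xi> + h *\<^sub>R axis i 1) + 1" using assms by simp
  then show ?thesis using norm_ge_zero[of "\<xi> + h *\<^sub>R axis i 1"] by argo
qed

text \<open>An integrable weight on \<open>\<real>\<^sup>n\<close> that is a product over the coordinates, so that decay can be
  established one coordinate at a time.\<close>

definition cauchy_weight :: "real^'n::finite \<Rightarrow> real" where
  "cauchy_weight z = (\<Prod>i\<in>UNIV. inverse (1 + (z $ i)\<^sup>2))"

lemma cauchy_weight_pos: "cauchy_weight z > 0"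
  unfolding cauchy_weight_def by (intro prod_pos) (simp add: add_pos_nonneg)

lemma cauchy_weight_continuous: "continuous_on UNIV cauchy_weight"
proof -
  have "1 + (x $ i)\<^sup>2 \<noteq> 0" for x :: "real^'n" and i
    by (smt (verit) zero_le_power2)
  then show ?thesis unfolding cauchy_weight_def[abs_def] by (intro continuous_intros) auto
qed

lemma cauchy_weight_measurable [measurable]: "cauchy_weight \<in> borel_measurable borel"
  using cauchy_weight_continuous by (rule borel_measurable_continuous_onI)

lemma cauchy_weight_lower:
  fixes z :: "real^'n::finite"
  shows "1 \<le> (1 + norm z) ^ (2 * CARD('n)) * cauchy_weight z"
proof -
  have "(1 + norm z) ^ (2 * CARD('n)) * cauchy_weight z
      = (\<Prod>i\<in>(UNIV::'n set). (1 + norm z)\<^sup>2 * inverse (1 + (z $ i)\<^sup>2))"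
    by (simp add: cauchy_weight_def prod.distrib power_mult)
  also have "\<dots> \<ge> 1"
  proof (rule prod_ge_1)
    fix i :: 'n
    have "(z $ i)\<^sup>2 \<le> (norm z)\<^sup>2"
      using component_le_norm_cart[of z i] by (simp add: abs_le_square_iff[symmetric])
    moreover have "(1 + norm z)\<^sup>2 = 1 + (norm z)\<^sup>2 + 2 * norm z" by (simp add: power2_sum)
    ultimately have "1 + (z $ i)\<^sup>2 \<le> (1 + norm z)\<^sup>2" using norm_ge_zero[of z] by linarith
    moreover have "1 + (z $ i)\<^sup>2 > 0" by (simp add: add_pos_nonneg)
    ultimately show "1 \<le> (1 + norm z)\<^sup>2 * inverse (1 + (z $ i)\<^sup>2)"
      by (simp add: field_simps)
  qed
  finally show ?thesis .
qed

lemma integrable_cauchy_weight: "integrable lborel (cauchy_weight :: real^'n::finite \<Rightarrow> real)"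
proof (rule integrableI_nonneg)
  have inj: "inj_on (\<lambda>i. axis i (1::real)) (UNIV :: 'n set)"
    by (auto simp: inj_on_def axis_eq_axis)
  have B: "(Basis :: (real^'n) set) = (\<lambda>i. axis i 1) ` UNIV"
    by (auto simp: Basis_vec_def)
  have eq: "cauchy_weight x = (\<Prod>b\<in>Basis. inverse (1 + (x \<bullet> b)\<^sup>2))" for x :: "real^'n"
    unfolding B by (subst prod.reindex[OF inj]) (simp add: cauchy_weight_def cart_eq_inner_axis)
  have I: "(\<integral>\<^sup>+x. ennreal (inverse (1 + x\<^sup>2)) \<partial>lborel) < \<infinity>"
  proof -
    have "integrable lborel (\<lambda>x::real. inverse (1 + x\<^sup>2))"
      using integrable_inverse_1_plus_square by (simp add: set_integrable_def)
    then show ?thesis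
      using integrableD(2)[of lborel "\<lambda>x::real. inverse (1 + x\<^sup>2)"] by (simp add: less_top)
  qed
  have "(\<integral>\<^sup>+x. ennreal (cauchy_weight (x::real^'n)) \<partial>lborel) = (\<integral>\<^sup>+x. (\<Prod>b\<in>Basis. ennreal (inverse (1 + ((x::real^'n) \<bullet> b)\<^sup>2))) \<partial>lborel)"
    by (simp add: eq prod_ennreal)
  also have "\<dots> = (\<Prod>b\<in>(Basis :: (real^'n) set). (\<integral>\<^sup>+x. ennreal (inverse (1 + x\<^sup>2)) \<partial>lborel))"
    by (rule nn_integral_lborel_prod) auto
  also have "\<dots> < \<infinity>"
    using I by (simp add: power_less_top_ennreal)
  finally show "(\<integral>\<^sup>+x. ennreal (cauchy_weight (x :: real^'n)) \<partial>lborel) < \<infinity>" .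
qed (use cauchy_weight_pos in \<open>auto intro: less_imp_le\<close>)

text \<open>Polynomials times \<open>exp (- |\<xi>|\<^sup>4)\<close>, the Fourier symbol of the biharmonic kernel at time 1. Derivatives
  of the kernel multiply its symbol by coordinates, and powers of \<open>x\<close> differentiate it; the class is
  closed under both.\<close>

inductive quartic_symbol :: "(real^'n::finite \<Rightarrow> real) \<Rightarrow> bool" where
  base: "quartic_symbol (\<lambda>\<xi>. exp (- (norm \<xi> ^ 4)))"
| coord: "quartic_symbol g \<Longrightarrow> quartic_symbol (\<lambda>\<xi>. \<xi> $ i * g \<xi>)"
| add: "quartic_symbol g \<Longrightarrow> quartic_symbol h \<Longrightarrow> quartic_symbol (\<lambda>\<xi>. g \<xi> + h \<xi>)"
| scale: "quartic_symbol g \<Longrightarrow> quartic_symbol (\<lambda>\<xi>. c * g \<xi>)"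

lemma quartic_symbol_sum:
  assumes "finite A" "A \<noteq> {}" "\<And>j. j \<in> A \<Longrightarrow> quartic_symbol (g j)"
  shows "quartic_symbol (\<lambda>\<xi>. \<Sum>j\<in>A. g j \<xi>)"
  using assms
proof (induction A rule: finite_ne_induct)
  case (insert j A)
  have "quartic_symbol (\<lambda>\<xi>. g j \<xi> + (\<Sum>j\<in>A. g j \<xi>))"
    using insert by (intro quartic_symbol.add) auto
  then show ?case using insert by simp
qed simp

lemma power_le_exp:
  fixes x :: real
  assumes "x \<ge> 0"
  shows "x ^ k \<le> real k ^ k * exp x"
proof (cases "k = 0")
  case False
  have "x ^ k = real k ^ k * (x / real k) ^ k" using False by (simp add: power_divide)
  also have "\<dots> \<le> real k ^ k * (1 + x / real k) ^ k"
    using assms by (intro mult_left_mono power_mono) auto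
  also have "\<dots> \<le> real k ^ k * exp x"
    using False assms by (intro mult_left_mono exp_ge_one_plus_x_over_n_power_n) auto
  finally show ?thesis .
qed (use assms in simp)

lemma quartic_symbol_bound:
  assumes "quartic_symbol g"
  shows "\<exists>C. \<forall>\<xi>. \<bar>g \<xi>\<bar> * (1 + norm \<xi>) ^ k \<le> C"
  using assms
proof (induction arbitrary: k)
  case base
  have "\<bar>exp (- (norm \<xi> ^ 4))\<bar> * (1 + norm \<xi>) ^ k \<le> 2 ^ k * (1 + real k ^ k)" for \<xi> :: "real^'n"
  proof -
    let ?r = "norm \<xi>"
    have "(1 + ?r) ^ k \<le> 2 ^ k * (1 + (?r ^ 4) ^ k)"
    proof (cases "?r \<le> 1")
      case True
      then have "(1 + ?r) ^ k \<le> 2 ^ k" by (intro power_mono) auto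
      also have "\<dots> \<le> 2 ^ k * (1 + (?r ^ 4) ^ k)" by simp
      finally show ?thesis .
    next
      case False
      then have "(1 + ?r) ^ k \<le> (2 * ?r ^ 4) ^ k"
        using self_le_power[of ?r 4] by (intro power_mono) auto
      also have "\<dots> \<le> 2 ^ k * (1 + (?r ^ 4) ^ k)" by (simp add: power_mult_distrib)
      finally show ?thesis .
    qed
    also have "\<dots> \<le> 2 ^ k * (exp (?r ^ 4) + real k ^ k * exp (?r ^ 4))"
      by (intro mult_left_mono add_mono power_le_exp) auto
    finally have "exp (- (?r ^ 4)) * (1 + ?r) ^ k \<le> exp (- (?r ^ 4)) * (2 ^ k * (exp (?r ^ 4) + real k ^ k * exp (?r ^ 4)))"
      by (intro mult_left_mono) auto
    also have "\<dots> = 2 ^ k * (1 + real k ^ k)" by (simp add: algebra_simps exp_minus)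
    finally show ?thesis by simp
  qed
  then show ?case by blast
next
  case (coord g i)
  obtain C where C: "\<And>\<xi>. \<bar>g \<xi>\<bar> * (1 + norm \<xi>) ^ Suc k \<le> C" using coord.IH by meson
  have "\<bar>\<xi> $ i * g \<xi>\<bar> * (1 + norm \<xi>) ^ k \<le> C" for \<xi>
  proof -
    have "\<bar>\<xi> $ i * g \<xi>\<bar> * (1 + norm \<xi>) ^ k = \<bar>\<xi> $ i\<bar> * (\<bar>g \<xi>\<bar> * (1 + norm \<xi>) ^ k)"
      by (simp add: abs_mult)
    also have "\<dots> \<le> (1 + norm \<xi>) * (\<bar>g \<xi>\<bar> * (1 + norm \<xi>) ^ k)"
      using component_le_norm_cart[of \<xi> i] by (intro mult_right_mono) auto
    also have "\<dots> \<le> C" using C[of \<xi>] by (simp add: mult_ac)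
    finally show ?thesis .
  qed
  then show ?case by blast
next
  case (add g h)
  obtain C D where C: "\<And>\<xi>. \<bar>g \<xi>\<bar> * (1 + norm \<xi>) ^ k \<le> C" and D: "\<And>\<xi>. \<bar>h \<xi>\<bar> * (1 + norm \<xi>) ^ k \<le> D"
    using add.IH by meson
  have "\<bar>g \<xi> + h \<xi>\<bar> * (1 + norm \<xi>) ^ k \<le> C + D" for \<xi>
  proof -
    have "\<bar>g \<xi> + h \<xi>\<bar> * (1 + norm \<xi>) ^ k \<le> (\<bar>g \<xi>\<bar> + \<bar>h \<xi>\<bar>) * (1 + norm \<xi>) ^ k"
      by (intro mult_right_mono) auto
    then show ?thesis using C[of \<xi>] D[of \<xi>] by (simp add: distrib_right)
  qed
  then show ?case by blast
next
  case (scale g c)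
  obtain C where C: "\<And>\<xi>. \<bar>g \<xi>\<bar> * (1 + norm \<xi>) ^ k \<le> C" using scale.IH by meson
  have "\<bar>c * g \<xi>\<bar> * (1 + norm \<xi>) ^ k \<le> \<bar>c\<bar> * C" for \<xi>
    using mult_left_mono[OF C, of "\<bar>c\<bar>"] by (simp add: abs_mult mult.assoc)
  then show ?case by blast
qed

lemma quartic_symbol_continuous: "quartic_symbol g \<Longrightarrow> continuous_on UNIV g"
  by (induction rule: quartic_symbol.induct) (auto intro!: continuous_intros)

lemma quartic_symbol_measurable: "quartic_symbol g \<Longrightarrow> g \<in> borel_measurable borel"
  using quartic_symbol_continuous by (rule borel_measurable_continuous_onI)

text \<open>The shift by \<open>h\<close> is included because the difference quotients of a symbol need a common majorant.\<close>

lemma quartic_symbol_dominated: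
  fixes g :: "real^'n::finite \<Rightarrow> real"
  assumes "quartic_symbol g"
  shows "\<exists>C. \<forall>\<xi> i h. \<bar>h\<bar> \<le> 1 \<longrightarrow> \<bar>g (\<xi> + h *\<^sub>R axis i 1)\<bar> \<le> C * cauchy_weight \<xi>"
proof -
  obtain C where C: "\<And>\<xi>. \<bar>g \<xi>\<bar> * (1 + norm \<xi>) ^ (2 * CARD('n)) \<le> C"
    using quartic_symbol_bound[OF assms] by meson
  have C0: "C \<ge> 0" using C[of 0] by (smt (verit) abs_ge_zero mult_nonneg_nonneg norm_ge_zero zero_le_power)
  have "\<bar>g (\<xi> + h *\<^sub>R axis i 1)\<bar> \<le> 2 ^ (2 * CARD('n)) * C * cauchy_weight \<xi>" if h: "\<bar>h\<bar> \<le> 1" for \<xi> i h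
  proof -
    let ?\<eta> = "\<xi> + h *\<^sub>R axis i 1" and ?m = "2 * CARD('n)"
    have "\<bar>g ?\<eta>\<bar> \<le> \<bar>g ?\<eta>\<bar> * ((1 + norm \<xi>) ^ ?m * cauchy_weight \<xi>)"
      using mult_left_mono[OF cauchy_weight_lower[of \<xi>], of "\<bar>g ?\<eta>\<bar>"] by simp
    also have "\<dots> \<le> \<bar>g ?\<eta>\<bar> * ((2 * (1 + norm ?\<eta>)) ^ ?m * cauchy_weight \<xi>)"
      using norm_le_shift_axis[OF h, of \<xi> i] less_imp_le[OF cauchy_weight_pos]
      by (intro mult_left_mono mult_right_mono power_mono) auto
    also have "\<dots> = 2 ^ ?m * (\<bar>g ?\<eta>\<bar> * (1 + norm ?\<eta>) ^ ?m) * cauchy_weight \<xi>"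
      by (simp only: power_mult_distrib mult_ac)
    also have "\<dots> \<le> 2 ^ ?m * C * cauchy_weight \<xi>"
      using C less_imp_le[OF cauchy_weight_pos] by (intro mult_left_mono mult_right_mono) auto
    finally show ?thesis .
  qed
  then show ?thesis by blast
qed

lemma quartic_symbol_integrable:
  fixes g :: "real^'n::finite \<Rightarrow> real"
  assumes "quartic_symbol g"
  shows "integrable lborel g"
proof -
  obtain C where C: "\<And>\<xi> h i. \<bar>h\<bar> \<le> 1 \<longrightarrow> \<bar>g (\<xi> + h *\<^sub>R axis i 1)\<bar> \<le> C * cauchy_weight \<xi>"
    using quartic_symbol_dominated[OF assms] by meson
  have "\<bar>g \<xi>\<bar> \<le> C * cauchy_weight \<xi>" for \<xi> using C[of 0 \<xi> undefined] by simp
  moreover have "C * cauchy_weight \<xi> \<le> \<bar>C\<bar> * cauchy_weight \<xi>" for \<xi>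
    using less_imp_le[OF cauchy_weight_pos] by (intro mult_right_mono) auto
  ultimately have bd: "\<bar>g \<xi>\<bar> \<le> \<bar>C\<bar> * cauchy_weight \<xi>" for \<xi> by (rule order_trans)
  show ?thesis
    using quartic_symbol_measurable[OF assms] bd
    by (intro Bochner_Integration.integrable_bound[OF integrable_mult_right[OF integrable_cauchy_weight, of "\<bar>C\<bar>"]] AE_I2)
       (auto simp: abs_mult abs_of_pos[OF cauchy_weight_pos])
qed

text \<open>The derivative of the exponential is \<open>- 4 |\<xi>|\<^sup>2 \<xi>\<^sub>i exp (- |\<xi>|\<^sup>4)\<close>, a sum of products of coordinates
  with the exponential; the product rule does the rest.\<close>

lemma quartic_symbol_partial:
  fixes g :: "real^'n::finite \<Rightarrow> real"
  assumes "quartic_symbol g"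
  shows "\<exists>g'. quartic_symbol g' \<and> (\<forall>\<xi>. ((\<lambda>h. g (\<xi> + h *\<^sub>R axis i 1)) has_real_derivative g' \<xi>) (at 0))"
  using assms
proof induction
  case base
  define g' :: "real^'n \<Rightarrow> real" where
    "g' \<xi> = - 4 * (\<Sum>j\<in>UNIV. \<xi> $ j * (\<xi> $ j * (\<xi> $ i * exp (- (norm \<xi> ^ 4)))))" for \<xi>
  have "quartic_symbol g'"
    unfolding g'_def by (intro quartic_symbol.intros quartic_symbol_sum) auto
  moreover have "((\<lambda>h. exp (- (norm (\<xi> + h *\<^sub>R axis i 1) ^ 4))) has_real_derivative g' \<xi>) (at 0)" for \<xi>
  proof -
    have n2: "(norm (\<xi> + h *\<^sub>R axis i 1))\<^sup>2 = (norm \<xi>)\<^sup>2 + 2 * h * \<xi> $ i + h\<^sup>2" for h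
    proof -
      have "(norm (\<xi> + h *\<^sub>R axis i 1))\<^sup>2 = \<xi> \<bullet> \<xi> + 2 * h * (\<xi> \<bullet> axis i 1) + h * h * (axis i (1::real) \<bullet> axis i 1)"
        unfolding power2_norm_eq_inner by (simp add: algebra_simps inner_commute)
      then show ?thesis
        by (simp add: power2_norm_eq_inner cart_eq_inner_axis[symmetric] power2_eq_square[of h] inner_axis_axis)
    qed
    have n4: "norm (\<xi> + h *\<^sub>R axis i 1) ^ 4 = ((norm \<xi>)\<^sup>2 + 2 * h * \<xi> $ i + h\<^sup>2)\<^sup>2" for h
      unfolding n2[symmetric] by simp
    have g'eq: "g' \<xi> = - 4 * ((norm \<xi>)\<^sup>2 * \<xi> $ i * exp (- (norm \<xi> ^ 4)))"
      unfolding g'_def power2_norm_eq_inner inner_vec_def sum_distrib_right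
      by (simp add: mult.assoc sum_distrib_left)
    show ?thesis unfolding n4 g'eq
      by (rule derivative_eq_intros refl | simp)+
  qed
  ultimately show ?case by blast
next
  case (coord g j)
  then obtain g' where g': "quartic_symbol g'"
      "\<And>\<xi>. has_partial i g (g' \<xi>) \<xi>" by blast
  have "quartic_symbol (\<lambda>\<xi>. (if i = j then 1 else 0) * g \<xi> + \<xi> $ j * g' \<xi>)"
    by (intro quartic_symbol.intros coord.hyps g')
  moreover have "((\<lambda>h. (\<xi> + h *\<^sub>R axis i 1) $ j * g (\<xi> + h *\<^sub>R axis i 1))
      has_real_derivative (if i = j then 1 else 0) * g \<xi> + \<xi> $ j * g' \<xi>) (at 0)" for \<xi>
  proof -
    have "((\<lambda>h. (\<xi> + h *\<^sub>R axis i 1) $ j) has_real_derivative (if i = j then 1 else 0)) (at 0)"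
      by (auto simp: axis_def intro!: derivative_eq_intros)
    from DERIV_mult[OF this g'(2)] show ?thesis by (simp add: algebra_simps)
  qed
  ultimately show ?case by blast
next
  case (add g h)
  then obtain g' h' where g': "quartic_symbol g'"
      "\<And>\<xi>. has_partial i g (g' \<xi>) \<xi>"
    and h': "quartic_symbol h'"
      "\<And>\<xi>. ((\<lambda>k. h (\<xi> + k *\<^sub>R axis i 1)) has_real_derivative h' \<xi>) (at 0)" by blast
  show ?case
    using quartic_symbol.add[OF g'(1) h'(1)] DERIV_add[OF g'(2) h'(2)] by blast
next
  case (scale g c)
  then obtain g' where g': "quartic_symbol g'"
      "\<And>\<xi>. has_partial i g (g' \<xi>) \<xi>" by blast
  show ?case
    using quartic_symbol.scale[OF g'(1), of c] DERIV_cmult[OF g'(2), of c] by blast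
qed

text \<open>The phase \<open>\<theta>\<close> lets derivatives of sine and cosine transforms stay in one family: each
  differentiation shifts the phase by a quarter turn.\<close>

definition cos_transform :: "real \<Rightarrow> (real^'n::finite \<Rightarrow> real) \<Rightarrow> real^'n \<Rightarrow> real" where
  "cos_transform \<theta> g x = (LINT \<xi>|lborel. cos (x \<bullet> \<xi> + \<theta>) * g \<xi>)"

lemma cos_transform_integrable:
  assumes "quartic_symbol g"
  shows "integrable lborel (\<lambda>\<xi>. cos (x \<bullet> \<xi> + \<theta>) * g \<xi>)"
proof (rule Bochner_Integration.integrable_bound[OF quartic_symbol_integrable[OF assms]])
  show "(\<lambda>\<xi>. cos (x \<bullet> \<xi> + \<theta>) * g \<xi>) \<in> borel_measurable lborel"
    using quartic_symbol_measurable[OF assms] by simp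
  show "AE \<xi> in lborel. norm (cos (x \<bullet> \<xi> + \<theta>) * g \<xi>) \<le> norm (g \<xi>)"
    using abs_cos_le_one by (intro AE_I2) (auto simp: abs_mult intro: mult_left_le_one_le)
qed

lemma cos_transform_partial:
  assumes "quartic_symbol g"
  shows "((\<lambda>h. cos_transform \<theta> g (x + h *\<^sub>R axis i 1)) has_real_derivative
           cos_transform (\<theta> + pi / 2) (\<lambda>\<xi>. \<xi> $ i * g \<xi>) x) (at 0)"
proof -
  have "((\<lambda>h. LINT \<xi>|lborel. cos ((x + h *\<^sub>R axis i 1) \<bullet> \<xi> + \<theta>) * g \<xi>) has_real_derivative
      (LINT \<xi>|lborel. cos ((x + 0 *\<^sub>R axis i 1) \<bullet> \<xi> + (\<theta> + pi / 2)) * (\<xi> $ i * g \<xi>))) (at 0)"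
  proof (rule has_derivative_lborel_integral[where w = "\<lambda>\<xi>. \<bar>\<xi> $ i * g \<xi>\<bar>"
        and F = "\<lambda>h \<xi>. cos ((x + h *\<^sub>R axis i 1) \<bullet> \<xi> + \<theta>) * g \<xi>"
        and F' = "\<lambda>h \<xi>. cos ((x + h *\<^sub>R axis i 1) \<bullet> \<xi> + (\<theta> + pi / 2)) * (\<xi> $ i * g \<xi>)"])
    have ph: "(x + h *\<^sub>R axis i 1) \<bullet> \<xi> = x \<bullet> \<xi> + h * \<xi> $ i" for h and \<xi> :: "real^'a"
      by (simp add: inner_add_left inner_axis' )
    show "((\<lambda>h. cos ((x + h *\<^sub>R axis i 1) \<bullet> \<xi> + \<theta>) * g \<xi>) has_real_derivative
        cos ((x + h *\<^sub>R axis i 1) \<bullet> \<xi> + (\<theta> + pi / 2)) * (\<xi> $ i * g \<xi>)) (at h)" for h \<xi>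
    proof -
      have "cos (x \<bullet> \<xi> + h * \<xi> $ i + (\<theta> + pi / 2)) = - sin (x \<bullet> \<xi> + h * \<xi> $ i + \<theta>)"
        using cos_add[of "x \<bullet> \<xi> + h * \<xi> $ i + \<theta>" "pi / 2"] by (simp add: add.assoc)
      then show ?thesis unfolding ph by (auto intro!: derivative_eq_intros)
    qed
    show "\<bar>cos ((x + h *\<^sub>R axis i 1) \<bullet> \<xi> + (\<theta> + pi / 2)) * (\<xi> $ i * g \<xi>)\<bar> \<le> \<bar>\<xi> $ i * g \<xi>\<bar>" for h \<xi>
      using abs_cos_le_one unfolding abs_mult by (intro mult_left_le_one_le) auto
    show "integrable lborel (\<lambda>\<xi>. \<bar>\<xi> $ i * g \<xi>\<bar>)"
      using quartic_symbol_integrable[OF quartic_symbol.coord[OF assms]] by simp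
  qed (rule cos_transform_integrable[OF assms])
  then show ?thesis unfolding cos_transform_def by simp
qed

text \<open>Integration by parts: the integral of a translate does not depend on the translation.\<close>

lemma cos_transform_coord:
  fixes g :: "real^'n::finite \<Rightarrow> real"
  assumes g: "quartic_symbol g"
    and g': "quartic_symbol g'" "\<And>\<xi>. has_partial i g (g' \<xi>) \<xi>"
  shows "x $ i * cos_transform \<theta> g x = cos_transform (\<theta> + pi / 2) g' x"
proof -
  define G where "G \<xi> = sin (x \<bullet> \<xi> + \<theta>) * g \<xi>" for \<xi>
  define G' where "G' \<xi> = x $ i * (cos (x \<bullet> \<xi> + \<theta>) * g \<xi>) - cos (x \<bullet> \<xi> + (\<theta> + pi / 2)) * g' \<xi>" for \<xi>
  have sin_eq: "sin (x \<bullet> \<xi> + \<theta>) = cos (x \<bullet> \<xi> + (\<theta> - pi / 2))" for \<xi>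
    using cos_diff[of "x \<bullet> \<xi> + \<theta>" "pi / 2"] by (simp add: add_diff_eq)
  have G: "integrable lborel G"
    unfolding G_def sin_eq by (rule cos_transform_integrable[OF g])
  have Gm[measurable]: "G \<in> borel_measurable borel" using G by (simp add: integrable_iff_bounded)
  have shift: "((\<lambda>h. g (\<xi> + h *\<^sub>R axis i 1)) has_real_derivative g' (\<xi> + h *\<^sub>R axis i 1)) (at h)" for \<xi> h
    using has_partial_shift[of g i \<xi> h] g'(2) partial_eqI[OF g'(2)] real_differentiableI by metis
  obtain C where C: "\<And>\<xi> h. \<bar>h\<bar> \<le> 1 \<longrightarrow> \<bar>g (\<xi> + h *\<^sub>R axis i 1)\<bar> \<le> C * cauchy_weight \<xi>"
    using quartic_symbol_dominated[OF g] by meson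
  obtain D where D: "\<And>\<xi> h. \<bar>h\<bar> \<le> 1 \<longrightarrow> \<bar>g' (\<xi> + h *\<^sub>R axis i 1)\<bar> \<le> D * cauchy_weight \<xi>"
    using quartic_symbol_dominated[OF g'(1)] by meson
  have "((\<lambda>h. LINT \<xi>|lborel. G (\<xi> + h *\<^sub>R axis i 1)) has_real_derivative
      (LINT \<xi>|lborel. G' (\<xi> + 0 *\<^sub>R axis i 1))) (at 0)"
  proof (rule has_derivative_lborel_integral[where F = "\<lambda>h \<xi>. G (\<xi> + h *\<^sub>R axis i 1)"
        and F' = "\<lambda>h \<xi>. G' (\<xi> + h *\<^sub>R axis i 1)" and w = "\<lambda>\<xi>. (\<bar>x $ i\<bar> * C + D) * cauchy_weight \<xi>"])
    show "((\<lambda>h. G (\<xi> + h *\<^sub>R axis i 1)) has_real_derivative G' (\<xi> + h *\<^sub>R axis i 1)) (at h)" for h \<xi>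
    proof -
      have ph: "x \<bullet> (\<xi> + h *\<^sub>R axis i 1) = x \<bullet> \<xi> + h * x $ i" for h
        by (simp add: inner_add_right inner_axis)
      have "cos (x \<bullet> \<xi> + h * x $ i + (\<theta> + pi / 2)) = - sin (x \<bullet> \<xi> + h * x $ i + \<theta>)"
        using cos_add[of "x \<bullet> \<xi> + h * x $ i + \<theta>" "pi / 2"] by (simp add: add.assoc)
      then show ?thesis unfolding G_def G'_def ph
        by (auto intro!: derivative_eq_intros shift)
    qed
    show "\<bar>G' (\<xi> + h *\<^sub>R axis i 1)\<bar> \<le> (\<bar>x $ i\<bar> * C + D) * cauchy_weight \<xi>" if "\<bar>h\<bar> < 1" for h \<xi>
    proof -
      let ?e = "\<xi> + h *\<^sub>R axis i 1"
      have "\<bar>G' ?e\<bar> \<le> \<bar>x $ i\<bar> * (\<bar>cos (x \<bullet> ?e + \<theta>)\<bar> * \<bar>g ?e\<bar>) + \<bar>cos (x \<bullet> ?e + (\<theta> + pi / 2))\<bar> * \<bar>g' ?e\<bar>"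
        unfolding G'_def abs_mult[symmetric] by (rule abs_triangle_ineq4)
      also have "\<dots> \<le> \<bar>x $ i\<bar> * \<bar>g ?e\<bar> + \<bar>g' ?e\<bar>"
        using abs_cos_le_one by (intro add_mono mult_left_mono mult_left_le_one_le) auto
      also have "\<dots> \<le> \<bar>x $ i\<bar> * (C * cauchy_weight \<xi>) + D * cauchy_weight \<xi>"
        using C[of h \<xi>] D[of h \<xi>] that by (intro add_mono mult_left_mono) auto
      finally show ?thesis by (simp add: algebra_simps)
    qed
    show "integrable lborel (\<lambda>\<xi>. (\<bar>x $ i\<bar> * C + D) * cauchy_weight \<xi>)"
      by (intro integrable_mult_right integrable_cauchy_weight)
    show "integrable lborel (\<lambda>\<xi>. G (\<xi> + h *\<^sub>R axis i 1))" for h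
    proof -
      have "integrable (distr lborel borel ((+) (h *\<^sub>R axis i 1))) G"
        using G by (simp add: lborel_distr_plus)
      then have "integrable lborel (\<lambda>\<xi>. G (h *\<^sub>R axis i 1 + \<xi>))"
        by (subst (asm) integrable_distr_eq) auto
      then show ?thesis by (simp add: add.commute)
    qed
  qed
  moreover have "(\<lambda>h. LINT \<xi>|lborel. G (\<xi> + h *\<^sub>R axis i 1)) = (\<lambda>h. LINT \<xi>|lborel. G \<xi>)"
    by (rule ext) (rule integral_lborel_translate, measurable)
  ultimately have "((\<lambda>h. LINT \<xi>|lborel. G \<xi>) has_real_derivative (LINT \<xi>|lborel. G' \<xi>)) (at (0::real))" by simp
  then have "(LINT \<xi>|lborel. G' \<xi>) = 0"
    using DERIV_unique[OF _ DERIV_const] by blast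
  moreover have "(LINT \<xi>|lborel. G' \<xi>) = x $ i * cos_transform \<theta> g x - cos_transform (\<theta> + pi / 2) g' x"
    unfolding G'_def cos_transform_def
    using cos_transform_integrable[OF g] cos_transform_integrable[OF g'(1)]
    by (subst Bochner_Integration.integral_diff) auto
  ultimately show ?thesis by simp
qed

text \<open>Each factor \<open>1 + x\<^sub>i\<^sup>2\<close> is traded, by two integrations by parts, for a transform of a second
  derivative of the symbol, which is again a symbol of the class.\<close>

lemma cos_transform_decay_aux:
  assumes "finite A" "quartic_symbol g"
  shows "\<exists>C. \<forall>x. (\<Prod>i\<in>A. 1 + (x $ i)\<^sup>2) * \<bar>cos_transform \<theta> g x\<bar> \<le> C"
  using assms
proof (induction A arbitrary: g \<theta> rule: finite_induct)
  case empty
  have "\<bar>cos_transform \<theta> g x\<bar> \<le> (LINT \<xi>|lborel. \<bar>g \<xi>\<bar>)" for x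
  proof -
    have "\<bar>cos_transform \<theta> g x\<bar> \<le> (LINT \<xi>|lborel. \<bar>cos (x \<bullet> \<xi> + \<theta>) * g \<xi>\<bar>)"
      unfolding cos_transform_def using integral_norm_bound[of lborel] by (metis (no_types, lifting) Bochner_Integration.integral_cong real_norm_def)
    also have "\<dots> \<le> (LINT \<xi>|lborel. \<bar>g \<xi>\<bar>)"
      using cos_transform_integrable[OF empty] quartic_symbol_integrable[OF empty] abs_cos_le_one
      by (intro integral_mono integrable_abs) (auto simp: abs_mult intro: mult_left_le_one_le)
    finally show ?thesis .
  qed
  then show ?case by auto
next
  case (insert i A)
  obtain g' where g': "quartic_symbol g'" "\<And>\<xi>. has_partial i g (g' \<xi>) \<xi>"
    using quartic_symbol_partial[OF insert.prems] by blast
  obtain g'' where g'': "quartic_symbol g''" "\<And>\<xi>. has_partial i g' (g'' \<xi>) \<xi>"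
    using quartic_symbol_partial[OF g'(1)] by blast
  have sq: "(1 + (x $ i)\<^sup>2) * cos_transform \<theta> g x = cos_transform \<theta> g x + cos_transform (\<theta> + pi / 2 + pi / 2) g'' x" for x
    using cos_transform_coord[OF insert.prems g', of x \<theta>] cos_transform_coord[OF g'(1) g'', of x "\<theta> + pi / 2"]
    by (simp add: algebra_simps power2_eq_square)
  obtain C where C: "\<And>x. (\<Prod>i\<in>A. 1 + (x $ i)\<^sup>2) * \<bar>cos_transform \<theta> g x\<bar> \<le> C"
    using insert.IH[OF insert.prems] by meson
  obtain D where D: "\<And>x. (\<Prod>i\<in>A. 1 + (x $ i)\<^sup>2) * \<bar>cos_transform (\<theta> + pi / 2 + pi / 2) g'' x\<bar> \<le> D"
    using insert.IH[OF g''(1)] by meson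
  have "(\<Prod>i\<in>insert i A. 1 + (x $ i)\<^sup>2) * \<bar>cos_transform \<theta> g x\<bar> \<le> C + D" for x
  proof -
    have P: "(\<Prod>i\<in>A. 1 + (x $ i)\<^sup>2) \<ge> 0" by (intro prod_nonneg) auto
    have "(\<Prod>i\<in>insert i A. 1 + (x $ i)\<^sup>2) * \<bar>cos_transform \<theta> g x\<bar>
        = (\<Prod>i\<in>A. 1 + (x $ i)\<^sup>2) * \<bar>(1 + (x $ i)\<^sup>2) * cos_transform \<theta> g x\<bar>"
      using insert.hyps by (simp add: abs_mult)
    also have "\<dots> \<le> (\<Prod>i\<in>A. 1 + (x $ i)\<^sup>2) * (\<bar>cos_transform \<theta> g x\<bar> + \<bar>cos_transform (\<theta> + pi / 2 + pi / 2) g'' x\<bar>)"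
      unfolding sq using P by (intro mult_left_mono) auto
    also have "\<dots> \<le> C + D" using C[of x] D[of x] by (simp add: distrib_left)
    finally show ?thesis .
  qed
  then show ?case by blast
qed

lemma cos_transform_decay:
  fixes g :: "real^'n::finite \<Rightarrow> real"
  assumes "quartic_symbol g"
  shows "\<exists>C. \<forall>x. \<bar>cos_transform \<theta> g x\<bar> \<le> C * cauchy_weight x"
proof -
  obtain C where C: "\<And>x. (\<Prod>i\<in>UNIV. 1 + (x $ i)\<^sup>2) * \<bar>cos_transform \<theta> g x\<bar> \<le> C"
    using cos_transform_decay_aux[OF _ assms, of UNIV] by auto
  have "\<bar>cos_transform \<theta> g x\<bar> \<le> C * cauchy_weight x" for x
  proof -
    have w: "cauchy_weight x * (\<Prod>i\<in>UNIV. 1 + (x $ i)\<^sup>2) = 1"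
      unfolding cauchy_weight_def prod.distrib[symmetric]
      by (intro prod.neutral ballI) (smt (verit) left_inverse zero_le_power2)
    have "\<bar>cos_transform \<theta> g x\<bar> = cauchy_weight x * ((\<Prod>i\<in>UNIV. 1 + (x $ i)\<^sup>2) * \<bar>cos_transform \<theta> g x\<bar>)"
      using w by (simp add: mult.assoc[symmetric])
    also have "\<dots> \<le> cauchy_weight x * C"
      using C[of x] less_imp_le[OF cauchy_weight_pos[of x]] by (intro mult_left_mono)
    finally show ?thesis by (simp add: mult.commute)
  qed
  then show ?thesis by blast
qed

lemma partials_cos_transform:
  assumes "quartic_symbol g"
  shows "\<exists>\<theta>' g'. quartic_symbol g' \<and> partials is (cos_transform \<theta> g) = cos_transform \<theta>' g'"
proof (induction "is")
  case Nil then show ?case using assms by auto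
next
  case (Cons i "is")
  then obtain \<theta>' g' where g': "quartic_symbol g'" "partials is (cos_transform \<theta> g) = cos_transform \<theta>' g'" by blast
  have "partials (i # is) (cos_transform \<theta> g) = cos_transform (\<theta>' + pi / 2) (\<lambda>\<xi>. \<xi> $ i * g' \<xi>)"
    using g' by (auto intro!: ext partial_eqI cos_transform_partial)
  then show ?case using quartic_symbol.coord[OF g'(1)] by blast
qed

lemma axis_smooth_cos_transform:
  assumes "quartic_symbol g"
  shows "axis_smooth (cos_transform \<theta> g)"
  unfolding axis_smooth_def
proof (intro allI)
  fix "is" i x
  obtain \<theta>' g' where g': "quartic_symbol g'" "partials is (cos_transform \<theta> g) = cos_transform \<theta>' g'"
    using partials_cos_transform[OF assms] by blast
  show "partially_differentiable i (partials is (cos_transform \<theta> g)) x"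
    unfolding g'(2) by (rule real_differentiableI[OF cos_transform_partial[OF g'(1)]])
qed

text \<open>In the Duhamel integral at most two derivatives fall on the biharmonic kernel, and none on the
  Gaussian, because the nonlinearity of mean curvature flow is kept in non-divergence form.\<close>

definition kernel_orders :: "flow \<Rightarrow> 'n::finite list set" where
  "kernel_orders F = (if F = MCF then {[]} else {is. length is \<le> 2})"

lemma kernel_orders_less: "is \<in> kernel_orders F \<Longrightarrow> length is < flow_order F"
  by (cases F) (auto simp: kernel_orders_def)

lemma biharmonic_kernel_eq:
  assumes "F \<noteq> MCF"
  shows "kernel F 1 = (\<lambda>x::real^'n::finite. inverse ((2 * pi) ^ CARD('n)) * cos_transform 0 (\<lambda>\<xi>. exp (- (norm \<xi> ^ 4))) (1 *\<^sub>R x))"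
  by (rule ext) (use assms in \<open>cases F; simp add: cos_transform_def divide_inverse\<close>)

lemma axis_smooth_kernel:
  assumes "F \<noteq> MCF"
  shows "axis_smooth (kernel F 1 :: real^'n::finite \<Rightarrow> real)"
  unfolding biharmonic_kernel_eq[OF assms]
  by (intro axis_smooth_dilation axis_smooth_cos_transform quartic_symbol.base)

text \<open>For the Gaussian, \<open>1 + r\<^sup>2 \<le> 4 exp (r\<^sup>2 / 4)\<close> in every coordinate; for the biharmonic kernel, all
  derivatives are cosine transforms of symbols of the class above.\<close>

lemma kernel_derivative_decay:
  assumes "is \<in> kernel_orders F"
  shows "\<exists>C\<ge>0. \<forall>z :: real^'n::finite. \<bar>partials is (kernel F 1) z\<bar> \<le> C * cauchy_weight z"
proof -
  have "\<exists>C. \<forall>z :: real^'n. \<bar>partials is (kernel F 1) z\<bar> \<le> C * cauchy_weight z"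
  proof (cases "F = MCF")
    case True
    have "\<bar>kernel F 1 z\<bar> \<le> 4 ^ CARD('n) * cauchy_weight z" for z :: "real^'n"
    proof -
      have "exp (- (norm z)\<^sup>2 / 4) = (\<Prod>i\<in>UNIV. exp (- ((z $ i)\<^sup>2 / 4)))"
        unfolding power2_norm_eq_inner inner_vec_def
        by (simp add: exp_sum[symmetric] sum_negf sum_divide_distrib power2_eq_square)
      also have "\<dots> \<le> (\<Prod>i\<in>(UNIV :: 'n set). 4 * inverse (1 + (z $ i)\<^sup>2))"
      proof (intro prod_mono conjI)
        fix i
        have "1 + (z $ i)\<^sup>2 \<le> 4 * exp ((z $ i)\<^sup>2 / 4)"
          using exp_ge_add_one_self[of "(z $ i)\<^sup>2 / 4"] by linarith
        moreover have "1 + (z $ i)\<^sup>2 > 0" by (simp add: add_pos_nonneg)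
        ultimately show "exp (- ((z $ i)\<^sup>2 / 4)) \<le> 4 * inverse (1 + (z $ i)\<^sup>2)"
          by (simp add: exp_minus field_simps)
      qed simp
      also have "\<dots> = 4 ^ CARD('n) * cauchy_weight z"
        by (simp add: cauchy_weight_def prod.distrib)
      finally have e: "exp (- (norm z)\<^sup>2 / 4) \<le> 4 ^ CARD('n) * cauchy_weight z" .
      have "(4 * pi) powr (- real CARD('n) / 2) \<le> 1"
        using powr_mono[of "- real CARD('n) / 2" 0 "4 * pi"] pi_gt3 by simp
      then have "(4 * pi) powr (- real CARD('n) / 2) * exp (- (norm z)\<^sup>2 / 4) \<le> exp (- (norm z)\<^sup>2 / 4)"
        by (intro mult_left_le_one_le) auto
      from order_trans[OF this e] show ?thesis using True by (simp add: abs_mult)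
    qed
    then show ?thesis using assms True by (auto simp: kernel_orders_def)
  next
    case False
    define g :: "real^'n \<Rightarrow> real" where "g = (\<lambda>\<xi>. exp (- (norm \<xi> ^ 4)))"
    have g: "quartic_symbol g" unfolding g_def by (rule quartic_symbol.base)
    obtain \<theta>' g' where g': "quartic_symbol g'" "partials is (cos_transform 0 g) = cos_transform \<theta>' g'"
      using partials_cos_transform[OF g] by blast
    obtain C where C: "\<And>z. \<bar>cos_transform \<theta>' g' z\<bar> \<le> C * cauchy_weight z"
      using cos_transform_decay[OF g'(1)] by blast
    let ?a = "inverse ((2 * pi) ^ CARD('n))"
    have "partials is (kernel F 1) = (\<lambda>x. ?a * 1 ^ length is * partials is (cos_transform 0 g) (1 *\<^sub>R x))"
      unfolding biharmonic_kernel_eq[OF False] g_def[symmetric]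
      by (rule partials_dilation[OF axis_smooth_cos_transform[OF g]])
    then have "\<bar>partials is (kernel F 1) z\<bar> = ?a * \<bar>cos_transform \<theta>' g' z\<bar>" for z :: "real^'n"
      by (simp add: g'(2) abs_mult)
    then have "\<bar>partials is (kernel F 1) z\<bar> \<le> (?a * C) * cauchy_weight z" for z :: "real^'n"
      using mult_left_mono[OF C, of ?a z] by (simp add: mult.assoc)
    then show ?thesis by blast
  qed
  then obtain C where C: "\<And>z :: real^'n. \<bar>partials is (kernel F 1) z\<bar> \<le> C * cauchy_weight z" by blast
  have "C * cauchy_weight z \<le> \<bar>C\<bar> * cauchy_weight z" for z :: "real^'n"
    using less_imp_le[OF cauchy_weight_pos] by (intro mult_right_mono) auto
  then show ?thesis using C by (intro exI[of _ "\<bar>C\<bar>"]) (auto intro: order_trans)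
qed

lemma flow_order_pos: "flow_order F > 0"
  by (cases F) auto

lemma inverse_root_time:
  assumes "\<tau> > 0"
  shows "\<tau> powr (- 1 / real (flow_order F)) > 0"
    and "\<tau> * (\<tau> powr (- 1 / real (flow_order F))) ^ flow_order F = 1"
proof -
  have "(\<tau> powr (- 1 / real (flow_order F))) ^ flow_order F = \<tau> powr (-1)"
    using assms flow_order_pos[of F] by (simp add: powr_realpow[symmetric] powr_powr)
  then show "\<tau> * (\<tau> powr (- 1 / real (flow_order F))) ^ flow_order F = 1"
    using assms by (simp add: powr_minus)
qed (use assms in simp)

text \<open>Here \<open>c = \<tau>\<^sup>-\<^sup>1\<^sup>/\<^sup>\<alpha>\<close>. For the Gaussian this is read off the formula, for the biharmonic kernel it is
  the substitution of \<open>c \<xi>\<close> for \<open>\<xi>\<close> in the Fourier integral.\<close>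

lemma kernel_self_similar:
  assumes c: "c > 0" and \<tau>: "\<tau> * c ^ flow_order F = 1"
  shows "kernel F \<tau> = (\<lambda>z::real^'n::finite. c ^ CARD('n) * kernel F 1 (c *\<^sub>R z))"
proof (cases "F = MCF")
  case True
  have t: "\<tau> = inverse (c\<^sup>2)" using c \<tau> True by (simp add: field_simps)
  have "(4 * pi * \<tau>) powr (- real CARD('n) / 2) = (4 * pi) powr (- real CARD('n) / 2) * \<tau> powr (- real CARD('n) / 2)"
    by (rule powr_mult)
  also have "\<tau> powr (- real CARD('n) / 2) = c ^ CARD('n)"
  proof -
    have "\<tau> = c powr (-2)" using c t by (simp add: powr_minus powr_numeral)
    then have "\<tau> powr (- real CARD('n) / 2) = c powr (real CARD('n))" by (simp add: powr_powr)
    then show ?thesis using c by (simp add: powr_realpow)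
  qed
  finally have p: "(4 * pi * \<tau>) powr (- real CARD('n) / 2) = c ^ CARD('n) * (4 * pi) powr (- real CARD('n) / 2)"
    by simp
  have "- (norm z)\<^sup>2 / (4 * \<tau>) = - (norm (c *\<^sub>R z))\<^sup>2 / 4" for z :: "real^'n"
    using c unfolding t by (simp add: field_simps power_mult_distrib)
  then show ?thesis using True p by (simp add: fun_eq_iff)
next
  case False
  have K: "kernel F s z = (1 / (2 * pi) ^ CARD('n)) * (LINT \<xi>|lborel. cos (z \<bullet> \<xi>) * exp (- s * norm \<xi> ^ 4))"
    for s and z :: "real^'n" using False by (cases F) auto
  have o: "flow_order F = 4" using False by (cases F) auto
  have "(LINT \<xi>|lborel. cos (z \<bullet> \<xi>) * exp (- \<tau> * norm \<xi> ^ 4))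
      = c ^ DIM(real^'n) * (LINT \<xi>|lborel. cos (z \<bullet> (c *\<^sub>R \<xi>)) * exp (- \<tau> * norm (c *\<^sub>R \<xi>) ^ 4))" for z :: "real^'n"
    by (rule integral_lborel_dilate[OF _ c]) measurable
  moreover have "- \<tau> * norm (c *\<^sub>R \<xi>) ^ 4 = - 1 * norm \<xi> ^ 4" for \<xi> :: "real^'n"
  proof -
    have n: "norm (c *\<^sub>R \<xi>) = c * norm \<xi>" using c by simp
    have "- \<tau> * norm (c *\<^sub>R \<xi>) ^ 4 = - (\<tau> * c ^ 4) * norm \<xi> ^ 4"
      unfolding n power_mult_distrib by simp
    also have "\<dots> = - 1 * norm \<xi> ^ 4" using \<tau> o by simp
    finally show ?thesis .
  qed
  ultimately show ?thesis unfolding K by (simp add: fun_eq_iff)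
qed

lemma partials_kernel_self_similar:
  assumes c: "c > 0" and \<tau>: "\<tau> * c ^ flow_order F = 1" and "is": "is \<in> kernel_orders F"
  shows "partials is (kernel F \<tau>) (z::real^'n::finite) = c ^ (CARD('n) + length is) * partials is (kernel F 1) (c *\<^sub>R z)"
proof (cases "F = MCF")
  case True
  then have "is = []" using "is" by (simp add: kernel_orders_def)
  then show ?thesis by (simp add: kernel_self_similar[OF c \<tau>] del: kernel.simps)
next
  case False
  show ?thesis unfolding kernel_self_similar[OF c \<tau>]
    by (subst partials_dilation[OF axis_smooth_kernel[OF False]]) (simp add: power_add)
qed


section \<open>The Duhamel integrand and its majorant\<close>

text \<open>Indexing the coefficients by the list of derivatives that falls on the kernel turns the Duhamel
  integrand of all flows into one sum.\<close>

fun coeff_of :: "('n::finite) coeffs \<Rightarrow> 'n list \<Rightarrow> 'n jetfun" where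
  "coeff_of (f0, f1, f2) [] = f0"
| "coeff_of (f0, f1, f2) [i] = f1 i"
| "coeff_of (f0, f1, f2) [i, j] = f2 i j"
| "coeff_of (f0, f1, f2) (i # j # k # is) = (\<lambda>q H. 0)"

lemma sum_lists_length_le_2:
  fixes g :: "'n::finite list \<Rightarrow> real"
  shows "(\<Sum>is | length is \<le> 2. g is) = g [] + (\<Sum>i\<in>UNIV. g [i]) + (\<Sum>i\<in>UNIV. \<Sum>j\<in>UNIV. g [i, j])"
proof -
  have split: "{is :: 'n list. length is \<le> 2} = {[]} \<union> (\<lambda>i. [i]) ` UNIV \<union> (\<lambda>(i, j). [i, j]) ` UNIV"
  proof (intro set_eqI iffI)
    fix l :: "'n list" assume "l \<in> {is. length is \<le> 2}"
    then consider "l = []" | i where "l = [i]" | i j where "l = [i, j]"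
      by (cases l; cases "tl l"; cases "tl (tl l)") auto
    then show "l \<in> {[]} \<union> (\<lambda>i. [i]) ` UNIV \<union> (\<lambda>(i, j). [i, j]) ` UNIV"
      by cases auto
  qed auto
  have "(\<Sum>is | length is \<le> 2. g is) = (\<Sum>is\<in>{[]}. g is) + (\<Sum>is\<in>(\<lambda>i. [i]) ` UNIV. g is) + (\<Sum>is\<in>(\<lambda>(i, j). [i, j]) ` UNIV. g is)"
    unfolding split by (subst sum.union_disjoint; (subst sum.union_disjoint)?) auto
  also have "(\<Sum>is\<in>(\<lambda>i. [i]) ` UNIV. g is) = (\<Sum>i\<in>UNIV. g [i])"
    by (subst sum.reindex) (auto simp: inj_on_def)
  also have "(\<Sum>is\<in>(\<lambda>(i, j). [i, j]) ` UNIV. g is) = (\<Sum>(i, j)\<in>UNIV. g [i, j])"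
    by (subst sum.reindex) (auto simp: inj_on_def case_prod_unfold)
  also have "\<dots> = (\<Sum>i\<in>UNIV. \<Sum>j\<in>UNIV. g [i, j])"
    by (simp add: sum.cartesian_product)
  finally show ?thesis by simp
qed

lemma duhamel_integrand_eq_sum:
  assumes "admissible_form F f"
  shows "duhamel_integrand F f u x t y s =
    (\<Sum>is\<in>kernel_orders F. partials is (kernel F (t - s)) (x - y)
        * coeff_of f is (grad (\<lambda>z. u z s) y) (hess (\<lambda>z. u z s) y))"
proof -
  obtain f0 f1 f2 where f: "f = (f0, f1, f2)" by (cases f)
  show ?thesis
  proof (cases "F = MCF")
    case True
    then show ?thesis using assms by (simp add: f kernel_orders_def Let_def)
  next
    case False
    then show ?thesis
      by (simp add: f kernel_orders_def sum_lists_length_le_2 Let_def del: kernel.simps)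
  qed
qed

text \<open>Degree of homogeneity in the second derivatives. It decides both the scaling of a term of the
  Duhamel integrand and its singularity at time 0.\<close>

definition homogeneous_jet :: "nat \<Rightarrow> ('n::finite) jetfun \<Rightarrow> bool" where
  "homogeneous_jet d \<phi> \<longleftrightarrow>
     continuous_on UNIV (\<lambda>z. \<phi> (fst z) (snd z)) \<and>
     (\<forall>q H \<mu>. \<phi> q (\<mu> *\<^sub>R H) = \<mu> ^ d * \<phi> q H)"

lemma homogeneous_jet_zero: "homogeneous_jet d (\<lambda>q H. 0)"
  by (simp add: homogeneous_jet_def)

lemma homogeneous_jet_lin_combs:
  assumes "\<And>T. T \<in> S \<Longrightarrow> homogeneous_jet d T" "\<phi> \<in> lin_combs S"
  shows "homogeneous_jet d \<phi>"
proof -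
  obtain N :: nat and c T where \<phi>: "\<phi> = (\<lambda>q H. \<Sum>l<N. c l * T l q H)" and T: "\<forall>l<N. T l \<in> S"
    using assms(2) unfolding lin_combs_def by blast
  have h: "homogeneous_jet d (T l)" if "l < N" for l using assms(1) T that by blast
  show ?thesis unfolding homogeneous_jet_def \<phi>
  proof (intro conjI allI)
    show "continuous_on UNIV (\<lambda>z. \<Sum>l<N. c l * T l (fst z) (snd z))"
      by (intro continuous_on_sum continuous_on_mult_left) (use h in \<open>auto simp: homogeneous_jet_def\<close>)
    show "(\<Sum>l<N. c l * T l q (\<mu> *\<^sub>R H)) = \<mu> ^ d * (\<Sum>l<N. c l * T l q H)" for q H \<mu>
      unfolding sum_distrib_left using h by (intro sum.cong) (auto simp: homogeneous_jet_def)
  qed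
qed

lemma area_pos: "area q > 0"
  unfolding area_def by (simp add: add_pos_nonneg)

lemma area_nonzero [simp]: "area q \<noteq> 0"
  using area_pos[of q] by simp

lemma area_continuous [continuous_intros]: "continuous_on S g \<Longrightarrow> continuous_on S (\<lambda>x. area (g x))"
  unfolding area_def by (intro continuous_intros)

lemma homogeneous_jet_terms:
  assumes "T \<in> jet_terms m M d"
  shows "homogeneous_jet m (T :: ('n::finite) jetfun)"
proof -
  obtain ps :: "('n \<times> 'n) list" and as :: "'n list" and k where
    T: "T = (\<lambda>q H. (\<Prod>(a, b)\<leftarrow>ps. H $ a $ b) * (\<Prod>a\<leftarrow>as. q $ a) / area q ^ (2 * k))" and m: "length ps = m"
    using assms unfolding jet_terms_def by blast
  have 1: "continuous_on UNIV (\<lambda>z :: (real^'n) \<times> (real^'n^'n). \<Prod>(a, b)\<leftarrow>ps. snd z $ a $ b)"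
    by (induction ps) (auto intro!: continuous_intros simp: case_prod_unfold)
  have 2: "continuous_on UNIV (\<lambda>z :: (real^'n) \<times> (real^'n^'n). \<Prod>a\<leftarrow>as. fst z $ a)"
    by (induction as) (auto intro!: continuous_intros)
  have h: "(\<Prod>(a, b)\<leftarrow>ps. (\<mu> *\<^sub>R H) $ a $ b) = \<mu> ^ length ps * (\<Prod>(a, b)\<leftarrow>ps. H $ a $ b)" for \<mu> and H :: "real^'n^'n"
    by (induction ps) auto
  show ?thesis unfolding homogeneous_jet_def T h m
    by (auto intro!: continuous_intros 1 2)
qed

text \<open>If \<open>m\<close> derivatives fall on the kernel, the coefficient is of degree \<open>\<alpha> - 1 - m\<close>. This relation
  makes the flow scale invariant.\<close>

lemma homogeneous_jet_coeff_of:
  fixes f :: "('n::finite) coeffs"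
  assumes "admissible_form F f" "is \<in> kernel_orders F"
  shows "homogeneous_jet (flow_order F - 1 - length is) (coeff_of f is)"
proof -
  obtain f0 f1 f2 where f: "f = (f0, f1, f2)" by (cases f)
  have lc: "homogeneous_jet m \<phi>" if "\<phi> \<in> lin_combs (jet_terms m M e)" for m M e and \<phi> :: "'n jetfun"
    using homogeneous_jet_lin_combs[OF homogeneous_jet_terms that] .
  show ?thesis
  proof (cases "F = MCF")
    case True
    have "homogeneous_jet 1 (\<lambda>q H. - (\<Sum>i\<in>UNIV. \<Sum>j\<in>UNIV. q $ i * q $ j * H $ i $ j) / (area q)\<^sup>2)"
      unfolding homogeneous_jet_def
      by (auto intro!: continuous_intros simp: sum_distrib_left mult_ac)
    then show ?thesis using True assms by (simp add: f kernel_orders_def)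
  next
    case False
    then have "length is \<le> 2" using assms(2) by (simp add: kernel_orders_def)
    then consider "is = []" | i where "is = [i]" | i j where "is = [i, j]"
      by (cases "is"; cases "tl is"; cases "tl (tl is)") auto
    then show ?thesis
    proof cases
      case 1
      have "homogeneous_jet 3 f0"
        using False assms(1) homogeneous_jet_zero lc by (cases F) (auto simp: f)
      then show ?thesis using 1 False by (cases F) (auto simp: f)
    next
      case 2
      have "homogeneous_jet 2 (f1 i)"
        using False assms(1) lc[of "f1 i" 2] by (cases F) (auto simp: f)
      then show ?thesis using 2 False by (cases F) (auto simp: f)
    next
      case 3
      have "f2 i j \<in> lin_combs (jet_terms 1 2 (\<lambda>k. 2 * k))"
        using False assms(1) by (cases F) (auto simp: f)
      then have "homogeneous_jet 1 (f2 i j)" by (rule lc)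
      then show ?thesis using 3 False by (cases F) (auto simp: f)
    qed
  qed
qed

lemma homogeneous_jet_bound:
  fixes \<phi> :: "('n::finite) jetfun"
  assumes \<phi>: "homogeneous_jet d \<phi>" and d: "d > 0"
  shows "\<exists>C\<ge>0. \<forall>q H. norm q \<le> B \<longrightarrow> \<bar>\<phi> q H\<bar> \<le> C * norm H ^ d"
proof -
  \<comment> \<open>homogeneity reduces the bound to \<open>|H| = 1\<close>, where compactness applies\<close>
  let ?S = "cball 0 B \<times> sphere 0 1 :: ((real^'n) \<times> (real^'n^'n)) set"
  have "compact ((\<lambda>z. \<phi> (fst z) (snd z)) ` ?S)"
    using \<phi> unfolding homogeneous_jet_def
    by (intro compact_continuous_image compact_Times) (auto intro: continuous_on_subset)
  from compact_imp_bounded[OF this]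
  obtain C where "\<forall>y\<in>(\<lambda>z. \<phi> (fst z) (snd z)) ` ?S. norm y \<le> C"
    unfolding bounded_iff by blast
  then have "\<forall>z\<in>?S. \<bar>\<phi> (fst z) (snd z)\<bar> \<le> C"
    by (simp only: real_norm_def ball_simps)
  then have C: "\<bar>\<phi> (fst z) (snd z)\<bar> \<le> C" if "z \<in> ?S" for z
    using that by (rule bspec)
  have "\<bar>\<phi> q H\<bar> \<le> max C 0 * norm H ^ d" if q: "norm q \<le> B" for q H
  proof (cases "H = 0")
    case True
    have "\<phi> q (0 *\<^sub>R H) = 0 ^ d * \<phi> q H" using \<phi> unfolding homogeneous_jet_def by blast
    then show ?thesis using True by (simp add: zero_power[OF d])
  next
    case False
    have "\<phi> q (norm H *\<^sub>R (H /\<^sub>R norm H)) = norm H ^ d * \<phi> q (H /\<^sub>R norm H)"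
      using \<phi> unfolding homogeneous_jet_def by blast
    then have "\<bar>\<phi> q H\<bar> = norm H ^ d * \<bar>\<phi> q (H /\<^sub>R norm H)\<bar>"
      using False by (simp add: abs_mult)
    also have "\<bar>\<phi> q (H /\<^sub>R norm H)\<bar> \<le> C"
      using C[of "(q, H /\<^sub>R norm H)"] q False by simp
    then have "norm H ^ d * \<bar>\<phi> q (H /\<^sub>R norm H)\<bar> \<le> norm H ^ d * max C 0"
      by (intro mult_left_mono) auto
    finally show ?thesis by (simp add: mult.commute)
  qed
  then show ?thesis by (intro exI[of _ "max C 0"]) auto
qed

lemma nn_integral_powr_finite:
  fixes a :: real
  assumes a: "a < 1" and t: "t > 0"
  shows "(\<integral>\<^sup>+s. ennreal (s powr - a) * indicator {0<..<t} s \<partial>lborel) < \<infinity>"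
proof -
  have "((\<lambda>x. x powr - a) has_integral (t powr (- a + 1) / (- a + 1))) {0..t}"
    using a t by (intro has_integral_powr_from_0) auto
  then have "(\<integral>\<^sup>+s. ennreal (indicator {0..t} s * s powr - a) \<partial>lborel) = ennreal (t powr (- a + 1) / (- a + 1))"
    by (intro nn_integral_has_integral_lebesgue) auto
  moreover have "(\<integral>\<^sup>+s. ennreal (s powr - a) * indicator {0<..<t} s \<partial>lborel)
      \<le> (\<integral>\<^sup>+s. ennreal (indicator {0..t} s * s powr - a) \<partial>lborel)"
    by (intro nn_integral_mono) (auto split: split_indicator)
  ultimately show ?thesis by (metis ennreal_less_top infinity_ennreal_def le_less_trans)
qed

text \<open>The two singularities are separated by cutting at \<open>t / 2\<close>.\<close>

lemma nn_integral_beta_finite: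
  fixes a b :: real
  assumes a: "0 \<le> a" "a < 1" and b: "0 \<le> b" "b < 1" and t: "t > 0"
  shows "(\<integral>\<^sup>+s. ennreal ((t - s) powr - a * s powr - b) * indicator {0<..<t} s \<partial>lborel) < \<infinity>"
proof -
  have bound: "(t - s) powr - a * s powr - b \<le> (t / 2) powr - a * s powr - b + (t / 2) powr - b * (t - s) powr - a"
    if s: "0 < s" "s < t" for s
  proof (cases "s \<le> t / 2")
    case True
    then have "(t - s) powr - a \<le> (t / 2) powr - a"
      using a t s by (intro powr_mono2') auto
    then have "(t - s) powr - a * s powr - b \<le> (t / 2) powr - a * s powr - b"
      by (intro mult_right_mono) auto
    then show ?thesis by (simp add: add_increasing2)
  next
    case False
    then have "s powr - b \<le> (t / 2) powr - b"
      using b t s by (intro powr_mono2') auto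
    then have "(t - s) powr - a * s powr - b \<le> (t / 2) powr - b * (t - s) powr - a"
      by (subst mult.commute) (intro mult_right_mono, auto)
    then show ?thesis by (simp add: add_increasing)
  qed
  have refl: "(\<integral>\<^sup>+s. ennreal ((t - s) powr - a) * indicator {0<..<t} s \<partial>lborel) < \<infinity>"
  proof -
    have "(\<integral>\<^sup>+s. ennreal (s powr - a) * indicator {0<..<t} s \<partial>lborel)
        = ennreal \<bar>-1\<bar> * (\<integral>\<^sup>+s. ennreal ((t + -1 * s) powr - a) * indicator {0<..<t} (t + -1 * s) \<partial>lborel)"
      by (rule nn_integral_real_affine) auto
    also have "\<dots> = (\<integral>\<^sup>+s. ennreal ((t - s) powr - a) * indicator {0<..<t} s \<partial>lborel)"
      by (simp, intro nn_integral_cong) (auto split: split_indicator)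
    finally show ?thesis using nn_integral_powr_finite[OF a(2) t] by simp
  qed
  have "(\<integral>\<^sup>+s. ennreal ((t - s) powr - a * s powr - b) * indicator {0<..<t} s \<partial>lborel)
      \<le> (\<integral>\<^sup>+s. ennreal ((t / 2) powr - a) * (ennreal (s powr - b) * indicator {0<..<t} s)
             + ennreal ((t / 2) powr - b) * (ennreal ((t - s) powr - a) * indicator {0<..<t} s) \<partial>lborel)"
  proof (intro nn_integral_mono)
    fix s
    show "ennreal ((t - s) powr - a * s powr - b) * indicator {0<..<t} s
      \<le> ennreal ((t / 2) powr - a) * (ennreal (s powr - b) * indicator {0<..<t} s)
             + ennreal ((t / 2) powr - b) * (ennreal ((t - s) powr - a) * indicator {0<..<t} s)"
      using bound[of s]
      by (auto split: split_indicator simp: ennreal_mult[symmetric] ennreal_plus[symmetric] simp del: ennreal_plus intro!: ennreal_leI)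
  qed
  also have "\<dots> = ennreal ((t / 2) powr - a) * (\<integral>\<^sup>+s. ennreal (s powr - b) * indicator {0<..<t} s \<partial>lborel)
        + ennreal ((t / 2) powr - b) * (\<integral>\<^sup>+s. ennreal ((t - s) powr - a) * indicator {0<..<t} s \<partial>lborel)"
    by (simp add: nn_integral_add nn_integral_cmult)
  also have "\<dots> < \<infinity>"
    using nn_integral_powr_finite[OF b(2) t] refl by (simp add: ennreal_mult_less_top)
  finally show ?thesis .
qed

lemma nn_integral_cauchy_weight_dilate:
  fixes x :: "real^'n::finite"
  assumes c: "c > 0"
  shows "(\<integral>\<^sup>+y. ennreal (c ^ CARD('n) * cauchy_weight (c *\<^sub>R (x - y))) \<partial>lborel) = (\<integral>\<^sup>+y. ennreal (cauchy_weight (y :: real^'n)) \<partial>lborel)"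
proof -
  let ?T = "\<lambda>y. c *\<^sub>R x + (- c) *\<^sub>R y" and ?J = "c ^ CARD('n)"
  have "(\<integral>\<^sup>+y. ennreal (cauchy_weight (y :: real^'n)) \<partial>lborel) = ennreal ?J * (\<integral>\<^sup>+y. ennreal (cauchy_weight (?T y)) \<partial>lborel)"
  proof (rule change_of_variables_constant_jacobian(1))
    show "lborel = density (distr lborel borel ?T) (\<lambda>_. ennreal ?J)"
      using lborel_affine[of "- c" "c *\<^sub>R x"] c by simp
  qed (use c in auto)
  also have "\<dots> = (\<integral>\<^sup>+y. ennreal ?J * ennreal (cauchy_weight (?T y)) \<partial>lborel)"
    by (rule nn_integral_cmult[symmetric]) measurable
  also have "\<dots> = (\<integral>\<^sup>+y. ennreal (?J * cauchy_weight (c *\<^sub>R (x - y))) \<partial>lborel)"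
    using c by (intro nn_integral_cong) (simp add: ennreal_mult' scaleR_diff_right)
  finally show ?thesis by simp
qed

abbreviation slab :: "real \<Rightarrow> ((real^'n::finite) \<times> real) set" where
  "slab t \<equiv> UNIV \<times> {0<..<t}"

text \<open>A term with \<open>j\<close> derivatives on the kernel and degree \<open>d\<close> in the second derivatives, up to a
  constant: the kernel contributes its self-similar bound, and the second derivatives of a solution
  contribute \<open>s\<^sup>-\<^sup>1\<^sup>/\<^sup>\<alpha>\<close> each.\<close>

definition duhamel_majorant :: "nat \<Rightarrow> nat \<Rightarrow> nat \<Rightarrow> real^'n::finite \<Rightarrow> real \<Rightarrow> (real^'n) \<times> real \<Rightarrow> real" where
  "duhamel_majorant \<alpha> j d x t = (\<lambda>(y, s).
     ((t - s) powr (- 1 / real \<alpha>)) ^ (CARD('n) + j) *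
     cauchy_weight ((t - s) powr (- 1 / real \<alpha>) *\<^sub>R (x - y)) * (s powr (- 1 / real \<alpha>)) ^ d)"

text \<open>Integrating over space first removes the weight and leaves \<open>(t - s)\<^sup>-\<^sup>j\<^sup>/\<^sup>\<alpha> s\<^sup>-\<^sup>d\<^sup>/\<^sup>\<alpha>\<close>, which is integrable
  because both exponents are above \<open>-1\<close>.\<close>

lemma duhamel_majorant_integrable:
  fixes x :: "real^'n::finite"
  assumes jd: "j < \<alpha>" "d < \<alpha>" and t: "t > 0"
  shows "set_integrable lborel (slab t) (duhamel_majorant \<alpha> j d x t)"
  unfolding set_integrable_def
proof (rule integrableI_nonneg)
  let ?D = "\<lambda>z. indicat_real (slab t) z *\<^sub>R duhamel_majorant \<alpha> j d x t z"
  let ?W = "\<integral>\<^sup>+y. ennreal (cauchy_weight (y :: real^'n)) \<partial>lborel"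
  have m: "(\<lambda>z. indicat_real (slab t) (z :: (real^'n) \<times> real)) \<in> borel_measurable borel"
    by (intro borel_measurable_indicator borel_open open_Times) auto
  show meas: "?D \<in> borel_measurable lborel"
  proof -
    have [measurable]: "(\<lambda>z. fst z) \<in> borel_measurable (borel :: ((real^'n) \<times> real) measure)"
        "(\<lambda>z. snd z) \<in> borel_measurable (borel :: ((real^'n) \<times> real) measure)"
      by (intro borel_measurable_continuous_onI continuous_intros)+
    have "(\<lambda>z :: (real^'n) \<times> real. cauchy_weight ((t - snd z) powr (- 1 / real \<alpha>) *\<^sub>R (x - fst z))) \<in> borel_measurable borel"
      by measurable
    moreover have "(\<lambda>z :: (real^'n) \<times> real. ((t - snd z) powr (- 1 / real \<alpha>)) ^ (CARD('n) + j)) \<in> borel_measurable borel"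
        "(\<lambda>z :: (real^'n) \<times> real. (snd z powr (- 1 / real \<alpha>)) ^ d) \<in> borel_measurable borel"
      by measurable
    ultimately show ?thesis
      unfolding duhamel_majorant_def case_prod_unfold measurable_lborel2
      by (intro borel_measurable_scaleR borel_measurable_times m)
  qed
  then have meas': "(\<lambda>z. ennreal (?D z)) \<in> borel_measurable (lborel \<Otimes>\<^sub>M lborel)"
    unfolding lborel_prod by measurable
  show "AE z in lborel. 0 \<le> ?D z"
    by (intro AE_I2) (auto simp: duhamel_majorant_def case_prod_unfold less_imp_le[OF cauchy_weight_pos])
  have pw: "(r powr - (1 / real \<alpha>)) ^ k = r powr - (real k / real \<alpha>)" if "r > 0" for r and k :: nat
    using that by (simp add: powr_powr powr_realpow[symmetric])
  have inner: "(\<integral>\<^sup>+y. ennreal (?D (y, s)) \<partial>lborel)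
      = ?W * (ennreal ((t - s) powr - (real j / real \<alpha>) * s powr - (real d / real \<alpha>)) * indicator {0<..<t} s)" for s
  proof (cases "s \<in> {0<..<t}")
    case True
    then have c: "(t - s) powr (- 1 / real \<alpha>) > 0" by simp
    let ?c = "(t - s) powr (- 1 / real \<alpha>)"
    have e: "?D (y, s) = (?c ^ CARD('n) * cauchy_weight (?c *\<^sub>R (x - y))) * ((t - s) powr - (real j / real \<alpha>) * s powr - (real d / real \<alpha>))" for y
      using True by (simp add: duhamel_majorant_def power_add pw mult_ac)
    have "(\<integral>\<^sup>+y. ennreal (?D (y, s)) \<partial>lborel)
       = (\<integral>\<^sup>+y. ennreal (?c ^ CARD('n) * cauchy_weight (?c *\<^sub>R (x - y))) * ennreal ((t - s) powr - (real j / real \<alpha>) * s powr - (real d / real \<alpha>)) \<partial>lborel)"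
      unfolding e using c by (intro nn_integral_cong ennreal_mult) (auto intro!: mult_nonneg_nonneg less_imp_le[OF cauchy_weight_pos])
    also have "\<dots> = (\<integral>\<^sup>+y. ennreal (?c ^ CARD('n) * cauchy_weight (?c *\<^sub>R (x - y))) \<partial>lborel) * ennreal ((t - s) powr - (real j / real \<alpha>) * s powr - (real d / real \<alpha>))"
      by (rule nn_integral_multc) measurable
    also have "\<dots> = ?W * ennreal ((t - s) powr - (real j / real \<alpha>) * s powr - (real d / real \<alpha>))"
      by (simp only: nn_integral_cauchy_weight_dilate[OF c])
    finally show ?thesis using True by simp
  next
    case False
    then have "indicat_real (slab t) (y, s) = 0" "indicator {0<..<t} s = (0 :: ennreal)" for y :: "real^'n"
      by auto
    then show ?thesis by simp
  qed
  have "(\<integral>\<^sup>+z. ennreal (?D z) \<partial>lborel) = (\<integral>\<^sup>+s. \<integral>\<^sup>+y. ennreal (?D (y, s)) \<partial>lborel \<partial>lborel)"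
    unfolding lborel_prod[symmetric] by (rule lborel_pair.nn_integral_snd[OF meas', symmetric])
  also have "\<dots> = ?W * (\<integral>\<^sup>+s. ennreal ((t - s) powr - (real j / real \<alpha>) * s powr - (real d / real \<alpha>)) * indicator {0<..<t} s \<partial>lborel)"
    unfolding inner by (rule nn_integral_cmult) measurable
  also have "\<dots> < \<infinity>"
  proof -
    have "?W < \<infinity>"
      using integrableD(2)[OF integrable_cauchy_weight]
      by (simp add: less_top abs_of_pos[OF cauchy_weight_pos])
    moreover have "(\<integral>\<^sup>+s. ennreal ((t - s) powr - (real j / real \<alpha>) * s powr - (real d / real \<alpha>)) * indicator {0<..<t} s \<partial>lborel) < \<infinity>"
      using jd t by (intro nn_integral_beta_finite) auto
    ultimately show ?thesis by (simp add: ennreal_mult_less_top)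
  qed
  finally show "(\<integral>\<^sup>+z. ennreal (?D z) \<partial>lborel) < \<infinity>" .
qed


section \<open>Weak gradients and changes of variables\<close>

lemma partial_zero_outside_support:
  assumes "x \<notin> closure {x. \<phi> x \<noteq> 0}"
  shows "partial i \<phi> x = 0"
proof (rule partial_eqI)
  have "open (- closure {x. \<phi> x \<noteq> 0})" by (intro open_Compl closed_closure)
  then obtain e where e: "e > 0" "ball x e \<subseteq> - closure {x. \<phi> x \<noteq> 0}"
    using assms openE by (metis ComplI)
  have z: "\<phi> (x + h *\<^sub>R axis i 1) = 0" if "\<bar>h\<bar> < e" for h
  proof -
    have "x + h *\<^sub>R axis i 1 \<in> ball x e" using that by (simp add: dist_norm)
    then have "x + h *\<^sub>R axis i 1 \<notin> closure {x. \<phi> x \<noteq> 0}" using e(2) by blast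
    then show ?thesis using closure_subset[of "{x. \<phi> x \<noteq> 0}"] by blast
  qed
  show "has_partial i \<phi> 0 x"
  proof (rule has_field_derivative_transform_within_open[of "\<lambda>_. 0" _ _ "ball 0 e"])
    show "((\<lambda>_. 0) has_real_derivative 0) (at (0::real))" by simp
  qed (use e z in \<open>auto simp: dist_real_def\<close>)
qed

lemma lebesgue_integrable_mult_compact:
  fixes f k :: "real^'n::finite \<Rightarrow> real"
  assumes f: "f absolutely_integrable_on K" and K: "compact K"
    and k: "continuous_on UNIV k" "\<And>x. x \<notin> K \<Longrightarrow> k x = 0"
  shows "integrable lebesgue (\<lambda>x. f x * k x)"
proof -
  have "compact (k ` K)" using k(1) K by (intro compact_continuous_image) (auto intro: continuous_on_subset)
  then obtain B where B: "\<And>x. x \<in> K \<Longrightarrow> \<bar>k x\<bar> \<le> B"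
    using compact_imp_bounded[of "k ` K"] unfolding bounded_iff by auto
  have fi: "integrable lebesgue (\<lambda>x. indicat_real K x *\<^sub>R f x)"
    using f by (simp add: set_integrable_def)
  have km: "k \<in> borel_measurable lebesgue"
    using borel_measurable_continuous_onI[OF k(1)] by (simp add: measurable_completion)
  have eq: "f x * k x = (indicat_real K x *\<^sub>R f x) * k x" for x
    using k(2) by (auto simp: indicator_def)
  have "integrable lebesgue (\<lambda>x. (indicat_real K x *\<^sub>R f x) * k x)"
  proof (rule Bochner_Integration.integrable_bound)
    show "integrable lebesgue (\<lambda>x. B * (indicat_real K x *\<^sub>R f x))" using fi by simp
    show "(\<lambda>x. (indicat_real K x *\<^sub>R f x) * k x) \<in> borel_measurable lebesgue"
      using fi km by (intro borel_measurable_times) auto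
    show "AE x in lebesgue. norm ((indicat_real K x *\<^sub>R f x) * k x) \<le> norm (B * (indicat_real K x *\<^sub>R f x))"
    proof (intro AE_I2)
      fix x
      show "norm ((indicat_real K x *\<^sub>R f x) * k x) \<le> norm (B * (indicat_real K x *\<^sub>R f x))"
        using mult_right_mono[OF order_trans[OF B abs_ge_self], of x "\<bar>f x\<bar>"] by (auto simp: indicator_def abs_mult mult.commute)
    qed
  qed
  then show ?thesis by (simp add: eq)
qed

lemma weak_gradient_add:
  fixes f f' :: "real^'n::finite \<Rightarrow> real"
  assumes "weak_gradient f g" "weak_gradient f' g'"
  shows "weak_gradient (\<lambda>x. f x + f' x) (\<lambda>x. g x + g' x)"
  unfolding weak_gradient_def
proof (intro conjI allI impI)
  fix K :: "(real^'n) set" assume K: "compact K"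
  show "(\<lambda>x. f x + f' x) absolutely_integrable_on K" "(\<lambda>x. g x + g' x) absolutely_integrable_on K"
    using assms K unfolding weak_gradient_def by (auto intro!: set_integral_add(1))
next
  fix \<phi> :: "real^'n \<Rightarrow> real" and i assume \<phi>: "test_function \<phi>"
  let ?K = "closure {x. \<phi> x \<noteq> 0}"
  have K: "compact ?K" and smooth: "\<And>k. C_class k \<phi>" using \<phi> unfolding test_function_def by auto
  have "\<forall>is. length is \<le> 1 \<longrightarrow> continuous_on UNIV (partials is \<phi>)"
    using smooth[of 1] unfolding C_class_def by blast
  from this[rule_format, of "[]"] this[rule_format, of "[i]"]
  have c: "continuous_on UNIV \<phi>" "continuous_on UNIV (partial i \<phi>)" by simp_all
  have 1: "integrable lebesgue (\<lambda>x. f x * partial i \<phi> x)" if "weak_gradient f g" for f g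
    using that K partial_zero_outside_support c unfolding weak_gradient_def
    by (intro lebesgue_integrable_mult_compact[OF _ K]) auto
  have 2: "integrable lebesgue (\<lambda>x. g x $ i * \<phi> x)" if "weak_gradient f g" for f g
  proof (rule lebesgue_integrable_mult_compact[OF _ K c(1)])
    have "g absolutely_integrable_on ?K" using that K unfolding weak_gradient_def by blast
    from absolutely_integrable_component[OF this, of "axis i 1"]
    show "(\<lambda>x. g x $ i) absolutely_integrable_on ?K"
      by (simp only: cart_eq_inner_axis)
    show "\<phi> x = 0" if "x \<notin> ?K" for x using that closure_subset[of "{x. \<phi> x \<noteq> 0}"] by blast
  qed
  have "(LINT x|lebesgue. (f x + f' x) * partial i \<phi> x)
      = (LINT x|lebesgue. f x * partial i \<phi> x) + (LINT x|lebesgue. f' x * partial i \<phi> x)"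
    using 1[OF assms(1)] 1[OF assms(2)] by (simp add: distrib_right)
  also have "\<dots> = - (LINT x|lebesgue. g x $ i * \<phi> x) - (LINT x|lebesgue. g' x $ i * \<phi> x)"
    using assms \<phi> unfolding weak_gradient_def by simp
  also have "\<dots> = - (LINT x|lebesgue. (g x + g' x) $ i * \<phi> x)"
    using 2[OF assms(1)] 2[OF assms(2)] by (simp add: distrib_right)
  finally show "(LINT x|lebesgue. (f x + f' x) * partial i \<phi> x) = - (LINT x|lebesgue. (g x + g' x) $ i * \<phi> x)" .
qed

lemma weak_gradient_measurable:
  fixes f :: "real^'n::finite \<Rightarrow> real"
  assumes "weak_gradient f g"
  shows "g \<in> borel_measurable lebesgue"
proof (rule borel_measurable_LIMSEQ_metric)
  show "(\<lambda>x. indicat_real (cball 0 (real n)) x *\<^sub>R g x) \<in> borel_measurable lebesgue" for n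
  proof -
    have "\<forall>K. compact K \<longrightarrow> f absolutely_integrable_on K \<and> g absolutely_integrable_on K"
      using assms unfolding weak_gradient_def by (rule conjunct1)
    then have "g absolutely_integrable_on cball 0 (real n)" using compact_cball by blast
    then show ?thesis unfolding set_integrable_def by (rule borel_measurable_integrable)
  qed
  show "(\<lambda>n. indicat_real (cball 0 (real n)) x *\<^sub>R g x) \<longlonglongrightarrow> g x" for x
  proof (rule tendsto_eventually)
    obtain N :: nat where "norm x \<le> real N" using real_arch_simple by blast
    then show "\<forall>\<^sub>F n in sequentially. indicat_real (cball 0 (real n)) x *\<^sub>R g x = g x"
      by (intro eventually_sequentiallyI[of N]) (auto simp: indicator_def)
  qed
qed

lemma Linf_norm_AE: "AE x in lebesgue. ennreal (norm (f x)) \<le> Linf_norm f"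
  unfolding Linf_norm_def by (rule esssup_AE)

lemma Linf_norm_add:
  fixes f g :: "'a::euclidean_space \<Rightarrow> 'b::euclidean_space"
  assumes "f \<in> borel_measurable lebesgue" "g \<in> borel_measurable lebesgue"
  shows "Linf_norm (\<lambda>x. f x + g x) \<le> Linf_norm f + Linf_norm g"
  unfolding Linf_norm_def[of "\<lambda>x. f x + g x"]
proof (rule esssup_I)
  show "(\<lambda>x. ennreal (norm (f x + g x))) \<in> borel_measurable lebesgue" using assms by measurable
  show "AE x in lebesgue. ennreal (norm (f x + g x)) \<le> Linf_norm f + Linf_norm g"
    using Linf_norm_AE[of f] Linf_norm_AE[of g]
  proof eventually_elim
    case (elim x)
    have "ennreal (norm (f x + g x)) \<le> ennreal (norm (f x)) + ennreal (norm (g x))"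
      by (simp add: ennreal_plus[symmetric] norm_triangle_ineq del: ennreal_plus)
    then show ?case using elim by (meson add_mono order_trans)
  qed
qed

text \<open>Stated with strict bounds because the infimum that defines \<^const>\<open>grad_norm\<close> is compared through
  some weak gradient of each summand.\<close>

lemma grad_norm_add_less:
  fixes f f' :: "real^'n::finite \<Rightarrow> real"
  assumes "grad_norm f < a" "grad_norm f' < b"
  shows "grad_norm (\<lambda>x. f x + f' x) < a + b"
proof -
  obtain g g' where g: "weak_gradient f g" "Linf_norm g < a" and g': "weak_gradient f' g'" "Linf_norm g' < b"
    using assms unfolding grad_norm_def Inf_less_iff by blast
  have "grad_norm (\<lambda>x. f x + f' x) \<le> Linf_norm (\<lambda>x. g x + g' x)"
    unfolding grad_norm_def using weak_gradient_add[OF g(1) g'(1)] by (intro Inf_lower) blast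
  also have "\<dots> \<le> Linf_norm g + Linf_norm g'"
    using weak_gradient_measurable g g' by (intro Linf_norm_add) auto
  also have "\<dots> < a + b" using g(2) g'(2) by (intro add_strict_mono)
  finally show ?thesis .
qed

definition par_dil :: "nat \<Rightarrow> real \<Rightarrow> 'a::real_vector \<times> real \<Rightarrow> 'a \<times> real" where
  "par_dil \<alpha> l z = (l *\<^sub>R fst z, l ^ \<alpha> * snd z)"

lemma par_dil_affine:
  fixes l :: real and \<alpha> :: nat
  defines "c \<equiv> (\<lambda>b :: (real^'n::finite) \<times> real. if snd b = 0 then l else l ^ \<alpha>)"
  shows "par_dil \<alpha> l = (\<lambda>z :: (real^'n) \<times> real. 0 + (\<Sum>b\<in>Basis. (c b * (z \<bullet> b)) *\<^sub>R b))"
    and "l > 0 \<Longrightarrow> (\<Prod>b\<in>Basis. \<bar>c b\<bar>) = l ^ (CARD('n) + \<alpha>)"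
proof -
  show "par_dil \<alpha> l = (\<lambda>z :: (real^'n) \<times> real. 0 + (\<Sum>b\<in>Basis. (c b * (z \<bullet> b)) *\<^sub>R b))"
  proof
    fix z :: "(real^'n) \<times> real"
    show "par_dil \<alpha> l z = 0 + (\<Sum>b\<in>Basis. (c b * (z \<bullet> b)) *\<^sub>R b)"
    proof (rule euclidean_eqI)
      fix b :: "(real^'n) \<times> real" assume b: "b \<in> Basis"
      have "(0 + (\<Sum>b\<in>Basis. (c b * (z \<bullet> b)) *\<^sub>R b)) \<bullet> b = c b * (z \<bullet> b)"
        using b by (simp add: inner_sum_left inner_Basis if_distrib cong: if_cong)
      moreover have "par_dil \<alpha> l z \<bullet> b = c b * (z \<bullet> b)"
        using b by (cases z) (auto simp: par_dil_def c_def Basis_prod_def)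
      ultimately show "par_dil \<alpha> l z \<bullet> b = (0 + (\<Sum>b\<in>Basis. (c b * (z \<bullet> b)) *\<^sub>R b)) \<bullet> b" by simp
    qed
  qed
  assume l: "l > 0"
  have "(\<Prod>b\<in>Basis. \<bar>c b\<bar>) = (\<Prod>b\<in>(\<lambda>u. (u, 0)) ` Basis \<union> (\<lambda>u. (0, u)) ` Basis. \<bar>c b\<bar>)"
    by (simp add: Basis_prod_def)
  also have "\<dots> = (\<Prod>b\<in>(\<lambda>u. (u, 0)) ` Basis. \<bar>c b\<bar>) * (\<Prod>b\<in>(\<lambda>u. (0, u)) ` Basis. \<bar>c b\<bar>)"
    by (intro prod.union_disjoint) (auto simp: nonzero_Basis)
  also have "\<dots> = (\<Prod>b\<in>(Basis :: (real^'n) set). l) * l ^ \<alpha>"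
    using l by (subst (1 2) prod.reindex) (auto simp: inj_on_def c_def)
  finally show "(\<Prod>b\<in>Basis. \<bar>c b\<bar>) = l ^ (CARD('n) + \<alpha>)" by (simp add: power_add)
qed

lemma lborel_par_dil:
  assumes "l > 0"
  shows "(lborel :: ((real^'n::finite) \<times> real) measure) = density (distr lborel borel (par_dil \<alpha> l)) (\<lambda>_. ennreal (l ^ (CARD('n) + \<alpha>)))"
proof -
  have "(if snd b = 0 then l else l ^ \<alpha>) \<noteq> 0" for b :: "(real^'n) \<times> real" using assms by simp
  from lborel_affine_euclidean[where c = "\<lambda>b :: (real^'n) \<times> real. if snd b = 0 then l else l ^ \<alpha>" and t = 0, OF this] show ?thesis
    unfolding par_dil_affine(2)[OF assms] par_dil_affine(1) .
qed

lemma lebesgue_par_dil: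
  assumes "l > 0"
  shows "(lebesgue :: ((real^'n::finite) \<times> real) measure) = density (distr lebesgue lebesgue (par_dil \<alpha> l)) (\<lambda>_. ennreal (l ^ (CARD('n) + \<alpha>)))"
    and "par_dil \<alpha> l \<in> (lebesgue :: ((real^'n) \<times> real) measure) \<rightarrow>\<^sub>M lebesgue"
proof -
  have ne: "(if snd b = 0 then l else l ^ \<alpha>) \<noteq> 0" for b :: "(real^'n) \<times> real" using assms by simp
  from lebesgue_affine_euclidean[where c = "\<lambda>b :: (real^'n) \<times> real. if snd b = 0 then l else l ^ \<alpha>" and t = 0, OF ne]
  show "(lebesgue :: ((real^'n) \<times> real) measure) = density (distr lebesgue lebesgue (par_dil \<alpha> l)) (\<lambda>_. ennreal (l ^ (CARD('n) + \<alpha>)))"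
    unfolding par_dil_affine(2)[OF assms] par_dil_affine(1) .
  from lebesgue_affine_measurable[where c = "\<lambda>b :: (real^'n) \<times> real. if snd b = 0 then l else l ^ \<alpha>" and t = 0, OF ne]
  show "par_dil \<alpha> l \<in> (lebesgue :: ((real^'n) \<times> real) measure) \<rightarrow>\<^sub>M lebesgue"
    unfolding par_dil_affine(1) .
qed

lemma par_dil_measurable [measurable]:
  "par_dil \<alpha> l \<in> borel_measurable (borel :: ((real^'n::finite) \<times> real) measure)"
  unfolding par_dil_def[abs_def]
  by (intro borel_measurable_continuous_onI continuous_intros)

lemma integral_par_dil:
  fixes H :: "(real^'n::finite) \<times> real \<Rightarrow> real"
  assumes l: "l > 0" and H: "integrable lborel H"
  shows "integrable lborel (\<lambda>z. H (par_dil \<alpha> l z))"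
    and "(LINT z|lborel. H z) = l ^ (CARD('n) + \<alpha>) * (LINT z|lborel. H (par_dil \<alpha> l z))"
proof -
  have "par_dil \<alpha> l \<in> (lborel :: ((real^'n) \<times> real) measure) \<rightarrow>\<^sub>M borel" by simp
  note cv = change_of_variables_constant_jacobian(2,3)[OF lborel_par_dil[OF l, of \<alpha>] this]
  show "integrable lborel (\<lambda>z. H (par_dil \<alpha> l z))"
    by (rule cv(1)[OF _ _ H]) (use l in simp_all)
  show "(LINT z|lborel. H z) = l ^ (CARD('n) + \<alpha>) * (LINT z|lborel. H (par_dil \<alpha> l z))"
    by (rule cv(2)[OF _ _ borel_measurable_integrable[OF H]]) (use l in simp_all)
qed

lemma nn_integral_par_dil:
  fixes H :: "(real^'n::finite) \<times> real \<Rightarrow> ennreal"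
  assumes l: "l > 0" and H: "H \<in> borel_measurable lebesgue"
  shows "(\<integral>\<^sup>+z. H z \<partial>lebesgue) = ennreal (l ^ (CARD('n) + \<alpha>)) * (\<integral>\<^sup>+z. H (par_dil \<alpha> l z) \<partial>lebesgue)"
  by (rule change_of_variables_constant_jacobian(1)[OF lebesgue_par_dil[OF l] refl _ H]) (use l in simp)

lemma lebesgue_integral_dilate:
  fixes H :: "'a::euclidean_space \<Rightarrow> real"
  assumes l: "l > 0" and H: "integrable lebesgue H"
  shows "integrable lebesgue (\<lambda>z. H (l *\<^sub>R z))"
    and "(LINT z|lebesgue. H z) = l ^ DIM('a) * (LINT z|lebesgue. H (l *\<^sub>R z))"
proof -
  have "(lebesgue :: 'a measure) = density (distr lebesgue lebesgue ((*\<^sub>R) l)) (\<lambda>_. ennreal (l ^ DIM('a)))"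
    using lebesgue_affine_euclidean[where c = "\<lambda>_::'a. l" and t = 0] l
    unfolding scaleR_scaleR[symmetric] scaleR_sum_right[symmetric] euclidean_representation prod_constant by simp
  note cv = change_of_variables_constant_jacobian(2,3)[OF this lebesgue_measurable_scaling refl]
  show "integrable lebesgue (\<lambda>z. H (l *\<^sub>R z))"
    by (rule cv(1)[OF _ H]) (use l in simp)
  show "(LINT z|lebesgue. H z) = l ^ DIM('a) * (LINT z|lebesgue. H (l *\<^sub>R z))"
    by (rule cv(2)[OF _ borel_measurable_integrable[OF H]]) (use l in simp)
qed


section \<open>Dilated solutions\<close>

text \<open>The rescaled solution. At time 1 and with \<open>l = t\<^sup>1\<^sup>/\<^sup>\<alpha>\<close> it is the function whose limit is sought.\<close>

definition dilate :: "flow \<Rightarrow> real \<Rightarrow> (real^'n::finite \<Rightarrow> real \<Rightarrow> real) \<Rightarrow> real^'n \<Rightarrow> real \<Rightarrow> real" where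
  "dilate F l u x t = inverse l * u (l *\<^sub>R x) (l ^ flow_order F * t)"

lemma power_flow_order_powr:
  assumes "l > 0"
  shows "(l ^ flow_order F) powr (real m / real (flow_order F)) = l ^ m"
  using assms flow_order_pos[of F] by (simp add: powr_realpow[symmetric] powr_powr)

lemma grad_component: "grad f x $ i = partials [i] f x"
  by (simp add: grad_def)

lemma hess_component: "hess f x $ i $ j = partials [i, j] f x"
  by (simp add: hess_def)

text \<open>Scale invariant bounds for all derivatives, in the form in which they pass to limits.\<close>

definition slice_bounds :: "flow \<Rightarrow> (nat \<Rightarrow> real) \<Rightarrow> (real^'n::finite \<Rightarrow> real \<Rightarrow> real) \<Rightarrow> bool" where
  "slice_bounds F B u \<longleftrightarrow>
     (\<forall>t>0. axis_smooth (\<lambda>x. u x t)) \<and>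
     (\<forall>\<gamma> i x. \<forall>t>0. \<bar>partials (\<gamma> @ [i]) (\<lambda>z. u z t) x\<bar>
        \<le> B (length \<gamma>) * t powr - (real (length \<gamma>) / real (flow_order F)))"

text \<open>One time derivative of the gradient is enough for compactness in time.\<close>

definition time_bound :: "real \<Rightarrow> (real^'n::finite \<Rightarrow> real \<Rightarrow> real) \<Rightarrow> bool" where
  "time_bound B u \<longleftrightarrow>
     (\<forall>i x. \<forall>t>0. \<exists>D. ((\<lambda>s. partial i (\<lambda>z. u z s) x) has_real_derivative D) (at t) \<and> \<bar>D\<bar> * t \<le> B)"

text \<open>Analyticity makes the derivatives in the well-posedness bounds genuine ones: \<^const>\<open>deriv\<close> and
  \<^const>\<open>partial\<close> say nothing at points where a function is not differentiable.\<close>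

lemma derivative_bounds_imp_slice_bounds:
  assumes an: "real_analytic_on (\<lambda>(x, t). u x t) (UNIV \<times> {0<..})"
    and db: "derivative_bounds F u0 u" and fin: "grad_norm u0 < \<infinity>"
  shows "\<exists>B B'. slice_bounds F B u \<and> time_bound B' u"
proof -
  obtain c R where c: "c > 0" "R > 0" and b: "\<And>\<gamma> k x t. t > 0 \<Longrightarrow>
      ennreal (norm (scaled_deriv F \<gamma> k u x t)) \<le> ennreal (c * R ^ (length \<gamma> + k) * fact (length \<gamma> + k)) * grad_norm u0"
    using db unfolding derivative_bounds_def by blast
  define G where "G = enn2real (grad_norm u0)"
  have G: "grad_norm u0 = ennreal G" "G \<ge> 0" using fin by (auto simp: G_def less_top)
  have b': "norm (scaled_deriv F \<gamma> k u x t) \<le> c * R ^ (length \<gamma> + k) * fact (length \<gamma> + k) * G" if "t > 0" for \<gamma> k x t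
    using b[OF that, of \<gamma> k x] c G by (simp add: ennreal_mult[symmetric])
  have comp: "\<bar>scaled_deriv F \<gamma> k u x t $ i\<bar> \<le> c * R ^ (length \<gamma> + k) * fact (length \<gamma> + k) * G" if "t > 0" for \<gamma> k x t i
    using order_trans[OF component_le_norm_cart b'[OF that]] .
  define B where "B m = c * R ^ m * fact m * G" for m
  have "slice_bounds F B u"
    unfolding slice_bounds_def
  proof (intro conjI allI impI)
    show "axis_smooth (\<lambda>x. u x t)" if "0 < t" for t using axis_smooth_slice[OF an that] .
    fix \<gamma> i x and t :: real assume t: "t > 0"
    have eq: "scaled_deriv F \<gamma> 0 u x t $ i = t powr (real (length \<gamma>) / real (flow_order F)) * partials (\<gamma> @ [i]) (\<lambda>z. u z t) x"
      by (simp add: scaled_deriv_def partials_append)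
    have "t powr (real (length \<gamma>) / real (flow_order F)) * \<bar>partials (\<gamma> @ [i]) (\<lambda>z. u z t) x\<bar> \<le> B (length \<gamma>)"
      using comp[OF t, of \<gamma> 0 x i] unfolding eq by (simp add: abs_mult B_def)
    then show "\<bar>partials (\<gamma> @ [i]) (\<lambda>z. u z t) x\<bar> \<le> B (length \<gamma>) * t powr - (real (length \<gamma>) / real (flow_order F))"
      using t by (simp add: powr_minus field_simps)
  qed
  moreover have "time_bound (B 1) u"
    unfolding time_bound_def
  proof (intro allI impI)
    fix i x and t :: real assume t: "t > 0"
    have d: "(\<lambda>s. partial i (\<lambda>z. u z s) x) differentiable at t"
      using partials_differentiable_time[OF an t, of "[i]" x] by simp
    have eq: "scaled_deriv F [] 1 u x t $ i = t * deriv (\<lambda>s. partial i (\<lambda>z. u z s) x) t"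
      using t by (simp add: scaled_deriv_def tdt_def)
    have "\<bar>deriv (\<lambda>s. partial i (\<lambda>z. u z s) x) t\<bar> * t \<le> B 1"
      using comp[OF t, of "[]" 1 x i] t unfolding eq by (simp add: abs_mult B_def mult.commute)
    then show "\<exists>D. ((\<lambda>s. partial i (\<lambda>z. u z s) x) has_real_derivative D) (at t) \<and> \<bar>D\<bar> * t \<le> B 1"
      using d by (metis DERIV_deriv_iff_real_differentiable)
  qed
  ultimately show ?thesis by blast
qed

lemma partials_dilate:
  assumes sm: "axis_smooth (\<lambda>x. u x (l ^ flow_order F * t))"
  shows "partials is (\<lambda>z. dilate F l u z t) x
      = inverse l * l ^ length is * partials is (\<lambda>z. u z (l ^ flow_order F * t)) (l *\<^sub>R x)"
  unfolding dilate_def by (subst partials_dilation[OF sm]) simp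

text \<open>The constants do not depend on \<open>l\<close>: the powers of \<open>l\<close> gained in space are lost in time.\<close>

lemma slice_bounds_dilate:
  fixes u :: "real^'n::finite \<Rightarrow> real \<Rightarrow> real"
  assumes b: "slice_bounds F B u" and l: "l > 0"
  shows "slice_bounds F B (dilate F l u)"
  unfolding slice_bounds_def
proof (intro conjI allI impI)
  fix t :: real assume t: "t > 0"
  have lt: "l ^ flow_order F * t > 0" using l t by simp
  have sm: "axis_smooth (\<lambda>x. u x (l ^ flow_order F * t))" using b lt unfolding slice_bounds_def by blast
  show "axis_smooth (\<lambda>x. dilate F l u x t)"
    unfolding dilate_def by (rule axis_smooth_dilation[OF sm])
  fix \<gamma> :: "'n list" and i x
  let ?m = "length \<gamma>" and ?a = "real (flow_order F)"
  have "\<bar>partials (\<gamma> @ [i]) (\<lambda>z. dilate F l u z t) x\<bar>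
      = l ^ ?m * \<bar>partials (\<gamma> @ [i]) (\<lambda>z. u z (l ^ flow_order F * t)) (l *\<^sub>R x)\<bar>"
    unfolding partials_dilate[where u = u and l = l and F = F and t = t, OF sm] using l by (simp add: abs_mult)
  also have "\<dots> \<le> l ^ ?m * (B ?m * (l ^ flow_order F * t) powr - (real ?m / ?a))"
    using b lt l unfolding slice_bounds_def by (intro mult_left_mono) auto
  also have "(l ^ flow_order F * t) powr - (real ?m / ?a) = inverse (l ^ ?m) * t powr - (real ?m / ?a)"
    using l t power_flow_order_powr[OF l, of F ?m] by (simp add: powr_mult powr_minus)
  also have "l ^ ?m * (B ?m * (inverse (l ^ ?m) * t powr - (real ?m / ?a))) = B ?m * t powr - (real ?m / ?a)"
    using l by simp
  finally show "\<bar>partials (\<gamma> @ [i]) (\<lambda>z. dilate F l u z t) x\<bar> \<le> B ?m * t powr - (real ?m / ?a)" .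
qed

lemma time_bound_dilate:
  assumes b: "slice_bounds F B u" "time_bound B' u" and l: "l > 0"
  shows "time_bound B' (dilate F l u)"
  unfolding time_bound_def
proof (intro allI impI)
  fix i x and t :: real assume t: "t > 0"
  let ?L = "l ^ flow_order F"
  have L: "?L > 0" and Lt: "?L * t > 0" using l t by simp_all
  obtain D where D: "((\<lambda>s. partial i (\<lambda>z. u z s) (l *\<^sub>R x)) has_real_derivative D) (at (?L * t))" "\<bar>D\<bar> * (?L * t) \<le> B'"
    using b(2) Lt unfolding time_bound_def by blast
  have "((\<lambda>s. partial i (\<lambda>z. u z (?L * s)) (l *\<^sub>R x)) has_real_derivative D * ?L) (at t)"
    using DERIV_chain2[of "\<lambda>s. partial i (\<lambda>z. u z s) (l *\<^sub>R x)" D "\<lambda>s. ?L * s" t ?L UNIV] D(1)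
    by (auto intro!: derivative_eq_intros)
  moreover have "partial i (\<lambda>z. u z (?L * s)) (l *\<^sub>R x) = partial i (\<lambda>z. dilate F l u z s) x" if "s \<in> {0<..}" for s
  proof -
    have sm: "axis_smooth (\<lambda>x. u x (?L * s))" using b(1) that L unfolding slice_bounds_def by simp
    show ?thesis using partials_dilate[where u = u and l = l and F = F and t = s, OF sm, of "[i]" x] l by simp
  qed
  ultimately have "((\<lambda>s. partial i (\<lambda>z. dilate F l u z s) x) has_real_derivative D * ?L) (at t)"
    using has_field_derivative_transform_within_open[of "\<lambda>s. partial i (\<lambda>z. u z (?L * s)) (l *\<^sub>R x)" _ t "{0<..}"] t
    by auto
  moreover have "\<bar>D * ?L\<bar> * t \<le> B'" using D(2) L by (simp add: abs_mult mult_ac)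
  ultimately show "\<exists>D. ((\<lambda>s. partial i (\<lambda>z. dilate F l u z s) x) has_real_derivative D) (at t) \<and> \<bar>D\<bar> * t \<le> B'" by blast
qed

lemma grad_dilate:
  assumes "axis_smooth (\<lambda>x. u x (l ^ flow_order F * t))" "l > 0"
  shows "grad (\<lambda>z. dilate F l u z t) x = grad (\<lambda>z. u z (l ^ flow_order F * t)) (l *\<^sub>R x)"
  by (rule vec_eq_iff[THEN iffD2]) (use assms(2) in \<open>simp only: grad_component partials_dilate[where u = u and l = l and F = F and t = t, OF assms(1)]; simp\<close>)

lemma hess_dilate:
  assumes "axis_smooth (\<lambda>x. u x (l ^ flow_order F * t))" "l > 0"
  shows "hess (\<lambda>z. dilate F l u z t) x = l *\<^sub>R hess (\<lambda>z. u z (l ^ flow_order F * t)) (l *\<^sub>R x)"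
  unfolding vec_eq_iff vector_scaleR_component hess_component partials_dilate[where u = u and l = l and F = F and t = t, OF assms(1)]
  using assms(2) by simp

lemma partials_kernel_dilate:
  fixes z :: "real^'n::finite"
  assumes l: "l > 0" and \<tau>: "\<tau> > 0" and "is": "is \<in> kernel_orders F"
  shows "l ^ (CARD('n) + length is) * partials is (kernel F (l ^ flow_order F * \<tau>)) (l *\<^sub>R z) = partials is (kernel F \<tau>) z"
proof -
  define c where "c = \<tau> powr (- 1 / real (flow_order F))"
  have c: "c > 0" and 1: "\<tau> * c ^ flow_order F = 1"
    unfolding c_def by (fact inverse_root_time[OF \<tau>])+
  then have 2: "(l ^ flow_order F * \<tau>) * (c / l) ^ flow_order F = 1"
    using l by (simp add: power_divide)
  have cl: "c / l > 0" using c l by simp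
  show ?thesis
    unfolding partials_kernel_self_similar[OF c 1 "is"] partials_kernel_self_similar[OF cl 2 "is"]
    using l by (simp add: power_divide)
qed

text \<open>A term with \<open>m\<close> derivatives on the kernel gains \<open>l\<^sup>n\<^sup>+\<^sup>m\<close> from the kernel and \<open>l\<^sup>\<alpha>\<^sup>-\<^sup>1\<^sup>-\<^sup>m\<close> from its
  coefficient, so all terms scale alike.\<close>

lemma duhamel_integrand_dilate:
  fixes x :: "real^'n::finite"
  assumes adm: "admissible_form F f" and sm: "axis_smooth (\<lambda>x. u x (l ^ flow_order F * s))"
    and l: "l > 0" and s: "0 < s" "s < t"
  shows "duhamel_integrand F f (dilate F l u) x t y s
    = l ^ (CARD('n) + flow_order F - 1) *
      duhamel_integrand F f u (l *\<^sub>R x) (l ^ flow_order F * t) (l *\<^sub>R y) (l ^ flow_order F * s)"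
proof -
  let ?q = "grad (\<lambda>z. u z (l ^ flow_order F * s)) (l *\<^sub>R y)"
  let ?H = "hess (\<lambda>z. u z (l ^ flow_order F * s)) (l *\<^sub>R y)"
  have termwise: "partials is (kernel F (t - s)) (x - y) * coeff_of f is ?q (l *\<^sub>R ?H)
    = l ^ (CARD('n) + flow_order F - 1) *
      (partials is (kernel F (l ^ flow_order F * t - l ^ flow_order F * s)) (l *\<^sub>R x - l *\<^sub>R y) * coeff_of f is ?q ?H)"
    if "is": "is \<in> kernel_orders F" for "is"
  proof -
    have "coeff_of f is ?q (l *\<^sub>R ?H) = l ^ (flow_order F - 1 - length is) * coeff_of f is ?q ?H"
      using homogeneous_jet_coeff_of[OF adm "is"] unfolding homogeneous_jet_def by blast
    moreover have "CARD('n) + flow_order F - 1 = (CARD('n) + length is) + (flow_order F - 1 - length is)"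
      using kernel_orders_less[OF "is"] by simp
    moreover have "partials is (kernel F (t - s)) (x - y) = l ^ (CARD('n) + length is) *
        partials is (kernel F (l ^ flow_order F * t - l ^ flow_order F * s)) (l *\<^sub>R x - l *\<^sub>R y)"
      using partials_kernel_dilate[OF l _ "is", of "t - s" "x - y"] s by (simp add: algebra_simps)
    ultimately show ?thesis by (simp only: power_add mult_ac)
  qed
  show ?thesis
    unfolding duhamel_integrand_eq_sum[OF adm] grad_dilate[where u = u and l = l and F = F and t = s, OF sm l] hess_dilate[where u = u and l = l and F = F and t = s, OF sm l] sum_distrib_left
    by (intro sum.cong refl termwise)
qed

text \<open>Changes of variables and dominated convergence are applied in space-time, so iterated integrals
  are first replaced by joint ones.\<close>

lemma duhamel_iterated_eq_joint:
  fixes h :: "real^'n::finite \<Rightarrow> real \<Rightarrow> real"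
  assumes "set_integrable lborel (slab t) (\<lambda>(y, s). h y s)"
  shows "(LINT s:{0<..<t}|lborel. (LINT y|lborel. h y s)) = (LINT z:slab t|lborel. (\<lambda>(y, s). h y s) z)"
proof -
  let ?H = "\<lambda>y s. indicat_real {0<..<t} s * h y s"
  have eq: "indicat_real (slab t) z *\<^sub>R (\<lambda>(y, s). h y s) z = (\<lambda>(y, s). ?H y s) z" for z
    by (cases z) (auto simp: indicator_def)
  have int: "integrable (lborel \<Otimes>\<^sub>M lborel) (\<lambda>(y, s). ?H y s)"
    using assms unfolding set_integrable_def eq lborel_prod .
  have "(LINT s|lborel. LINT y|lborel. ?H y s) = (LINT z|(lborel \<Otimes>\<^sub>M lborel). (\<lambda>(y, s). ?H y s) z)"
    by (rule lborel_pair.integral_snd[OF int])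
  then show ?thesis
    unfolding set_lebesgue_integral_def eq lborel_prod by simp
qed

lemma kernel_convolution_dilate:
  fixes u0 :: "real^'n::finite \<Rightarrow> real"
  assumes l: "l > 0" and t: "t > 0"
    and i: "integrable lebesgue (\<lambda>y. kernel F (l ^ flow_order F * t) (l *\<^sub>R x - y) * u0 y)"
  shows "integrable lebesgue (\<lambda>y. kernel F t (x - y) * (inverse l * u0 (l *\<^sub>R y)))"
    and "(LINT y|lebesgue. kernel F t (x - y) * (inverse l * u0 (l *\<^sub>R y)))
      = inverse l * (LINT y|lebesgue. kernel F (l ^ flow_order F * t) (l *\<^sub>R x - y) * u0 y)"
proof -
  have K: "kernel F t (x - y) * (inverse l * u0 (l *\<^sub>R y))
      = l ^ CARD('n) * inverse l * (kernel F (l ^ flow_order F * t) (l *\<^sub>R x - l *\<^sub>R y) * u0 (l *\<^sub>R y))" for y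
    using partials_kernel_dilate[OF l t, of "[]" F "x - y"] by (simp add: kernel_orders_def scaleR_diff_right)
  show "integrable lebesgue (\<lambda>y. kernel F t (x - y) * (inverse l * u0 (l *\<^sub>R y)))"
    unfolding K by (intro integrable_mult_right lebesgue_integral_dilate(1)[OF l i])
  show "(LINT y|lebesgue. kernel F t (x - y) * (inverse l * u0 (l *\<^sub>R y)))
      = inverse l * (LINT y|lebesgue. kernel F (l ^ flow_order F * t) (l *\<^sub>R x - y) * u0 y)"
    unfolding K lebesgue_integral_dilate(2)[OF l i] by simp
qed

text \<open>Scale invariance of the integral equation: the data become \<open>l\<^sup>-\<^sup>1 u\<^sub>0(l x)\<close>. The joint integral gains
  \<open>l\<^sup>n\<^sup>+\<^sup>\<alpha>\<^sup>-\<^sup>1\<close> from its integrand and loses \<open>l\<^sup>n\<^sup>+\<^sup>\<alpha>\<close> to the change of variables.\<close>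

lemma mild_solution_dilate:
  fixes u :: "real^'n::finite \<Rightarrow> real \<Rightarrow> real"
  assumes adm: "admissible_form F f" and mild: "mild_solution F f u0 u" and b: "slice_bounds F B u"
    and l: "l > 0" and t: "t > 0"
  shows "integrable lebesgue (\<lambda>y. kernel F t (x - y) * (inverse l * u0 (l *\<^sub>R y)))"
    and "set_integrable lborel (slab t) (\<lambda>(y, s). duhamel_integrand F f (dilate F l u) x t y s)"
    and "dilate F l u x t = (LINT y|lebesgue. kernel F t (x - y) * (inverse l * u0 (l *\<^sub>R y)))
      + (LINT z:slab t|lborel. (\<lambda>(y, s). duhamel_integrand F f (dilate F l u) x t y s) z)"
proof -
  let ?a = "flow_order F" and ?n = "CARD('n)"
  let ?t = "l ^ ?a * t" and ?x = "l *\<^sub>R x"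
  have L: "l ^ ?a > 0" and Lt: "?t > 0" using l t by simp_all
  have i1: "integrable lebesgue (\<lambda>y. kernel F ?t (?x - y) * u0 y)"
    and i2: "set_integrable lborel (slab ?t) (\<lambda>(y, s). duhamel_integrand F f u ?x ?t y s)"
    and e: "u ?x ?t = (LINT y|lebesgue. kernel F ?t (?x - y) * u0 y)
        + (LINT s:{0<..<?t}|lborel. (LINT y|lborel. duhamel_integrand F f u ?x ?t y s))"
    using mild Lt unfolding mild_solution_def by blast+
  show "integrable lebesgue (\<lambda>y. kernel F t (x - y) * (inverse l * u0 (l *\<^sub>R y)))"
    by (rule kernel_convolution_dilate(1)[OF l t i1])
  note lin = kernel_convolution_dilate(2)[OF l t i1]
  let ?H = "\<lambda>z. indicat_real (slab ?t) z *\<^sub>R (\<lambda>(y, s). duhamel_integrand F f u ?x ?t y s) z"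
  have H: "integrable lborel ?H" using i2 unfolding set_integrable_def .
  have eq: "indicat_real (slab t) z *\<^sub>R (\<lambda>(y, s). duhamel_integrand F f (dilate F l u) x t y s) z
      = l ^ (?n + ?a - 1) * ?H (par_dil ?a l z)" for z
  proof -
    obtain y s where z: "z = (y, s)" by (cases z)
    show ?thesis
    proof (cases "0 < s \<and> s < t")
      case True
      then have "axis_smooth (\<lambda>x. u x (l ^ ?a * s))" using b L unfolding slice_bounds_def by simp
      from duhamel_integrand_dilate[where u = u and l = l and F = F and s = s, OF adm this l, of t x y]
      show ?thesis using True L by (simp add: z par_dil_def)
    next
      case False
      then have "\<not> (0 < l ^ ?a * s \<and> l ^ ?a * s < l ^ ?a * t)" using mult_less_cancel_left_pos[OF L, of s t] mult_less_cancel_left_pos[OF L, of 0 s, unfolded mult_zero_right] by blast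
      then show ?thesis using False by (auto simp: z par_dil_def indicator_def)
    qed
  qed
  show "set_integrable lborel (slab t) (\<lambda>(y, s). duhamel_integrand F f (dilate F l u) x t y s)"
    unfolding set_integrable_def eq by (intro integrable_mult_right integral_par_dil(1)[OF l H])
  have "(LINT z:slab t|lborel. (\<lambda>(y, s). duhamel_integrand F f (dilate F l u) x t y s) z)
      = l ^ (?n + ?a - 1) * (LINT z|lborel. ?H (par_dil ?a l z))"
    unfolding set_lebesgue_integral_def eq by simp
  moreover have "(LINT z:slab ?t|lborel. (\<lambda>(y, s). duhamel_integrand F f u ?x ?t y s) z)
      = l ^ (?n + ?a) * (LINT z|lborel. ?H (par_dil ?a l z))"
    unfolding set_lebesgue_integral_def by (rule integral_par_dil(2)[OF l H])
  moreover have "l ^ (?n + ?a) = l * l ^ (?n + ?a - 1)"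
    using flow_order_pos[of F] by (metis add_gr_0 power_eq_if less_not_refl)
  ultimately have "(LINT z:slab t|lborel. (\<lambda>(y, s). duhamel_integrand F f (dilate F l u) x t y s) z)
      = inverse l * (LINT z:slab ?t|lborel. (\<lambda>(y, s). duhamel_integrand F f u ?x ?t y s) z)"
    using l by simp
  then show "dilate F l u x t = (LINT y|lebesgue. kernel F t (x - y) * (inverse l * u0 (l *\<^sub>R y)))
      + (LINT z:slab t|lborel. (\<lambda>(y, s). duhamel_integrand F f (dilate F l u) x t y s) z)"
    unfolding lin dilate_def e duhamel_iterated_eq_joint[OF i2] by (simp add: distrib_left)
qed

lemma norm_grad_hess_le:
  fixes u :: "real^'n::finite \<Rightarrow> real \<Rightarrow> real"
  assumes b: "slice_bounds F B u" and s: "s > 0"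
  shows "norm (grad (\<lambda>z. u z s) y) \<le> real CARD('n) * B 0"
    and "norm (hess (\<lambda>z. u z s) y) \<le> real CARD('n) ^ 2 * B 1 * s powr (- 1 / real (flow_order F))"
proof -
  have g: "\<bar>grad (\<lambda>z. u z s) y $ i\<bar> \<le> B 0" for i
  proof -
    have "\<bar>partials ([] @ [i]) (\<lambda>z. u z s) y\<bar> \<le> B (length ([] :: 'n list)) * s powr - (real (length ([] :: 'n list)) / real (flow_order F))"
      using b s unfolding slice_bounds_def by blast
    then show ?thesis using s by (simp add: grad_component)
  qed
  have h: "\<bar>hess (\<lambda>z. u z s) y $ i $ j\<bar> \<le> B 1 * s powr (- 1 / real (flow_order F))" for i j
  proof -
    have "\<bar>partials ([i] @ [j]) (\<lambda>z. u z s) y\<bar> \<le> B (length [i]) * s powr - (real (length [i]) / real (flow_order F))"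
      using b s unfolding slice_bounds_def by blast
    then show ?thesis by (simp add: hess_component)
  qed
  have "norm (grad (\<lambda>z. u z s) y) \<le> (\<Sum>i\<in>UNIV. \<bar>grad (\<lambda>z. u z s) y $ i\<bar>)" by (rule norm_le_l1_cart)
  also have "\<dots> \<le> (\<Sum>i\<in>(UNIV :: 'n set). B 0)" by (intro sum_mono g)
  finally show "norm (grad (\<lambda>z. u z s) y) \<le> real CARD('n) * B 0" by simp
  have "norm (hess (\<lambda>z. u z s) y) \<le> (\<Sum>i\<in>UNIV. norm (hess (\<lambda>z. u z s) y $ i))"
    unfolding norm_vec_def by (rule L2_set_le_sum) simp
  also have "\<dots> \<le> (\<Sum>i\<in>(UNIV :: 'n set). \<Sum>j\<in>(UNIV :: 'n set). B 1 * s powr (- 1 / real (flow_order F)))"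
    by (intro sum_mono order_trans[OF norm_le_l1_cart] h)
  finally show "norm (hess (\<lambda>z. u z s) y) \<le> real CARD('n) ^ 2 * B 1 * s powr (- 1 / real (flow_order F))"
    by (simp add: power2_eq_square mult_ac)
qed

text \<open>One majorant serves all functions with the same derivative bounds, in particular all dilations of
  a solution.\<close>

lemma duhamel_integrand_majorised:
  fixes x :: "real^'n::finite"
  assumes adm: "admissible_form F f" and t: "t > 0"
  shows "\<exists>M. set_integrable lborel (slab t) M \<and>
    (\<forall>u. slice_bounds F B u \<longrightarrow> (\<forall>y. \<forall>s\<in>{0<..<t}. \<bar>duhamel_integrand F f u x t y s\<bar> \<le> M (y, s)))"
proof -
  let ?a = "flow_order F"
  let ?h = "real CARD('n) ^ 2 * B 1"
  have "\<exists>C\<ge>0. \<forall>q H. norm q \<le> real CARD('n) * B 0 \<longrightarrow> \<bar>coeff_of f is q H\<bar> \<le> C * norm H ^ (?a - 1 - length is)"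
    if "is": "is \<in> kernel_orders F" for "is" :: "'n list"
  proof (rule homogeneous_jet_bound[OF homogeneous_jet_coeff_of[OF adm "is"]])
    show "0 < ?a - 1 - length is"
      using "is" by (cases F) (auto simp: kernel_orders_def)
  qed
  then obtain C where C: "\<And>is :: 'n list. is \<in> kernel_orders F \<Longrightarrow> C is \<ge> 0"
     "\<And>is q H. is \<in> kernel_orders F \<Longrightarrow> norm q \<le> real CARD('n) * B 0 \<Longrightarrow>
        \<bar>coeff_of f is q H\<bar> \<le> C is * norm H ^ (?a - 1 - length is)"
    by metis
  obtain D where D: "\<And>is :: 'n list. is \<in> kernel_orders F \<Longrightarrow> D is \<ge> 0"
     "\<And>is z. is \<in> kernel_orders F \<Longrightarrow> \<bar>partials is (kernel F 1) (z :: real^'n)\<bar> \<le> D is * cauchy_weight z"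
    using kernel_derivative_decay by metis
  define M where "M z = (\<Sum>is\<in>kernel_orders F. (D is * C is * ?h ^ (?a - 1 - length is)) *
      duhamel_majorant ?a (length is) (?a - 1 - length is) x t z)" for z :: "(real^'n) \<times> real"
  have "set_integrable lborel (slab t) M"
    unfolding M_def[abs_def]
  proof -
    have "set_integrable lborel (slab t) (\<lambda>z. (D is * C is * ?h ^ (?a - 1 - length is)) *
        duhamel_majorant ?a (length is) (?a - 1 - length is) x t z)" if "is \<in> kernel_orders F" for "is"
      using kernel_orders_less[OF that] flow_order_pos[of F]
      by (intro set_integrable_mult_right duhamel_majorant_integrable t) auto
    then show "set_integrable lborel (slab t) (\<lambda>z. \<Sum>is\<in>kernel_orders F. (D is * C is * ?h ^ (?a - 1 - length is)) *
        duhamel_majorant ?a (length is) (?a - 1 - length is) x t z)"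
      unfolding set_integrable_def scaleR_sum_right by (intro Bochner_Integration.integrable_sum)
  qed
  moreover have "\<bar>duhamel_integrand F f u x t y s\<bar> \<le> M (y, s)"
    if b: "slice_bounds F B u" and s: "s \<in> {0<..<t}" for u y s
  proof -
    define c where "c = (t - s) powr (- 1 / real ?a)"
    have "t - s > 0" using s by simp
    note c = inverse_root_time(1)[OF this, of F, folded c_def]
      and 1 = inverse_root_time(2)[OF this, of F, folded c_def]
    let ?q = "grad (\<lambda>z. u z s) y" and ?H = "hess (\<lambda>z. u z s) y"
    have s0: "s > 0" using s by simp
    have "\<bar>partials is (kernel F (t - s)) (x - y) * coeff_of f is ?q ?H\<bar>
        \<le> (D is * C is * ?h ^ (?a - 1 - length is)) * duhamel_majorant ?a (length is) (?a - 1 - length is) x t (y, s)"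
      if "is": "is \<in> kernel_orders F" for "is"
    proof -
      let ?d = "?a - 1 - length is"
      have "\<bar>partials is (kernel F (t - s)) (x - y)\<bar> = c ^ (CARD('n) + length is) * \<bar>partials is (kernel F 1) (c *\<^sub>R (x - y))\<bar>"
        unfolding partials_kernel_self_similar[OF c 1 "is"] using c by (simp add: abs_mult)
      also have "\<dots> \<le> c ^ (CARD('n) + length is) * (D is * cauchy_weight (c *\<^sub>R (x - y)))"
        using c by (intro mult_left_mono D(2)[OF "is"]) auto
      finally have k: "\<bar>partials is (kernel F (t - s)) (x - y)\<bar> \<le> c ^ (CARD('n) + length is) * (D is * cauchy_weight (c *\<^sub>R (x - y)))" .
      have "\<bar>coeff_of f is ?q ?H\<bar> \<le> C is * norm ?H ^ ?d"
        by (rule C(2)[OF "is" norm_grad_hess_le(1)[OF b s0]])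
      also have "\<dots> \<le> C is * (?h * s powr (- 1 / real ?a)) ^ ?d"
        by (intro mult_left_mono power_mono norm_grad_hess_le(2)[OF b s0] C(1)[OF "is"]) auto
      finally have v: "\<bar>coeff_of f is ?q ?H\<bar> \<le> C is * (?h * s powr (- 1 / real ?a)) ^ ?d" .
      have "\<bar>partials is (kernel F (t - s)) (x - y) * coeff_of f is ?q ?H\<bar>
        \<le> (c ^ (CARD('n) + length is) * (D is * cauchy_weight (c *\<^sub>R (x - y)))) * (C is * (?h * s powr (- 1 / real ?a)) ^ ?d)"
        unfolding abs_mult using c D(1)[OF "is"] less_imp_le[OF cauchy_weight_pos]
        by (intro mult_mono k v) (auto intro!: mult_nonneg_nonneg)
      also have "\<dots> = (D is * C is * ?h ^ ?d) * duhamel_majorant ?a (length is) ?d x t (y, s)"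
        by (simp add: duhamel_majorant_def c_def power_mult_distrib mult_ac)
      finally show ?thesis .
    qed
    then show ?thesis
      unfolding duhamel_integrand_eq_sum[OF adm] M_def
      by (intro order_trans[OF sum_abs] sum_mono)
  qed
  ultimately show ?thesis by blast
qed


section \<open>Compactness\<close>

lemma pointwise_convergent_from_dense:
  fixes g :: "nat \<Rightarrow> 'a::metric_space \<Rightarrow> real"
  assumes dense: "\<And>d. d > 0 \<Longrightarrow> \<exists>y\<in>D. dist y x < d"
    and conv: "\<And>y. y \<in> D \<Longrightarrow> convergent (\<lambda>n. g n y)"
    and equi: "\<And>e. e > 0 \<Longrightarrow> \<exists>d>0. \<forall>y\<in>D. dist y x < d \<longrightarrow> (\<forall>n. \<bar>g n y - g n x\<bar> \<le> e)"
  shows "convergent (\<lambda>n. g n x)"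
proof -
  have "Cauchy (\<lambda>n. g n x)"
  proof (rule metric_CauchyI)
    fix e :: real assume e: "e > 0"
    obtain d where d: "d > 0" "\<And>y n. y \<in> D \<Longrightarrow> dist y x < d \<Longrightarrow> \<bar>g n y - g n x\<bar> \<le> e / 4"
      using equi[of "e / 4"] e by (metis divide_pos_pos zero_less_numeral)
    obtain y where y: "y \<in> D" "dist y x < d" using dense[OF d(1)] by blast
    have "Cauchy (\<lambda>n. g n y)" using conv[OF y(1)] by (simp add: Cauchy_convergent_iff)
    then obtain M where M: "\<And>m n. m \<ge> M \<Longrightarrow> n \<ge> M \<Longrightarrow> dist (g m y) (g n y) < e / 4"
      using e metric_CauchyD[of _ "e / 4"] by (metis divide_pos_pos zero_less_numeral)
    show "\<exists>M. \<forall>m\<ge>M. \<forall>n\<ge>M. dist (g m x) (g n x) < e"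
    proof (intro exI allI impI)
      fix m n assume mn: "m \<ge> M" "n \<ge> M"
      show "dist (g m x) (g n x) < e"
        using M[OF mn] d(2)[OF y, of m] d(2)[OF y, of n] e unfolding dist_real_def by linarith
    qed
  qed
  then show ?thesis by (simp add: Cauchy_convergent_iff)
qed

lemma gradient_equicontinuous:
  fixes F :: flow and B :: "nat \<Rightarrow> real" and y :: "real^'n::finite"
  assumes s: "s > 0" and e: "e > 0"
  shows "\<exists>d>0. \<forall>y' s'. s' > 0 \<longrightarrow> dist (y', s') (y, s) < d \<longrightarrow>
    (\<forall>u i. slice_bounds F B u \<longrightarrow> time_bound B' u \<longrightarrow>
       \<bar>partial i (\<lambda>z. u z s') y' - partial i (\<lambda>z. u z s) y\<bar> \<le> e)"
proof -
  let ?a = "real (flow_order F)"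
  define L where "L = \<bar>B 1\<bar> * (s / 2) powr - (1 / ?a) * real CARD('n) + \<bar>B'\<bar> / (s / 2) + 1"
  have L: "L > 0" using s by (simp add: L_def add_nonneg_pos)
  \<comment> \<open>the first bound keeps all times above \<open>s / 2\<close>, where the derivative bounds are uniform\<close>
  define d where "d = min (s / 2) (e / L)"
  have d: "d > 0" using s e L by (simp add: d_def)
  have "\<bar>partial i (\<lambda>z. u z s') y' - partial i (\<lambda>z. u z s) y\<bar> \<le> e"
    if s': "s' > 0" and dd: "dist (y', s') (y, s) < d" and b: "slice_bounds F B u" and tb: "time_bound B' u"
    for y' s' u i
  proof -
    have dy: "norm (y' - y) \<le> d" and ds: "\<bar>s' - s\<bar> \<le> d"
      using dd dist_fst_le[of "(y', s')" "(y, s)"] dist_snd_le[of "(y', s')" "(y, s)"]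
      by (simp_all add: dist_norm dist_real_def)
    have "d \<le> s / 2" unfolding d_def by (rule min.cobounded1)
    then have s2: "s / 2 \<le> s'" using ds by linarith
    have sm: "axis_smooth (\<lambda>z. u z s')" using b s' unfolding slice_bounds_def by blast
    have bd: "\<bar>partial j (partial i (\<lambda>z. u z s')) x\<bar> \<le> \<bar>B 1\<bar> * (s / 2) powr - (1 / ?a)" for j x
    proof -
      have "\<bar>partials ([j] @ [i]) (\<lambda>z. u z s') x\<bar> \<le> B (length [j]) * s' powr - (real (length [j]) / ?a)"
        using b s' unfolding slice_bounds_def by blast
      then have "\<bar>partial j (partial i (\<lambda>z. u z s')) x\<bar> \<le> B 1 * s' powr - (1 / ?a)" by simp
      also have "\<dots> \<le> \<bar>B 1\<bar> * (s / 2) powr - (1 / ?a)"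
        using s s2 by (intro mult_mono powr_mono2') auto
      finally show ?thesis .
    qed
    have "\<bar>partial i (\<lambda>z. u z s') y' - partial i (\<lambda>z. u z s') y\<bar> \<le> (\<bar>B 1\<bar> * (s / 2) powr - (1 / ?a)) * real CARD('n) * norm (y' - y)"
    proof (rule bounded_partials_imp_lipschitz[OF _ bd])
      show "partially_differentiable j (partial i (\<lambda>z. u z s')) x" for j x
        using axis_smoothD[OF sm, of "[i]" x j] by simp
    qed
    also have "\<dots> \<le> (\<bar>B 1\<bar> * (s / 2) powr - (1 / ?a)) * real CARD('n) * d"
      by (intro mult_left_mono dy) auto
    finally have 1: "\<bar>partial i (\<lambda>z. u z s') y' - partial i (\<lambda>z. u z s') y\<bar> \<le> (\<bar>B 1\<bar> * (s / 2) powr - (1 / ?a)) * real CARD('n) * d" .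
    have "\<exists>D. ((\<lambda>r. partial i (\<lambda>z. u z r) y) has_real_derivative D) (at r) \<and> \<bar>D\<bar> \<le> \<bar>B'\<bar> / (s / 2)"
      if r: "r \<in> {s / 2..}" for r
    proof -
      have r0: "r > 0" using r s by simp
      obtain D where D: "((\<lambda>r. partial i (\<lambda>z. u z r) y) has_real_derivative D) (at r)" "\<bar>D\<bar> * r \<le> B'"
        using tb r0 unfolding time_bound_def by blast
      have "\<bar>D\<bar> * (s / 2) \<le> \<bar>D\<bar> * r" using r by (intro mult_left_mono) auto
      also have "\<dots> \<le> \<bar>B'\<bar>" using D(2) by linarith
      finally have "\<bar>D\<bar> \<le> \<bar>B'\<bar> / (s / 2)" using s by (simp add: pos_le_divide_eq)
      then show ?thesis using D(1) by blast
    qed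
    then obtain D where D: "\<And>r. r \<in> {s / 2..} \<Longrightarrow> ((\<lambda>r. partial i (\<lambda>z. u z r) y) has_real_derivative D r) (at r)"
        "\<And>r. r \<in> {s / 2..} \<Longrightarrow> \<bar>D r\<bar> \<le> \<bar>B'\<bar> / (s / 2)" by metis
    have "norm (partial i (\<lambda>z. u z s') y - partial i (\<lambda>z. u z s) y) \<le> \<bar>B'\<bar> / (s / 2) * norm (s' - s)"
      by (rule field_differentiable_bound[of "{s / 2..}" _ D])
         (use D s s2 in \<open>auto intro: DERIV_subset\<close>)
    also have "\<dots> \<le> \<bar>B'\<bar> / (s / 2) * d"
      using ds s by (intro mult_left_mono) auto
    finally have 2: "\<bar>partial i (\<lambda>z. u z s') y - partial i (\<lambda>z. u z s) y\<bar> \<le> \<bar>B'\<bar> / (s / 2) * d" by simp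
    have "\<bar>partial i (\<lambda>z. u z s') y' - partial i (\<lambda>z. u z s) y\<bar>
        \<le> (\<bar>B 1\<bar> * (s / 2) powr - (1 / ?a)) * real CARD('n) * d + \<bar>B'\<bar> / (s / 2) * d"
      using 1 2 by linarith
    also have "\<dots> \<le> L * d" using d by (simp add: L_def algebra_simps)
    also have "\<dots> \<le> L * (e / L)" using L by (intro mult_left_mono) (auto simp: d_def)
    also have "\<dots> = e" using L by simp
    finally show ?thesis .
  qed
  then show ?thesis using d by blast
qed

text \<open>Arzela-Ascoli in its pointwise form: a diagonal subsequence converges on a countable dense set,
  and equicontinuity carries this to all points. The gradients are used because, unlike the
  functions themselves, they are bounded uniformly.\<close>

lemma gradient_convergent_subsequence:
  fixes w :: "nat \<Rightarrow> real^'n::finite \<Rightarrow> real \<Rightarrow> real"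
  assumes sb: "\<And>n. slice_bounds F B (w n)" and tb: "\<And>n. time_bound B' (w n)"
  obtains k where "strict_mono (k :: nat \<Rightarrow> nat)"
    "\<And>i y s. s > 0 \<Longrightarrow> convergent (\<lambda>n. partial i (\<lambda>z. w (k n) z s) y)"
proof -
  obtain D :: "((real^'n) \<times> real) set" where D: "countable D" "\<And>X. open X \<Longrightarrow> X \<noteq> {} \<Longrightarrow> \<exists>d\<in>D. d \<in> X"
    using countable_dense_exists by blast
  let ?S = "(UNIV :: 'n set) \<times> (D \<inter> UNIV \<times> {0<..})"
  let ?g = "\<lambda>n (i, y, s). partial i (\<lambda>z. w n z s) y"
  have bd: "norm (?g n p) \<le> B 0" if "p \<in> ?S" for n p
  proof -
    obtain i y s where p0: "p = (i, y, s)" by (cases p)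
    then have p: "p = (i, y, s)" "s > 0" using that by auto
    have "\<bar>partials ([] @ [i]) (\<lambda>z. w n z s) y\<bar> \<le> B (length ([] :: 'n list)) * s powr - (real (length ([] :: 'n list)) / real (flow_order F))"
      using sb p(2) unfolding slice_bounds_def by blast
    then show ?thesis using p by simp
  qed
  have "countable ?S" using D(1) by (intro countable_SIGMA) (auto intro: countable_finite)
  then obtain k where k: "strict_mono (k :: nat \<Rightarrow> nat)" "\<And>p. p \<in> ?S \<Longrightarrow> \<exists>l. (\<lambda>n. ?g (k n) p) \<longlonglongrightarrow> l"
    using function_convergent_subsequence[of ?S ?g "B 0"] bd by blast
  have "convergent (\<lambda>n. partial i (\<lambda>z. w (k n) z s) y)" if s: "s > 0" for i y s
  proof -
    have "convergent (\<lambda>n. (\<lambda>(y, s). partial i (\<lambda>z. w (k n) z s) y) (y, s))"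
    proof (rule pointwise_convergent_from_dense[where D = "D \<inter> UNIV \<times> {0<..}"])
      fix d :: real assume d: "d > 0"
      have "open (ball (y, s) d \<inter> UNIV \<times> {0<..})" by (intro open_Int open_ball open_Times) auto
      moreover have "(y, s) \<in> ball (y, s) d \<inter> UNIV \<times> {0<..}" using s d by simp
      ultimately obtain z where "z \<in> D" "z \<in> ball (y, s) d \<inter> UNIV \<times> {0<..}" using D(2) by blast
      then show "\<exists>z\<in>D \<inter> UNIV \<times> {0<..}. dist z (y, s) < d" by (auto simp: dist_commute)
    next
      fix z assume "z \<in> D \<inter> UNIV \<times> {0<..}"
      then show "convergent (\<lambda>n. (\<lambda>(y, s). partial i (\<lambda>z. w (k n) z s) y) z)"
        using k(2)[of "(i, z)"] by (auto simp: convergent_def)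
    next
      fix e :: real assume e: "e > 0"
      show "\<exists>d>0. \<forall>z\<in>D \<inter> UNIV \<times> {0<..}. dist z (y, s) < d \<longrightarrow>
          (\<forall>n. \<bar>(\<lambda>(y, s). partial i (\<lambda>z. w (k n) z s) y) z - (\<lambda>(y, s). partial i (\<lambda>z. w (k n) z s) y) (y, s)\<bar> \<le> e)"
        using gradient_equicontinuous[OF s e, of y F B B'] sb tb by fastforce
    qed
    then show ?thesis by simp
  qed
  then show ?thesis using that k(1) by blast
qed

lemma slice_bounds_C_class:
  fixes u :: "real^'n::finite \<Rightarrow> real \<Rightarrow> real"
  assumes b: "slice_bounds F B u" and t: "t > 0"
  shows "C_class k (\<lambda>x. u x t)"
proof -
  have sm: "axis_smooth (\<lambda>x. u x t)" using b t unfolding slice_bounds_def by blast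
  have "continuous_on UNIV (partials is (\<lambda>x. u x t))" for "is" :: "'n list"
  proof (rule bounded_partials_imp_continuous[OF axis_smoothD[OF sm]])
    fix i x
    define js where "js = butlast (i # is)"
    define j where "j = last (i # is)"
    have js: "i # is = js @ [j]" unfolding js_def j_def by (metis append_butlast_last_id list.distinct(1))
    have "length js = length is" by (simp add: js_def)
    then have "\<bar>partials (i # is) (\<lambda>x. u x t) x\<bar> \<le> B (length is) * t powr - (real (length is) / real (flow_order F))"
      using b t unfolding slice_bounds_def js by metis
    then show "\<bar>partial i (partials is (\<lambda>x. u x t)) x\<bar> \<le> B (length is) * t powr - (real (length is) / real (flow_order F))"
      by simp
  qed
  then show ?thesis using axis_smoothD[OF sm] unfolding C_class_def by blast
qed

lemma slice_bounds_partials: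
  assumes b: "slice_bounds F B u" and t: "t > 0" and ne: "is \<noteq> []"
  shows "\<bar>partials is (\<lambda>z. u z t) x\<bar> \<le> B (length is - 1) * t powr - (real (length is - 1) / real (flow_order F))"
proof -
  have js: "is = butlast is @ [last is]" using ne by simp
  have "\<bar>partials (butlast is @ [last is]) (\<lambda>z. u z t) x\<bar>
      \<le> B (length (butlast is)) * t powr - (real (length (butlast is)) / real (flow_order F))"
    using b t unfolding slice_bounds_def by blast
  then show ?thesis using ne by simp
qed

text \<open>Convergence of the gradients gives convergence of the second derivatives, hence of the Duhamel
  integrands, hence, by dominated convergence and the integral equation, of the functions
  themselves. Only then is the limit known as a function, and its derivatives are the limits found
  before. The linear part \<open>a\<close> is kept abstract: of the data, only its limit matters.\<close>

lemma limit_is_mild_solution: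
  fixes w :: "nat \<Rightarrow> real^'n::finite \<Rightarrow> real \<Rightarrow> real"
  assumes adm: "admissible_form F f"
    and sb: "\<And>n. slice_bounds F B (w n)"
    and conv: "\<And>i y s. s > 0 \<Longrightarrow> convergent (\<lambda>n. partial i (\<lambda>z. w n z s) y)"
    and int: "\<And>n x t. t > 0 \<Longrightarrow> set_integrable lborel (slab t) (\<lambda>(y, s). duhamel_integrand F f (w n) x t y s)"
    and eq: "\<And>n x t. t > 0 \<Longrightarrow> w n x t = a n x t
      + (LINT z:slab t|lborel. (\<lambda>(y, s). duhamel_integrand F f (w n) x t y s) z)"
    and v0: "\<And>x t. t > 0 \<Longrightarrow> integrable lebesgue (\<lambda>y. kernel F t (x - y) * v0 y)"
    and lin: "\<And>x t. t > 0 \<Longrightarrow> (\<lambda>n. a n x t) \<longlonglongrightarrow> (LINT y|lebesgue. kernel F t (x - y) * v0 y)"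
  shows "\<exists>W. mild_solution F f v0 W \<and> slice_bounds F B W \<and>
    (\<forall>t>0. \<forall>is x. (\<lambda>n. partials is (\<lambda>z. w n z t) x) \<longlonglongrightarrow> partials is (\<lambda>z. W z t) x)"
proof -
  have sm: "axis_smooth (\<lambda>z. w n z s)" if "s > 0" for n s using sb that unfolding slice_bounds_def by blast
  have bdd: "\<exists>B'. \<forall>n x. \<bar>partials is (\<lambda>z. w n z s) x\<bar> \<le> B'" if "s > 0" "is \<noteq> []" for s and "is" :: "'n list"
    using slice_bounds_partials[OF sb that] by blast
  define g where "g i s y = lim (\<lambda>n. partial i (\<lambda>z. w n z s) y)" for i s y
  have g: "(\<lambda>n. partial i (\<lambda>z. w n z s) y) \<longlonglongrightarrow> g i s y" if "s > 0" for i s y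
    unfolding g_def using conv[OF that] by (simp add: convergent_LIMSEQ_iff)
  have gp: "(\<lambda>n. partials is (partial i (\<lambda>z. w n z s)) y) \<longlonglongrightarrow> partials is (g i s) y" if s: "s > 0" for i s y "is"
  proof (rule partials_of_pointwise_limit(2))
    show "axis_smooth (partial i (\<lambda>z. w n z s))" for n
      using axis_smooth_partials[OF sm[OF s], of "[i]"] by simp
    show "\<exists>B'. \<forall>n x. \<bar>partials js (partial i (\<lambda>z. w n z s)) x\<bar> \<le> B'" for js
      using bdd[OF s, of "js @ [i]"] by (simp add: partials_append)
  qed (rule g[OF s])
  define q where "q s y = (\<chi> i. g i s y)" for s y
  define H where "H s y = (\<chi> i j. partial i (g j s) y)" for s y
  have q: "(\<lambda>n. grad (\<lambda>z. w n z s) y) \<longlonglongrightarrow> q s y" if "s > 0" for s y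
    unfolding q_def by (rule vec_tendstoI) (use g[OF that] in \<open>simp add: grad_def\<close>)
  have H: "(\<lambda>n. hess (\<lambda>z. w n z s) y) \<longlonglongrightarrow> H s y" if "s > 0" for s y
    unfolding H_def
  proof (intro vec_tendstoI)
    fix i j
    show "(\<lambda>n. hess (\<lambda>z. w n z s) y $ i $ j) \<longlonglongrightarrow> (\<chi> i j. partial i (g j s) y) $ i $ j"
      using gp[OF that, of "[i]" j y] by (simp add: hess_def)
  qed
  define E where "E x t y s = (\<Sum>is\<in>kernel_orders F. partials is (kernel F (t - s)) (x - y) * coeff_of f is (q s y) (H s y))" for x t y s
  have E: "(\<lambda>n. duhamel_integrand F f (w n) x t y s) \<longlonglongrightarrow> E x t y s" if s: "s > 0" for x t y s
    unfolding duhamel_integrand_eq_sum[OF adm] E_def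
  proof (intro tendsto_sum tendsto_mult tendsto_const)
    fix "is" :: "'n list" assume "is": "is \<in> kernel_orders F"
    have "continuous_on UNIV (\<lambda>z. coeff_of f is (fst z) (snd z))"
      using homogeneous_jet_coeff_of[OF adm "is"] unfolding homogeneous_jet_def by blast
    from continuous_on_tendsto_compose[OF this tendsto_Pair[OF q[OF s, of y] H[OF s, of y]]]
    show "(\<lambda>n. coeff_of f is (grad (\<lambda>z. w n z s) y) (hess (\<lambda>z. w n z s) y)) \<longlonglongrightarrow> coeff_of f is (q s y) (H s y)"
      by simp
  qed
  have dct: "set_integrable lborel (slab t) (\<lambda>(y, s). E x t y s)"
    "(\<lambda>n. LINT z:slab t|lborel. (\<lambda>(y, s). duhamel_integrand F f (w n) x t y s) z)
      \<longlonglongrightarrow> (LINT z:slab t|lborel. (\<lambda>(y, s). E x t y s) z)" if t: "t > 0" for x t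
  proof -
    obtain M where M: "set_integrable lborel (slab t) M"
      "\<And>u y s. slice_bounds F B u \<Longrightarrow> s \<in> {0<..<t} \<Longrightarrow> \<bar>duhamel_integrand F f u x t y s\<bar> \<le> M (y, s)"
      using duhamel_integrand_majorised[OF adm t, of B x] by blast
    let ?I = "\<lambda>z. indicat_real (slab t) (z :: (real^'n) \<times> real)"
    have m: "(\<lambda>z. ?I z *\<^sub>R (\<lambda>(y, s). duhamel_integrand F f (w n) x t y s) z) \<in> borel_measurable lborel" for n
      using int[OF t] unfolding set_integrable_def by (rule borel_measurable_integrable)
    have l: "(\<lambda>n. ?I z *\<^sub>R (\<lambda>(y, s). duhamel_integrand F f (w n) x t y s) z) \<longlonglongrightarrow> ?I z *\<^sub>R (\<lambda>(y, s). E x t y s) z" for z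
    proof (cases z)
      case (Pair y s)
      show ?thesis
      proof (cases "0 < s")
        case True
        then show ?thesis unfolding Pair prod.case by (intro tendsto_scaleR tendsto_const E)
      qed (simp add: Pair)
    qed
    have mE: "(\<lambda>z. ?I z *\<^sub>R (\<lambda>(y, s). E x t y s) z) \<in> borel_measurable lborel"
      by (rule borel_measurable_LIMSEQ_metric[OF m l])
    have bound: "norm (?I z *\<^sub>R (\<lambda>(y, s). duhamel_integrand F f (w n) x t y s) z) \<le> ?I z *\<^sub>R M z" for n z
      using M(2)[OF sb] by (cases z) (auto simp: indicator_def)
    note prems = mE m M(1)[unfolded set_integrable_def] AE_I2[OF l] AE_I2[OF bound]
    show "set_integrable lborel (slab t) (\<lambda>(y, s). E x t y s)"
      unfolding set_integrable_def by (rule integrable_dominated_convergence[OF prems])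
    show "(\<lambda>n. LINT z:slab t|lborel. (\<lambda>(y, s). duhamel_integrand F f (w n) x t y s) z)
      \<longlonglongrightarrow> (LINT z:slab t|lborel. (\<lambda>(y, s). E x t y s) z)"
      unfolding set_lebesgue_integral_def by (rule integral_dominated_convergence[OF prems])
  qed
  define W where "W x t = (if t > 0 then (LINT y|lebesgue. kernel F t (x - y) * v0 y)
      + (LINT z:slab t|lborel. (\<lambda>(y, s). E x t y s) z) else v0 x)" for x t
  have W: "(\<lambda>n. w n x t) \<longlonglongrightarrow> W x t" if t: "t > 0" for x t
    unfolding eq[OF t] W_def using t by (simp del: split_beta) (intro tendsto_add lin dct(2) t)
  have Wp: "axis_smooth (\<lambda>z. W z t)" "(\<lambda>n. partials is (\<lambda>z. w n z t) x) \<longlonglongrightarrow> partials is (\<lambda>z. W z t) x"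
    if t: "t > 0" for t "is" x
    using partials_of_pointwise_limit[OF sm[OF t] bdd[OF t] W[OF t]] by blast+
  have sbW: "slice_bounds F B W"
    unfolding slice_bounds_def
  proof (intro conjI allI impI)
    fix t :: real assume t: "t > 0"
    show "axis_smooth (\<lambda>x. W x t)" by (rule Wp(1)[OF t])
    fix \<gamma> :: "'n list" and i x
    show "\<bar>partials (\<gamma> @ [i]) (\<lambda>z. W z t) x\<bar> \<le> B (length \<gamma>) * t powr - (real (length \<gamma>) / real (flow_order F))"
    proof (rule LIMSEQ_le_const2)
      show "(\<lambda>n. \<bar>partials (\<gamma> @ [i]) (\<lambda>z. w n z t) x\<bar>) \<longlonglongrightarrow> \<bar>partials (\<gamma> @ [i]) (\<lambda>z. W z t) x\<bar>"
        by (intro tendsto_rabs Wp(2) t)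
      show "\<exists>N. \<forall>n\<ge>N. \<bar>partials (\<gamma> @ [i]) (\<lambda>z. w n z t) x\<bar> \<le> B (length \<gamma>) * t powr - (real (length \<gamma>) / real (flow_order F))"
        using sb t unfolding slice_bounds_def by blast
    qed
  qed
  have "E x t y s = duhamel_integrand F f W x t y s" if s: "s > 0" for x t y s
  proof -
    have "(\<lambda>n. grad (\<lambda>z. w n z s) y) \<longlonglongrightarrow> grad (\<lambda>z. W z s) y"
      by (rule vec_tendstoI) (use Wp(2)[OF s] in \<open>simp only: grad_component\<close>)
    then have qs: "q s y = grad (\<lambda>z. W z s) y" using q[OF s] LIMSEQ_unique by blast
    have "(\<lambda>n. hess (\<lambda>z. w n z s) y) \<longlonglongrightarrow> hess (\<lambda>z. W z s) y"
      by (intro vec_tendstoI) (use Wp(2)[OF s] in \<open>simp only: hess_component\<close>)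
    then have "H s y = hess (\<lambda>z. W z s) y" using H[OF s] LIMSEQ_unique by blast
    then show ?thesis unfolding duhamel_integrand_eq_sum[OF adm] E_def qs by simp
  qed
  then have ED: "indicat_real (slab t) z *\<^sub>R (\<lambda>(y, s). E x t y s) z
      = indicat_real (slab t) z *\<^sub>R (\<lambda>(y, s). duhamel_integrand F f W x t y s) z" for x t z
    by (cases z) (auto simp: indicator_def)
  have intW: "set_integrable lborel (slab t) (\<lambda>(y, s). duhamel_integrand F f W x t y s)" if "t > 0" for x t
    using dct(1)[OF that, of x] unfolding set_integrable_def ED .
  have "mild_solution F f v0 W"
    unfolding mild_solution_def
  proof (intro conjI allI impI)
    show "W x 0 = v0 x" for x by (simp add: W_def)
    fix t :: real assume t: "t > 0"
    show "C_class 2 (\<lambda>x. W x t)" by (rule slice_bounds_C_class[OF sbW t])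
    fix x
    show "integrable lebesgue (\<lambda>y. kernel F t (x - y) * v0 y)" by (rule v0[OF t])
    show "set_integrable lborel (slab t) (\<lambda>(y, s). duhamel_integrand F f W x t y s)" by (rule intW[OF t])
    show "W x t = (LINT y|lebesgue. kernel F t (x - y) * v0 y)
        + (LINT s:{0<..<t}|lborel. (LINT y|lborel. duhamel_integrand F f W x t y s))"
    proof -
      have "(LINT z:slab t|lborel. (\<lambda>(y, s). E x t y s) z)
          = (LINT z:slab t|lborel. (\<lambda>(y, s). duhamel_integrand F f W x t y s) z)"
        unfolding set_lebesgue_integral_def ED ..
      then show ?thesis
        unfolding duhamel_iterated_eq_joint[OF intW[OF t]] using t by (simp only: W_def[of x t] if_True)
    qed
  qed
  then show ?thesis using sbW Wp(2) by blast
qed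


section \<open>Lower semicontinuity of the solution norm\<close>

text \<open>A set where a continuous function exceeds a level is open, hence empty if it is negligible.\<close>

lemma le_Linf_norm_continuous:
  fixes f :: "'a::euclidean_space \<Rightarrow> 'b::real_normed_vector"
  assumes "continuous_on UNIV f"
  shows "ennreal (norm (f x)) \<le> Linf_norm f"
proof (rule ccontr)
  assume neg: "\<not> ennreal (norm (f x)) \<le> Linf_norm f"
  then have "Linf_norm f < \<infinity>"
    by (metis infinity_ennreal_def not_le_imp_less ennreal_less_top less_trans)
  then obtain a where a: "Linf_norm f = ennreal a" "a \<ge> 0"
    by (cases "Linf_norm f") auto
  let ?U = "{y. a < norm (f y)}"
  have oU: "open ?U" using assms by (intro open_Collect_less continuous_intros)
  have "x \<in> ?U" using neg a by (simp add: ennreal_le_iff not_le)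
  with oU have nn: "\<not> negligible ?U" using open_not_negligible by blast
  have "AE y in lebesgue. y \<notin> ?U"
    using Linf_norm_AE[of f] a by (simp add: ennreal_le_iff not_less)
  moreover have "?U \<in> sets lebesgue"
    using oU by (intro sets_completionI_sets) (simp add: borel_open)
  ultimately have "negligible ?U"
    unfolding negligible_iff_null_sets by (simp only: AE_iff_null_sets)
  then show False using nn by blast
qed

lemma Linf_norm_le:
  fixes f :: "'a::euclidean_space \<Rightarrow> 'b::euclidean_space"
  assumes "continuous_on UNIV f" "\<And>x. ennreal (norm (f x)) \<le> c"
  shows "Linf_norm f \<le> c"
  unfolding Linf_norm_def
proof (rule esssup_I)
  have "f \<in> borel_measurable lebesgue"
    using borel_measurable_continuous_onI[OF assms(1)] by (simp add: measurable_completion)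
  then show "(\<lambda>x. ennreal (norm (f x))) \<in> borel_measurable lebesgue" by measurable
qed (use assms(2) in simp)

text \<open>Removes the root from the second half of the norm; in this form scaling and Fatou's lemma apply
  directly.\<close>

lemma Lp_norm_le_iff:
  assumes p: "p > 0" and R: "R > 0" and c: "c \<ge> 0"
  shows "ennreal (R powr (2 / p)) * Lp_norm p S f \<le> ennreal c \<longleftrightarrow>
    (\<integral>\<^sup>+z\<in>S. ennreal (norm (f z) powr p) \<partial>lebesgue) \<le> ennreal (c powr p * R powr -2)"
proof -
  let ?I = "\<integral>\<^sup>+z\<in>S. ennreal (norm (f z) powr p) \<partial>lebesgue"
  show ?thesis
  proof (cases "?I = \<infinity>")
    case True
    then have "Lp_norm p S f = \<infinity>" by (simp add: Lp_norm_def Let_def)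
    then show ?thesis using True R by (simp add: ennreal_mult_top top_unique)
  next
    case False
    then obtain i where i: "?I = ennreal i" "i \<ge> 0" by (cases ?I) auto
    have L: "Lp_norm p S f = ennreal (i powr (1 / p))" using i by (simp add: Lp_norm_def Let_def)
    have "ennreal (R powr (2 / p)) * Lp_norm p S f \<le> ennreal c \<longleftrightarrow> R powr (2 / p) * i powr (1 / p) \<le> c"
      unfolding L using c by (simp add: ennreal_mult[symmetric])
    also have "\<dots> \<longleftrightarrow> (R powr (2 / p) * i powr (1 / p)) powr p \<le> c powr p"
    proof
      show "R powr (2 / p) * i powr (1 / p) \<le> c \<Longrightarrow> (R powr (2 / p) * i powr (1 / p)) powr p \<le> c powr p"
        using p by (intro powr_mono2) auto
      show "(R powr (2 / p) * i powr (1 / p)) powr p \<le> c powr p \<Longrightarrow> R powr (2 / p) * i powr (1 / p) \<le> c"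
        using powr_less_mono2[OF p c, of "R powr (2 / p) * i powr (1 / p)"] by linarith
    qed
    also have "(R powr (2 / p) * i powr (1 / p)) powr p = R powr 2 * i"
      using p R i by (simp add: powr_mult powr_powr)
    also have "R powr 2 * i \<le> c powr p \<longleftrightarrow> i \<le> c powr p * R powr -2"
      using R by (simp add: powr_minus field_simps)
    also have "\<dots> \<longleftrightarrow> ?I \<le> ennreal (c powr p * R powr -2)" unfolding i(1) by simp
    finally show ?thesis .
  qed
qed

text \<open>The norm is invariant under dilations, which act on the parabolic cylinders by \<open>(x, R) \<mapsto> (l x, l R)\<close>,
  and lower semicontinuous under pointwise convergence of the derivatives: the gradient bound holds
  at every point by continuity, and Fatou's lemma handles the integrals over the cylinders.\<close>

lemma X_norm_limit_le:
  fixes u W :: "real^'n::finite \<Rightarrow> real \<Rightarrow> real" and l :: "nat \<Rightarrow> real"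
  assumes u: "u \<in> X_ball F r"
    and sb: "slice_bounds F B u" "slice_bounds F B W" and l: "\<And>n. l n > 0"
    and lim: "\<And>t is x. t > 0 \<Longrightarrow> (\<lambda>n. partials is (\<lambda>z. dilate F (l n) u z t) x) \<longlonglongrightarrow> partials is (\<lambda>z. W z t) x"
  shows "W \<in> X_ball F r"
proof -
  let ?a = "flow_order F"
  let ?p = "real (CARD('n) + 2 + ?a)"
  have sm: "axis_smooth (\<lambda>z. u z t)" if "t > 0" for t using sb that unfolding slice_bounds_def by blast
  have gl: "(\<lambda>n. grad (\<lambda>z. dilate F (l n) u z t) x) \<longlonglongrightarrow> grad (\<lambda>z. W z t) x" if "t > 0" for t x
    by (rule vec_tendstoI) (use lim[OF that] in \<open>simp only: grad_component\<close>)
  have hl: "(\<lambda>n. hess (\<lambda>z. dilate F (l n) u z t) x) \<longlonglongrightarrow> hess (\<lambda>z. W z t) x" if "t > 0" for t x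
    by (intro vec_tendstoI) (use lim[OF that] in \<open>simp only: hess_component\<close>)
  have ld: "l n ^ ?a * t > 0" if "t > 0" for n t using l that by simp
  have gd: "grad (\<lambda>z. dilate F (l n) u z t) x = grad (\<lambda>z. u z (l n ^ ?a * t)) (l n *\<^sub>R x)" if "t > 0" for n t x
    using grad_dilate[where u = u and l = "l n" and F = F and t = t, OF sm[OF ld[OF that]] l] .
  have hd: "hess (\<lambda>z. dilate F (l n) u z t) x = l n *\<^sub>R hess (\<lambda>z. u z (l n ^ ?a * t)) (l n *\<^sub>R x)" if "t > 0" for n t x
    using hess_dilate[where u = u and l = "l n" and F = F and t = t, OF sm[OF ld[OF that]] l] .
  have cg: "continuous_on UNIV (grad (\<lambda>z. w z t))" if "t > 0" "slice_bounds F B w" for t and w :: "real^'n \<Rightarrow> real \<Rightarrow> real"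
  proof -
    have "continuous_on UNIV (partials [i] (\<lambda>z. w z t))" for i
      using slice_bounds_C_class[OF that(2,1), of 1] unfolding C_class_def by (metis One_nat_def length_Cons list.size(3) order_refl)
    then show ?thesis unfolding grad_def[abs_def] by (intro continuous_on_vec_lambda) simp
  qed
  let ?A = "SUP t\<in>{0<..}. Linf_norm (grad (\<lambda>x. u x t))"
  define T where "T w x R = ennreal (R powr (2 / ?p)) * Lp_norm ?p (ball x R \<times> {R ^ ?a / 2<..<R ^ ?a}) (\<lambda>(y, s). hess (\<lambda>z. w z s) y)"
    for w :: "real^'n \<Rightarrow> real \<Rightarrow> real" and x R
  let ?S = "SUP x. SUP R\<in>{0<..}. T u x R"
  have Xu: "X_norm F u = ?A + ?S" "X_norm F W = (SUP t\<in>{0<..}. Linf_norm (grad (\<lambda>x. W x t))) + (SUP x. SUP R\<in>{0<..}. T W x R)"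
    unfolding X_norm_def Let_def T_def by simp_all
  have A: "Linf_norm (grad (\<lambda>x. W x t)) \<le> ?A" if t: "t > 0" for t
  proof (rule Linf_norm_le[OF cg[OF t sb(2)]])
    fix x
    show "ennreal (norm (grad (\<lambda>x. W x t) x)) \<le> ?A"
    proof (rule LIMSEQ_le_const2)
      show "(\<lambda>n. ennreal (norm (grad (\<lambda>z. dilate F (l n) u z t) x))) \<longlonglongrightarrow> ennreal (norm (grad (\<lambda>x. W x t) x))"
        by (intro tendsto_ennrealI tendsto_norm gl t)
      have "ennreal (norm (grad (\<lambda>z. dilate F (l n) u z t) x)) \<le> ?A" for n
        unfolding gd[OF t]
        by (rule order_trans[OF le_Linf_norm_continuous[OF cg[OF ld[OF t] sb(1)]]])
           (use ld[OF t] in \<open>auto intro: SUP_upper\<close>)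
      then show "\<exists>N. \<forall>n\<ge>N. ennreal (norm (grad (\<lambda>z. dilate F (l n) u z t) x)) \<le> ?A" by blast
    qed
  qed
  let ?U = "UNIV \<times> {0<..} :: ((real^'n) \<times> real) set"
  \<comment> \<open>the Hessian is known to be measurable only at positive times\<close>
  define h where "h w = (\<lambda>z. indicat_real ?U z *\<^sub>R (\<lambda>(y, s). hess (\<lambda>z. w z s) y) z)" for w :: "real^'n \<Rightarrow> real \<Rightarrow> real"
  have hu: "h u \<in> borel_measurable lebesgue"
    using u unfolding X_ball_def set_borel_measurable_def h_def by blast
  have hdil: "h (dilate F (l n) u) z = l n *\<^sub>R h u (par_dil ?a (l n) z)" for n z
  proof (cases z)
    case (Pair y s)
    have "(l n ^ ?a * s > 0) = (s > 0)" using mult_less_cancel_left_pos[of "l n ^ ?a" 0 s] l[of n] by simp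
    then show ?thesis using hd[of s n y] by (simp add: Pair h_def par_dil_def indicator_def)
  qed
  have hdm: "h (dilate F (l n) u) \<in> borel_measurable lebesgue" for n
  proof -
    have "(\<lambda>z. l n *\<^sub>R h u (par_dil ?a (l n) z)) \<in> borel_measurable lebesgue"
      by (intro borel_measurable_scaleR borel_measurable_const measurable_compose[OF lebesgue_par_dil(2)[OF l] hu])
    then show ?thesis by (simp add: hdil[abs_def])
  qed
  have hlim: "(\<lambda>n. h (dilate F (l n) u) z) \<longlonglongrightarrow> h W z" for z
  proof (cases z)
    case (Pair y s)
    then show ?thesis using hl[of s y] by (cases "s > 0") (simp_all add: h_def)
  qed
  have hW: "h W \<in> borel_measurable lebesgue"
    by (rule borel_measurable_LIMSEQ_metric[OF hdm hlim])
  define Q where "Q x R = ball x R \<times> {R ^ ?a / 2<..<R ^ ?a}" for x :: "real^'n" and R :: real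
  have Qm: "Q x R \<in> sets lebesgue" for x R
    unfolding Q_def by (intro sets_completionI_sets) (simp, intro borel_open open_Times, auto)
  define I where "I w x R = (\<integral>\<^sup>+z. ennreal (norm (h w z) powr ?p) * indicator (Q x R) z \<partial>lebesgue)" for w :: "real^'n \<Rightarrow> real \<Rightarrow> real" and x R
  have Ieq: "(\<integral>\<^sup>+z\<in>Q x R. ennreal (norm ((\<lambda>(y, s). hess (\<lambda>z. w z s) y) z) powr ?p) \<partial>lebesgue) = I w x R"
    if R: "R > 0" for w x R
    unfolding I_def
  proof (intro nn_integral_cong)
    fix z
    have "R ^ ?a > 0" using R by simp
    then have "z \<in> Q x R \<Longrightarrow> z \<in> ?U" by (cases z) (auto simp: Q_def)
    then show "ennreal (norm ((\<lambda>(y, s). hess (\<lambda>z. w z s) y) z) powr ?p) * indicator (Q x R) z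
        = ennreal (norm (h w z) powr ?p) * indicator (Q x R) z"
      by (cases "z \<in> Q x R") (auto simp: h_def)
  qed
  have T_iff: "T w x R \<le> ennreal c \<longleftrightarrow> I w x R \<le> ennreal (c powr ?p * R powr -2)" if "R > 0" "c \<ge> 0" for w x R c
    unfolding T_def Ieq[OF that(1), symmetric] Q_def using that by (intro Lp_norm_le_iff) auto
  have S: "T W x R \<le> ?S" if R: "R > 0" for x R
  proof (cases "?S = \<infinity>")
    case False
    then obtain c where c: "?S = ennreal c" "c \<ge> 0" by (cases ?S) auto
    have Iu: "I u y r \<le> ennreal (c powr ?p * r powr -2)" if "r > 0" for y r
    proof -
      have "T u y r \<le> (SUP R\<in>{0<..}. T u y R)" using that by (intro SUP_upper) auto
      also have "\<dots> \<le> ?S" by (intro SUP_upper) auto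
      finally show ?thesis using T_iff[OF that c(2)] c(1) by simp
    qed
    have Id: "I (dilate F (l n) u) x R \<le> ennreal (c powr ?p * R powr -2)" for n
    proof -
      let ?l = "l n"
      have l0: "?l > 0" by (rule l)
      have "z \<in> Q x R \<longleftrightarrow> par_dil ?a ?l z \<in> Q (?l *\<^sub>R x) (?l * R)" for z :: "(real^'n) \<times> real"
      proof (cases z)
        case (Pair y s)
        have "dist (?l *\<^sub>R x) (?l *\<^sub>R y) < ?l * R \<longleftrightarrow> dist x y < R"
          using l0 by (simp add: dist_norm scaleR_diff_right[symmetric])
        moreover have "(?l * R) ^ ?a / 2 < ?l ^ ?a * s \<longleftrightarrow> R ^ ?a / 2 < s"
          using mult_less_cancel_left_pos[of "?l ^ ?a" "R ^ ?a / 2" s] l0 by (simp add: power_mult_distrib)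
        moreover have "?l ^ ?a * s < (?l * R) ^ ?a \<longleftrightarrow> s < R ^ ?a"
          using mult_less_cancel_left_pos[of "?l ^ ?a" s "R ^ ?a"] l0 by (simp add: power_mult_distrib)
        ultimately show ?thesis by (simp add: Pair Q_def par_dil_def)
      qed
      then have ind: "indicator (Q x R) z = (indicator (Q (?l *\<^sub>R x) (?l * R)) (par_dil ?a ?l z) :: ennreal)" for z
        by (simp add: indicator_def)
      let ?G = "\<lambda>z. ennreal (norm (h u z) powr ?p) * indicator (Q (?l *\<^sub>R x) (?l * R)) z"
      have Gm: "?G \<in> borel_measurable lebesgue"
        using hu Qm by measurable
      have "I (dilate F ?l u) x R = (\<integral>\<^sup>+z. ennreal (?l powr ?p) * ?G (par_dil ?a ?l z) \<partial>lebesgue)"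
        unfolding I_def hdil ind using l0
        by (intro nn_integral_cong) (simp add: powr_mult ennreal_mult mult.assoc)
      also have "\<dots> = ennreal (?l powr ?p) * (\<integral>\<^sup>+z. ?G (par_dil ?a ?l z) \<partial>lebesgue)"
        using measurable_compose[OF lebesgue_par_dil(2)[OF l0] Gm] by (intro nn_integral_cmult)
      finally have 1: "I (dilate F ?l u) x R = ennreal (?l powr ?p) * (\<integral>\<^sup>+z. ?G (par_dil ?a ?l z) \<partial>lebesgue)" .
      have 2: "I u (?l *\<^sub>R x) (?l * R) = ennreal (?l ^ (CARD('n) + ?a)) * (\<integral>\<^sup>+z. ?G (par_dil ?a ?l z) \<partial>lebesgue)"
        unfolding I_def by (rule nn_integral_par_dil[OF l0 Gm])
      have "?l powr ?p = ?l ^ 2 * ?l ^ (CARD('n) + ?a)"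
        unfolding powr_realpow[OF l0] power_add by (simp only: mult_ac)
      then have "I (dilate F ?l u) x R = ennreal (?l ^ 2) * I u (?l *\<^sub>R x) (?l * R)"
        unfolding 1 2 using l0 by (simp add: ennreal_mult mult.assoc)
      also have "\<dots> \<le> ennreal (?l ^ 2) * ennreal (c powr ?p * (?l * R) powr -2)"
        using l0 R by (intro mult_left_mono Iu) auto
      also have "\<dots> = ennreal (c powr ?p * R powr -2)"
      proof -
        have "?l ^ 2 * (c powr ?p * (?l * R) powr -2) = c powr ?p * R powr -2"
          using l0 R by (simp add: powr_mult powr_minus powr_numeral)
        then show ?thesis by (simp add: ennreal_mult[symmetric])
      qed
      finally show ?thesis .
    qed
    have "I W x R \<le> liminf (\<lambda>n. I (dilate F (l n) u) x R)"
    proof -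
      have eqz: "ennreal (norm (h W z) powr ?p) * indicator (Q x R) z
          = liminf (\<lambda>n. ennreal (norm (h (dilate F (l n) u) z) powr ?p) * indicator (Q x R) z)" for z
      proof (rule lim_imp_Liminf[symmetric])
        have "(\<lambda>n. ennreal (norm (h (dilate F (l n) u) z) powr ?p)) \<longlonglongrightarrow> ennreal (norm (h W z) powr ?p)"
          by (intro tendsto_ennrealI tendsto_powr2 tendsto_norm hlim tendsto_const) auto
        then show "(\<lambda>n. ennreal (norm (h (dilate F (l n) u) z) powr ?p) * indicator (Q x R) z)
            \<longlonglongrightarrow> ennreal (norm (h W z) powr ?p) * indicator (Q x R) z"
          by (cases "z \<in> Q x R") simp_all
      qed simp
      have "(\<lambda>z. ennreal (norm (h (dilate F (l n) u) z) powr ?p) * indicator (Q x R) z) \<in> borel_measurable lebesgue" for n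
        using hdm Qm by measurable
      then show ?thesis unfolding I_def eqz by (rule nn_integral_liminf)
    qed
    also have "\<dots> \<le> ennreal (c powr ?p * R powr -2)"
      by (intro Liminf_le always_eventually allI Id) simp
    finally show ?thesis using T_iff[OF R c(2)] c(1) by simp
  next
    case True
    show ?thesis unfolding True by simp
  qed
  have "X_norm F W \<le> X_norm F u"
    unfolding Xu by (intro add_mono SUP_least) (use A S in auto)
  also have "\<dots> \<le> r" using u unfolding X_ball_def by blast
  finally show ?thesis
    using hW unfolding X_ball_def set_borel_measurable_def h_def by blast
qed


section \<open>Convergence to the self-similar solution\<close>

text \<open>The kernels have the same integral norm at all times.\<close>

lemma kernel_convolution_bounded:
  fixes p :: "real^'n::finite \<Rightarrow> real"
  assumes p: "Linf_norm p < \<infinity>"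
  shows "\<exists>M. \<forall>\<tau>>0. \<forall>x. integrable lebesgue (\<lambda>y. kernel F \<tau> (x - y) * p y) \<longrightarrow>
    \<bar>LINT y|lebesgue. kernel F \<tau> (x - y) * p y\<bar> \<le> M"
proof -
  obtain P where P: "Linf_norm p = ennreal P" "P \<ge> 0" using p by (cases "Linf_norm p") auto
  have pP: "AE y in lebesgue. \<bar>p y\<bar> \<le> P"
    using Linf_norm_AE[of p] P by simp
  have "[] \<in> kernel_orders F" by (simp add: kernel_orders_def)
  from kernel_derivative_decay[OF this]
  obtain D where D: "D \<ge> 0" "\<And>z :: real^'n. \<bar>kernel F 1 z\<bar> \<le> D * cauchy_weight z" by auto
  define W where "W = (\<integral>\<^sup>+y. ennreal (cauchy_weight (y :: real^'n)) \<partial>lborel)"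
  have W: "W < \<infinity>"
    using integrableD(2)[OF integrable_cauchy_weight] unfolding W_def
    by (simp add: less_top abs_of_pos[OF cauchy_weight_pos])
  have "\<bar>LINT y|lebesgue. kernel F \<tau> (x - y) * p y\<bar> \<le> enn2real (ennreal (P * D) * W)"
    if \<tau>: "\<tau> > 0" and i: "integrable lebesgue (\<lambda>y. kernel F \<tau> (x - y) * p y)" for \<tau> x
  proof -
    define c where "c = \<tau> powr (- 1 / real (flow_order F))"
    have c: "c > 0" and 1: "\<tau> * c ^ flow_order F = 1"
      unfolding c_def by (fact inverse_root_time[OF \<tau>])+
    have k: "\<bar>kernel F \<tau> (x - y)\<bar> \<le> D * (c ^ CARD('n) * cauchy_weight (c *\<^sub>R (x - y)))" for y
      unfolding kernel_self_similar[OF c 1] abs_mult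
      using mult_left_mono[OF D(2)[of "c *\<^sub>R (x - y)"], of "c ^ CARD('n)"] c by (simp add: mult_ac)
    have "ennreal (norm (LINT y|lebesgue. kernel F \<tau> (x - y) * p y)) \<le> (\<integral>\<^sup>+y. ennreal (norm (kernel F \<tau> (x - y) * p y)) \<partial>lebesgue)"
      by (rule integral_norm_bound_ennreal[OF i])
    also have "\<dots> \<le> (\<integral>\<^sup>+y. ennreal (P * D) * ennreal (c ^ CARD('n) * cauchy_weight (c *\<^sub>R (x - y))) \<partial>lebesgue)"
    proof (rule nn_integral_mono_AE, use pP in eventually_elim)
      fix y assume y: "\<bar>p y\<bar> \<le> P"
      have "norm (kernel F \<tau> (x - y) * p y) \<le> (D * (c ^ CARD('n) * cauchy_weight (c *\<^sub>R (x - y)))) * P"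
        unfolding real_norm_def abs_mult using k[of y] y by (intro mult_mono) auto
      then show "ennreal (norm (kernel F \<tau> (x - y) * p y)) \<le> ennreal (P * D) * ennreal (c ^ CARD('n) * cauchy_weight (c *\<^sub>R (x - y)))"
        using P D c by (subst ennreal_mult[symmetric]) (auto intro!: ennreal_leI mult_nonneg_nonneg less_imp_le[OF cauchy_weight_pos] simp: mult_ac)
    qed
    also have "\<dots> = ennreal (P * D) * W"
      unfolding nn_integral_completion W_def nn_integral_cauchy_weight_dilate[OF c, of x, symmetric]
      by (rule nn_integral_cmult) measurable
    finally have "ennreal \<bar>LINT y|lebesgue. kernel F \<tau> (x - y) * p y\<bar> \<le> ennreal (P * D) * W" by simp
    moreover have "ennreal (P * D) * W < \<infinity>" using W by (simp add: ennreal_mult_less_top)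
    ultimately show ?thesis
      by (metis enn2real_ennreal enn2real_mono abs_ge_zero infinity_ennreal_def)
  qed
  then show ?thesis by blast
qed

lemma lipschitz_pointwise_imp_uniform_on_compact:
  fixes g :: "nat \<Rightarrow> 'a::metric_space \<Rightarrow> real"
  assumes K: "compact K" and lip: "\<And>n x y. \<bar>g n x - g n y\<bar> \<le> L * dist x y"
    and lim: "\<And>x. (\<lambda>n. g n x) \<longlonglongrightarrow> 0" and e: "e > 0"
  shows "eventually (\<lambda>n. \<forall>x\<in>K. \<bar>g n x\<bar> \<le> e) sequentially"
proof -
  define d where "d = e / (2 * (\<bar>L\<bar> + 1))"
  have d: "d > 0" using e by (simp add: d_def)
  obtain A where A: "finite A" "K \<subseteq> (\<Union>x\<in>A. ball x d)"
    using K d unfolding compact_eq_totally_bounded by blast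
  have "eventually (\<lambda>n. \<forall>x\<in>A. \<bar>g n x\<bar> < e / 2) sequentially"
  proof (intro eventually_ball_finite A(1) ballI)
    fix x
    show "eventually (\<lambda>n. \<bar>g n x\<bar> < e / 2) sequentially"
      using order_tendstoD(2)[OF tendsto_rabs_zero[OF lim[of x]], of "e / 2"] e by simp
  qed
  then show ?thesis
  proof eventually_elim
    case (elim n)
    show ?case
    proof
      fix x assume "x \<in> K"
      then obtain a where a: "a \<in> A" "dist a x < d" using A(2) by auto
      have "\<bar>g n x - g n a\<bar> \<le> L * dist x a" by (rule lip)
      also have "\<dots> \<le> (\<bar>L\<bar> + 1) * d" using a by (intro mult_mono) (auto simp: dist_commute)
      also have "\<dots> = e / 2" by (simp add: d_def field_simps)
      finally have "\<bar>g n x - g n a\<bar> \<le> e / 2" .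
      moreover have "\<bar>g n a\<bar> < e / 2" using elim a(1) by blast
      ultimately show "\<bar>g n x\<bar> \<le> e" by linarith
    qed
  qed
qed

lemma Ck_norm_tendsto_0:
  fixes g :: "nat \<Rightarrow> real^'n::finite \<Rightarrow> real"
  assumes K: "compact K" and sm: "\<And>n. axis_smooth (g n)"
    and bd: "\<And>is. is \<noteq> [] \<Longrightarrow> \<exists>B. \<forall>n x. \<bar>partials is (g n) x\<bar> \<le> B"
    and lim: "\<And>is x. (\<lambda>n. partials is (g n) x) \<longlonglongrightarrow> 0"
  shows "(\<lambda>n. Ck_norm k K (g n)) \<longlonglongrightarrow> 0"
proof -
  have "\<exists>B. \<forall>n i x. \<bar>partial i (partials is (g n)) x\<bar> \<le> B" for "is"
  proof -
    obtain B where B: "\<And>i n x. \<bar>partials (i # is) (g n) x\<bar> \<le> B i"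
      using bd[of "_ # is"] by (metis list.distinct(1))
    have "\<bar>partial i (partials is (g n)) x\<bar> \<le> (\<Sum>i\<in>UNIV. \<bar>B i\<bar>)" for n i x
    proof -
      have "\<bar>partial i (partials is (g n)) x\<bar> \<le> \<bar>B i\<bar>" using B[where i = i and n = n and x = x] by simp
      also have "\<dots> \<le> (\<Sum>i\<in>UNIV. \<bar>B i\<bar>)" by (rule member_le_sum) auto
      finally show ?thesis .
    qed
    then show ?thesis by blast
  qed
  then obtain B where B: "\<And>is n i x. \<bar>partial i (partials is (g n)) x\<bar> \<le> B is" by metis
  have C: "C_class k (g n)" for n
    unfolding C_class_def
    using axis_smoothD[OF sm] bounded_partials_imp_continuous[OF axis_smoothD[OF sm] B] by blast
  have small: "eventually (\<lambda>n. Ck_norm k K (g n) \<le> ennreal e) sequentially" if e: "e > 0" for e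
  proof -
    have "eventually (\<lambda>n. \<forall>is\<in>{is. length is \<le> k}. \<forall>x\<in>K. \<bar>partials is (g n) x\<bar> \<le> e) sequentially"
    proof (rule eventually_ball_finite)
      have "{is :: 'n list. length is \<le> k} = {is. set is \<subseteq> UNIV \<and> length is \<le> k}" by auto
      then show "finite {is :: 'n list. length is \<le> k}"
        using finite_lists_length_le[of "UNIV :: 'n set" k] by simp
      show "\<forall>is\<in>{is. length is \<le> k}. eventually (\<lambda>n. \<forall>x\<in>K. \<bar>partials is (g n) x\<bar> \<le> e) sequentially"
      proof
        fix "is" :: "'n list"
        show "eventually (\<lambda>n. \<forall>x\<in>K. \<bar>partials is (g n) x\<bar> \<le> e) sequentially"
        using bounded_partials_imp_lipschitz[OF axis_smoothD[OF sm] B]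
        by (intro lipschitz_pointwise_imp_uniform_on_compact[OF K _ lim e, where L = "B is * real CARD('n)"])
           (simp add: dist_norm)
      qed
    qed
    then show ?thesis
    proof eventually_elim
      case (elim n)
      then show ?case unfolding Ck_norm_def using C[of n] by (auto intro!: SUP_least ennreal_leI)
    qed
  qed
  show ?thesis
  proof (rule order_tendstoI)
    fix a :: ennreal assume "0 < a"
    then obtain b where b: "0 < b" "b < a" using dense by blast
    then obtain e where e: "b = ennreal e" "e \<ge> 0" by (cases b) auto
    have "e > 0" using b e by (simp add: ennreal_less_zero_iff)
    from small[OF this] show "eventually (\<lambda>n. Ck_norm k K (g n) < a) sequentially"
      by eventually_elim (use b e in auto)
  qed simp
qed

lemma X_ball_mono: "u \<in> X_ball F r \<Longrightarrow> r \<le> r' \<Longrightarrow> u \<in> X_ball F r'"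
  unfolding X_ball_def by (auto intro: order_trans)

text \<open>Dilation fixes \<open>v0\<close> and divides the sup norm of \<open>p\<close> by \<open>l\<close>, so the linear parts converge to that of
  \<open>v0\<close>. Every limit along a subsequence is therefore a solution with data \<open>v0\<close> in the ball where
  such a solution is unique. Uniqueness also transfers the derivative bounds to \<open>v\<close>.\<close>

lemma dilated_solutions_subconverge:
  fixes v0 p :: "real^'n::finite \<Rightarrow> real" and u v :: "real^'n \<Rightarrow> real \<Rightarrow> real" and l :: "nat \<Rightarrow> real"
  assumes adm: "admissible_form F f"
    and unique: "\<And>w. mild_solution F f v0 w \<Longrightarrow> w \<in> X_ball F r \<Longrightarrow> (\<forall>x. \<forall>t\<ge>0. w x t = v x t)"
    and hom: "\<And>\<mu> x. \<mu> > 0 \<Longrightarrow> v0 x = inverse \<mu> * v0 (\<mu> *\<^sub>R x)"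
    and p: "Linf_norm p < \<infinity>"
    and u: "mild_solution F f (\<lambda>x. v0 x + p x) u" "u \<in> X_ball F r"
    and sb: "slice_bounds F B u" and tb: "time_bound B' u"
    and v: "mild_solution F f v0 v"
    and l: "\<And>n. l n > 0" "filterlim l at_top sequentially"
  shows "\<exists>k. strict_mono (k :: nat \<Rightarrow> nat) \<and> slice_bounds F B v \<and>
    (\<forall>is x. (\<lambda>n. partials is (\<lambda>z. dilate F (l (k n)) u z 1) x) \<longlonglongrightarrow> partials is (\<lambda>z. v z 1) x)"
proof -
  let ?a = "flow_order F"
  obtain k where k: "strict_mono (k :: nat \<Rightarrow> nat)"
      "\<And>i y s. s > 0 \<Longrightarrow> convergent (\<lambda>n. partial i (\<lambda>z. dilate F (l (k n)) u z s) y)"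
    using gradient_convergent_subsequence[of F B "\<lambda>n. dilate F (l n) u" B']
      slice_bounds_dilate[OF sb l(1)] time_bound_dilate[OF sb tb l(1)] by blast
  define w where "w n = dilate F (l (k n)) u" for n
  have lk: "filterlim (\<lambda>n. l (k n)) at_top sequentially"
    using filterlim_compose[OF l(2) filterlim_subseq[OF k(1)]] .
  have sbw: "slice_bounds F B (w n)" for n unfolding w_def by (rule slice_bounds_dilate[OF sb l(1)])
  have v0i: "integrable lebesgue (\<lambda>y. kernel F t (x - y) * v0 y)" if "t > 0" for x t
    using v that unfolding mild_solution_def by blast
  have u0i: "integrable lebesgue (\<lambda>y. kernel F t (x - y) * (v0 y + p y))" if "t > 0" for x t
    using u(1) that unfolding mild_solution_def by blast
  have pi: "integrable lebesgue (\<lambda>y. kernel F t (x - y) * p y)" if "t > 0" for x t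
    using Bochner_Integration.integrable_diff[OF u0i[OF that, of x] v0i[OF that, of x]] by (simp add: distrib_left)
  obtain M where M: "\<And>\<tau> x. \<tau> > 0 \<Longrightarrow> \<bar>LINT y|lebesgue. kernel F \<tau> (x - y) * p y\<bar> \<le> M"
    using kernel_convolution_bounded[OF p, of F] pi by blast
  define a where "a n x t = (LINT y|lebesgue. kernel F t (x - y) * (inverse (l (k n)) * (v0 (l (k n) *\<^sub>R y) + p (l (k n) *\<^sub>R y))))"
    for n x t
  have a_eq: "a n x t = (LINT y|lebesgue. kernel F t (x - y) * v0 y)
      + inverse (l (k n)) * (LINT y|lebesgue. kernel F (l (k n) ^ ?a * t) (l (k n) *\<^sub>R x - y) * p y)"
    if t: "t > 0" for n x t
  proof -
    let ?l = "l (k n)"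
    have lt: "?l ^ ?a * t > 0" using l(1)[of "k n"] t by simp
    note kc = kernel_convolution_dilate(2)[OF l(1) t]
    have "a n x t = inverse ?l * (LINT y|lebesgue. kernel F (?l ^ ?a * t) (?l *\<^sub>R x - y) * (v0 y + p y))"
      unfolding a_def by (rule kc[OF u0i[OF lt]])
    also have "\<dots> = inverse ?l * (LINT y|lebesgue. kernel F (?l ^ ?a * t) (?l *\<^sub>R x - y) * v0 y)
        + inverse ?l * (LINT y|lebesgue. kernel F (?l ^ ?a * t) (?l *\<^sub>R x - y) * p y)"
      using v0i[OF lt] pi[OF lt] by (simp add: distrib_left)
    also have "inverse ?l * (LINT y|lebesgue. kernel F (?l ^ ?a * t) (?l *\<^sub>R x - y) * v0 y)
        = (LINT y|lebesgue. kernel F t (x - y) * (inverse ?l * v0 (?l *\<^sub>R y)))"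
      by (rule kc[OF v0i[OF lt], symmetric])
    also have "\<dots> = (LINT y|lebesgue. kernel F t (x - y) * v0 y)"
      by (simp only: hom[OF l(1), symmetric])
    finally show ?thesis .
  qed
  have lin: "(\<lambda>n. a n x t) \<longlonglongrightarrow> (LINT y|lebesgue. kernel F t (x - y) * v0 y)" if t: "t > 0" for x t
  proof -
    have inv0: "(\<lambda>n. inverse (l (k n))) \<longlonglongrightarrow> 0"
      using tendsto_inverse_0_at_top[OF lk] .
    have "(\<lambda>n. inverse (l (k n)) * (LINT y|lebesgue. kernel F (l (k n) ^ ?a * t) (l (k n) *\<^sub>R x - y) * p y)) \<longlonglongrightarrow> 0"
    proof (rule Lim_null_comparison)
      show "\<forall>\<^sub>F n in sequentially. norm (inverse (l (k n)) * (LINT y|lebesgue. kernel F (l (k n) ^ ?a * t) (l (k n) *\<^sub>R x - y) * p y))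
          \<le> inverse (l (k n)) * M"
      proof (intro always_eventually allI)
        fix n
        have "l (k n) ^ ?a * t > 0" using l(1)[of "k n"] t by simp
        from mult_left_mono[OF M[OF this, of "l (k n) *\<^sub>R x"], of "inverse (l (k n))"] l(1)[of "k n"]
        show "norm (inverse (l (k n)) * (LINT y|lebesgue. kernel F (l (k n) ^ ?a * t) (l (k n) *\<^sub>R x - y) * p y))
          \<le> inverse (l (k n)) * M" by (simp add: abs_mult)
      qed
      show "(\<lambda>n. inverse (l (k n)) * M) \<longlonglongrightarrow> 0" using tendsto_mult_right[OF inv0, of M] by simp
    qed
    from tendsto_add[OF tendsto_const this] show ?thesis unfolding a_eq[OF t] by simp
  qed
  note dil = mild_solution_dilate[OF adm u(1) sb l(1)]
  have "\<exists>W. mild_solution F f v0 W \<and> slice_bounds F B W \<and>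
    (\<forall>t>0. \<forall>is x. (\<lambda>n. partials is (\<lambda>z. w n z t) x) \<longlonglongrightarrow> partials is (\<lambda>z. W z t) x)"
  proof (rule limit_is_mild_solution[OF adm sbw _ _ _ v0i lin])
    show "convergent (\<lambda>n. partial i (\<lambda>z. w n z s) y)" if "s > 0" for i y s
      using k(2)[OF that] unfolding w_def .
    show "set_integrable lborel (slab t) (\<lambda>(y, s). duhamel_integrand F f (w n) x t y s)" if "t > 0" for n x t
      unfolding w_def by (rule dil(2)[OF that])
    show "w n x t = a n x t + (LINT z:slab t|lborel. (\<lambda>(y, s). duhamel_integrand F f (w n) x t y s) z)"
      if "t > 0" for n x t
      unfolding w_def a_def by (rule dil(3)[OF that])
  qed
  then obtain W where W: "mild_solution F f v0 W" "slice_bounds F B W"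
      "\<And>t is x. t > 0 \<Longrightarrow> (\<lambda>n. partials is (\<lambda>z. w n z t) x) \<longlonglongrightarrow> partials is (\<lambda>z. W z t) x" by blast
  have "W \<in> X_ball F r"
    by (rule X_norm_limit_le[OF u(2) sb W(2), of "\<lambda>n. l (k n)"]) (use l(1) W(3) in \<open>auto simp: w_def\<close>)
  from unique[OF W(1) this] have eq: "(\<lambda>z. W z t) = (\<lambda>z. v z t)" if "t > 0" for t using that by auto
  have "slice_bounds F B v"
    using W(2) unfolding slice_bounds_def by (simp add: eq)
  moreover have "(\<lambda>n. partials is (\<lambda>z. dilate F (l (k n)) u z 1) x) \<longlonglongrightarrow> partials is (\<lambda>z. v z 1) x" for "is" x
    using W(3)[of 1 "is" x] unfolding w_def eq[OF zero_less_one] by simp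
  ultimately show ?thesis using k(1) by blast
qed

theorem theorem2p1:
  fixes F :: flow and f :: "('n::finite) coeffs" and \<epsilon>\<^sub>0 C :: real
  assumes dim: "F = WF \<Longrightarrow> CARD('n) = 2"
    and rewriting: "rewrites_flow F f"
    and well_posed: "koch_lamm F f \<epsilon>\<^sub>0 C"
  shows "\<exists>\<epsilon>>0. \<forall>(v0 :: real^'n \<Rightarrow> real) (p :: real^'n \<Rightarrow> real)
             (u :: real^'n \<Rightarrow> real \<Rightarrow> real) (v :: real^'n \<Rightarrow> real \<Rightarrow> real).
           (\<forall>\<mu>>0. \<forall>x. v0 x = inverse \<mu> * v0 (\<mu> *\<^sub>R x)) \<longrightarrow>
           Linf_norm p < \<infinity> \<longrightarrow>
           grad_norm v0 < ennreal \<epsilon> \<longrightarrow>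
           grad_norm p < ennreal \<epsilon> \<longrightarrow>
           global_mild_solution F f C (\<lambda>x. v0 x + p x) u \<longrightarrow>
           global_mild_solution F f C v0 v \<longrightarrow>
           (\<forall>K k. compact K \<longrightarrow> 1 \<le> k \<longrightarrow>
              ((\<lambda>t. Ck_norm k K
                  (\<lambda>x. t powr (- 1 / real (flow_order F)) *
                         u (t powr (1 / real (flow_order F)) *\<^sub>R x) t
                       - v x 1)) \<longlongrightarrow> 0) at_top)"
proof -
  let ?a = "real (flow_order F)"
  have adm: "admissible_form F f" using rewriting unfolding rewrites_flow_def by blast
  have pos: "\<epsilon>\<^sub>0 > 0" "C > 0" using well_posed unfolding koch_lamm_def by auto
  have KL: "\<exists>u. global_mild_solution F f C u0 u \<and>
         (\<forall>u'. mild_solution F f u0 u' \<and> u' \<in> X_ball F (ennreal (C * \<epsilon>\<^sub>0)) \<longrightarrow> (\<forall>x. \<forall>t\<ge>0. u' x t = u x t)) \<and>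
         real_analytic_on (\<lambda>(x, t). u x t) (UNIV \<times> {0<..}) \<and> derivative_bounds F u0 u"
    if "grad_norm u0 < ennreal \<epsilon>\<^sub>0" for u0
    using well_posed that unfolding koch_lamm_def by blast
  have ball: "w \<in> X_ball F (ennreal (C * \<epsilon>\<^sub>0))" if "w \<in> X_ball F (ennreal C * grad_norm u0)" "grad_norm u0 < ennreal \<epsilon>\<^sub>0"
    for w :: "real^'n \<Rightarrow> real \<Rightarrow> real" and u0
  proof (rule X_ball_mono[OF that(1)])
    show "ennreal C * grad_norm u0 \<le> ennreal (C * \<epsilon>\<^sub>0)"
      using that(2) pos by (simp add: ennreal_mult mult_left_mono)
  qed
  show ?thesis
  \<comment> \<open>half of \<open>\<epsilon>\<^sub>0\<close>, so that the sum of the two data is still below \<open>\<epsilon>\<^sub>0\<close>\<close>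
  proof (intro exI[of _ "\<epsilon>\<^sub>0 / 2"] conjI allI impI)
    show "\<epsilon>\<^sub>0 / 2 > 0" using pos by simp
    fix v0 p :: "real^'n \<Rightarrow> real" and u v :: "real^'n \<Rightarrow> real \<Rightarrow> real" and K :: "(real^'n) set" and k :: nat
    assume hom: "\<forall>\<mu>>0. \<forall>x. v0 x = inverse \<mu> * v0 (\<mu> *\<^sub>R x)" and p: "Linf_norm p < \<infinity>"
      and gv: "grad_norm v0 < ennreal (\<epsilon>\<^sub>0 / 2)" and gp: "grad_norm p < ennreal (\<epsilon>\<^sub>0 / 2)"
      and u: "global_mild_solution F f C (\<lambda>x. v0 x + p x) u" and v: "global_mild_solution F f C v0 v"
      and K: "compact K"
    have gu: "grad_norm (\<lambda>x. v0 x + p x) < ennreal \<epsilon>\<^sub>0"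
    proof -
      have "ennreal (\<epsilon>\<^sub>0 / 2) + ennreal (\<epsilon>\<^sub>0 / 2) = ennreal \<epsilon>\<^sub>0"
        using pos by (simp add: ennreal_plus[symmetric] del: ennreal_plus)
      then show ?thesis using grad_norm_add_less[OF gv gp] by simp
    qed
    have gv': "grad_norm v0 < ennreal \<epsilon>\<^sub>0"
    proof -
      have "ennreal (\<epsilon>\<^sub>0 / 2) \<le> ennreal \<epsilon>\<^sub>0" using pos by (intro ennreal_leI) simp
      with gv show ?thesis by (rule less_le_trans)
    qed
    obtain U where U: "global_mild_solution F f C (\<lambda>x. v0 x + p x) U"
        "\<And>u'. mild_solution F f (\<lambda>x. v0 x + p x) u' \<Longrightarrow> u' \<in> X_ball F (ennreal (C * \<epsilon>\<^sub>0)) \<Longrightarrow> (\<forall>x. \<forall>t\<ge>0. u' x t = U x t)"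
        "real_analytic_on (\<lambda>(x, t). U x t) (UNIV \<times> {0<..})" "derivative_bounds F (\<lambda>x. v0 x + p x) U"
      using KL[OF gu] by blast
    obtain V where V: "global_mild_solution F f C v0 V"
        "\<And>u'. mild_solution F f v0 u' \<Longrightarrow> u' \<in> X_ball F (ennreal (C * \<epsilon>\<^sub>0)) \<Longrightarrow> (\<forall>x. \<forall>t\<ge>0. u' x t = V x t)"
      using KL[OF gv'] by blast
    have uU: "u x t = U x t" if "t \<ge> 0" for x t
      using U(2)[of u] u ball[OF _ gu] that unfolding global_mild_solution_def by blast
    have vV: "v x t = V x t" if "t \<ge> 0" for x t
      using V(2)[of v] v ball[OF _ gv'] that unfolding global_mild_solution_def by blast
    have "grad_norm (\<lambda>x. v0 x + p x) < \<infinity>" using gu by (rule less_trans) simp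
    from derivative_bounds_imp_slice_bounds[OF U(3,4) this]
    obtain B B' where sb: "slice_bounds F B U" and tb: "time_bound B' U" by blast
    have UX: "mild_solution F f (\<lambda>x. v0 x + p x) U" "U \<in> X_ball F (ennreal (C * \<epsilon>\<^sub>0))"
      and VX: "mild_solution F f v0 V"
      using U(1) V(1) ball[OF _ gu] unfolding global_mild_solution_def by blast+
    let ?g = "\<lambda>t x. t powr (- 1 / ?a) * u (t powr (1 / ?a) *\<^sub>R x) t - v x 1"
    have g_eq: "?g t = (\<lambda>x. dilate F (t powr (1 / ?a)) U x 1 - V x 1)" if "t > 0" for t
    proof -
      have "(t powr (1 / ?a)) ^ flow_order F = t"
        using that flow_order_pos[of F] by (simp add: powr_realpow[symmetric] powr_powr)
      then show ?thesis using that by (simp add: dilate_def uU vV powr_minus)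
    qed
    show "((\<lambda>t. Ck_norm k K (?g t)) \<longlongrightarrow> 0) at_top"
    proof (rule order_tendstoI)
      fix c :: ennreal assume c: "0 < c"
      show "eventually (\<lambda>t. Ck_norm k K (?g t) < c) at_top"
      proof (rule ccontr)
        assume "\<not> eventually (\<lambda>t. Ck_norm k K (?g t) < c) at_top"
        \<comment> \<open>times this large make the dilation factors at least \<open>m\<close>\<close>
        then have "\<forall>m :: nat. \<exists>t. t \<ge> (real m + 1) ^ flow_order F \<and> \<not> Ck_norm k K (?g t) < c"
          unfolding eventually_at_top_linorder by blast
        from choice[OF this] obtain \<tau> where \<tau>: "\<And>m :: nat. \<tau> m \<ge> (real m + 1) ^ flow_order F" "\<And>m. \<not> Ck_norm k K (?g (\<tau> m)) < c" by blast
        define l where "l m = \<tau> m powr (1 / ?a)" for m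
        have \<tau>0: "\<tau> m > 0" for m
          by (rule less_le_trans[OF _ \<tau>(1)]) (simp add: add_nonneg_pos)
        have l0: "l m > 0" for m using \<tau>0[of m] by (simp add: l_def)
        have "real m \<le> l m" for m
        proof -
          have m0: "real m + 1 > 0" by (simp add: add_nonneg_pos)
          have "real m + 1 = ((real m + 1) ^ flow_order F) powr (1 / ?a)"
            using power_flow_order_powr[OF m0, of F 1] by simp
          also have "\<dots> \<le> l m" unfolding l_def using \<tau>(1)[of m] by (intro powr_mono2) auto
          finally show ?thesis by linarith
        qed
        then have l1: "filterlim l at_top sequentially"
          by (intro filterlim_at_top_mono[OF filterlim_real_sequentially] always_eventually allI)
        have hom': "\<And>\<mu> x. \<mu> > 0 \<Longrightarrow> v0 x = inverse \<mu> * v0 (\<mu> *\<^sub>R x)" using hom by blast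
        obtain j where j: "strict_mono (j :: nat \<Rightarrow> nat)" "slice_bounds F B V"
          "\<And>is x. (\<lambda>n. partials is (\<lambda>z. dilate F (l (j n)) U z 1) x) \<longlonglongrightarrow> partials is (\<lambda>z. V z 1) x"
          using dilated_solutions_subconverge[OF adm V(2) hom' p UX sb tb VX l0 l1] by blast
        have smU: "axis_smooth (\<lambda>z. dilate F (l (j n)) U z 1)" for n
          using slice_bounds_dilate[OF sb l0] unfolding slice_bounds_def by simp
        have smV: "axis_smooth (\<lambda>z. V z 1)" using j(2) unfolding slice_bounds_def by simp
        have "(\<lambda>n. Ck_norm k K (\<lambda>x. dilate F (l (j n)) U x 1 - V x 1)) \<longlonglongrightarrow> 0"
        proof (rule Ck_norm_tendsto_0[OF K axis_smooth_diff[OF smU smV]])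
          fix "is" :: "'n list"
          show "(\<lambda>n. partials is (\<lambda>x. dilate F (l (j n)) U x 1 - V x 1) x) \<longlonglongrightarrow> 0" for x
            unfolding partials_diff[OF smU smV] using LIM_zero[OF j(3)] .
          assume ne: "is \<noteq> []"
          have "\<bar>partials is (\<lambda>x. dilate F (l (j n)) U x 1 - V x 1) x\<bar> \<le> B (length is - 1) + B (length is - 1)" for n x
          proof -
            have "\<bar>partials is (\<lambda>z. dilate F (l (j n)) U z 1) x\<bar> \<le> B (length is - 1)"
              using slice_bounds_partials[OF slice_bounds_dilate[OF sb l0] zero_less_one ne] by simp
            moreover have "\<bar>partials is (\<lambda>z. V z 1) x\<bar> \<le> B (length is - 1)"
              using slice_bounds_partials[OF j(2) zero_less_one ne] by simp
            ultimately show ?thesis unfolding partials_diff[OF smU smV] by linarith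
          qed
          then show "\<exists>D. \<forall>n x. \<bar>partials is (\<lambda>x. dilate F (l (j n)) U x 1 - V x 1) x\<bar> \<le> D" by blast
        qed
        from order_tendstoD(2)[OF this c]
        obtain n where "Ck_norm k K (\<lambda>x. dilate F (l (j n)) U x 1 - V x 1) < c"
          by (auto simp: eventually_sequentially)
        then have "Ck_norm k K (?g (\<tau> (j n))) < c" unfolding g_eq[OF \<tau>0] l_def .
        then show False using \<tau>(2) by blast
      qed
    qed simp
  qed
qed

end
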